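(* Let $k,l,m$ be positive integers with $l\le m$, let $n=k(m-l)+l$, let $K$ be a field and $R=K[x_1,\dots,x_n]$. Let $\mathcal{C}_{m,l,k}$ be the clutter on the vertex set $\{x_1,\dots,x_n\}$ with edge set $\{E_1,\dots,E_k\}$, where $E_i=\{x_{(i-1)(m-l)+1},x_{(i-1)(m-l)+2},\dots,x_{(i-1)(m-l)+m}\}$ for $i=1,\dots,k$, and let $I_{m,l,k}=I(\mathcal{C}_{m,l,k})\subseteq R$ be its edge ideal. Then the quotient ring $R/I_{m,l,k}$ is sequentially Cohen-Macaulay.
   Context: A clutter on a vertex set $V$ is a family of subsets of $V$ (called edges), none of which is included in another. The edge ideal $I(\mathcal{C})$ of a clutter $\mathcal{C}$ on $\{x_1,\dots,x_n\}$ is the squarefree monomial ideal of $R=K[x_1,\dots,x_n]$ generated by the monomials $\prod_{x_j\in E}x_j$, where $E$ ranges over the edges of $\mathcal{C}$. Thus $I_{m,l,k}=(u_1,\dots,u_k)$ with $u_i=\prod_{j=1}^{m}x_{(i-1)(m-l)+j}$. $R$ is graded in the standard way ($\deg x_i=1$). A graded $R$-module $M$ is called sequentially Cohen-Macaulay if there is a filtration $0=M_0\subset M_1\subset\cdots\subset M_r=M$ by graded $R$-submodules such that each quotient $M_i/M_{i-1}$ is Cohen-Macaulay and $\dim(M_1/M_0)<\dim(M_2/M_1)<\cdots<\dim(M_r/M_{r-1})$ (Krull dimensions). The quotient ring $R/I_{m,l,k}$ is regarded as a graded $R$-module. *)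

theory Defs
  imports "HOL-Algebra.QuotRing" "HOL-Algebra.Module"
    "HOL-Library.Poly_Mapping" "HOL-Library.Extended_Real"
begin

section \<open>Modules over a commutative ring\<close>

definition ring_as_module :: "'a ring \<Rightarrow> ('a, 'a) module" where
  "ring_as_module R = ring.extend R (module.fields (mult R))"

text \<open>
  The underlying ring record is the library quotient \<open>M Quot N\<close>. Its multiplicative
  fields mean something only if those of \<open>M\<close> do; for an ideal \<open>I\<close> of \<open>R\<close>,
  \<open>quot_module (ring_as_module R) I\<close> is the quotient ring \<open>R/I\<close> with its \<open>R\<close>-module
  structure. The union in the scalar multiplication is that of a single coset.
\<close>
definition quot_module :: "('a, 'b) module \<Rightarrow> 'b set \<Rightarrow> ('a, 'b set) module" where
  "quot_module M N =
     ring.extend (M Quot N) (module.fields (\<lambda>a X. \<Union>x\<in>X. N +>\<^bsub>M\<^esub> (a \<odot>\<^bsub>M\<^esub> x)))"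

definition annihilator :: "'a ring \<Rightarrow> ('a, 'b) module \<Rightarrow> 'a set" where
  "annihilator R M = {a \<in> carrier R. \<forall>x \<in> carrier M. a \<odot>\<^bsub>M\<^esub> x = \<zero>\<^bsub>M\<^esub>}"

text \<open>Suprema are taken in the extended reals, so the zero ring has dimension \<open>-\<infinity>\<close>.\<close>
definition krull_dim :: "'a ring \<Rightarrow> ereal" where
  "krull_dim R = Sup {ereal (real n) | n. \<exists>P :: nat \<Rightarrow> 'a set.
     (\<forall>i\<le>n. primeideal (P i) R) \<and> (\<forall>i<n. P i \<subset> P (Suc i))}"

definition module_dim :: "'a ring \<Rightarrow> ('a, 'b) module \<Rightarrow> ereal" where
  "module_dim R M = krull_dim (R Quot annihilator R M)"

text \<open>The submodule \<open>(S)M\<close> of \<open>M\<close>, for a set \<open>S\<close> of ring elements.\<close>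
definition ideal_smult :: "'a ring \<Rightarrow> 'a set \<Rightarrow> ('a, 'b) module \<Rightarrow> 'b set" where
  "ideal_smult R S M =
     \<Inter>{N. submodule N R M \<and> (\<forall>a\<in>S. \<forall>x\<in>carrier M. a \<odot>\<^bsub>M\<^esub> x \<in> N)}"

definition nonzerodivisor_on :: "'a \<Rightarrow> ('a, 'b) module \<Rightarrow> bool" where
  "nonzerodivisor_on a M \<longleftrightarrow> (\<forall>x\<in>carrier M. a \<odot>\<^bsub>M\<^esub> x = \<zero>\<^bsub>M\<^esub> \<longrightarrow> x = \<zero>\<^bsub>M\<^esub>)"

definition regular_sequence :: "'a ring \<Rightarrow> ('a, 'b) module \<Rightarrow> 'a list \<Rightarrow> bool" where
  "regular_sequence R M as \<longleftrightarrow>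
     set as \<subseteq> carrier R \<and>
     (\<forall>i<length as.
        nonzerodivisor_on (as ! i) (quot_module M (ideal_smult R (set (take i as)) M))) \<and>
     ideal_smult R (set as) M \<noteq> carrier M"

definition depth :: "'a ring \<Rightarrow> 'a set \<Rightarrow> ('a, 'b) module \<Rightarrow> ereal" where
  "depth R J M =
     Sup {ereal (real (length as)) | as. set as \<subseteq> J \<and> regular_sequence R M as}"

section \<open>Graded modules\<close>

text \<open>\<open>M\<close> is the internal direct sum of the additive subgroups \<open>G d\<close>, \<open>d \<in> \<int>\<close>.\<close>
definition graded_group :: "('b, 'c) ring_scheme \<Rightarrow> (int \<Rightarrow> 'b set) \<Rightarrow> bool" where
  "graded_group M G \<longleftrightarrow>
     abelian_group M \<and> (\<forall>d. additive_subgroup (G d) M) \<and>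
     (\<forall>x\<in>carrier M. \<exists>!y. (\<forall>d. y d \<in> G d) \<and> finite {d. y d \<noteq> \<zero>\<^bsub>M\<^esub>} \<and>
        x = (\<Oplus>\<^bsub>M\<^esub>d\<in>{d. y d \<noteq> \<zero>\<^bsub>M\<^esub>}. y d))"

definition graded_ring :: "'a ring \<Rightarrow> (int \<Rightarrow> 'a set) \<Rightarrow> bool" where
  "graded_ring R A \<longleftrightarrow> cring R \<and> graded_group R A \<and>
     (\<forall>i j. \<forall>a\<in>A i. \<forall>b\<in>A j. a \<otimes>\<^bsub>R\<^esub> b \<in> A (i + j))"

definition graded_module ::
  "'a ring \<Rightarrow> (int \<Rightarrow> 'a set) \<Rightarrow> ('a, 'b) module \<Rightarrow> (int \<Rightarrow> 'b set) \<Rightarrow> bool" where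
  "graded_module R A M G \<longleftrightarrow> graded_ring R A \<and> Module.module R M \<and> graded_group M G \<and>
     (\<forall>i j. \<forall>a\<in>A i. \<forall>x\<in>G j. a \<odot>\<^bsub>M\<^esub> x \<in> G (i + j))"

definition graded_submodule ::
  "'b set \<Rightarrow> 'a ring \<Rightarrow> ('a, 'b) module \<Rightarrow> (int \<Rightarrow> 'b set) \<Rightarrow> bool" where
  "graded_submodule N R M G \<longleftrightarrow>
     submodule N R M \<and> graded_group (M\<lparr>carrier := N\<rparr>) (\<lambda>d. N \<inter> G d)"

definition quot_grading ::
  "('a, 'b) module \<Rightarrow> 'b set \<Rightarrow> (int \<Rightarrow> 'b set) \<Rightarrow> int \<Rightarrow> 'b set set" where
  "quot_grading M N G d = (\<lambda>x. N +>\<^bsub>M\<^esub> x) ` G d"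

definition irrelevant_ideal :: "'a ring \<Rightarrow> (int \<Rightarrow> 'a set) \<Rightarrow> 'a set" where
  "irrelevant_ideal R A = Idl\<^bsub>R\<^esub> (\<Union>d\<in>{0<..}. A d)"

text \<open>
  The graded notion, for standard graded algebras over a field: the depth is taken with respect
  to the graded maximal ideal \<open>R\<^sub>+\<close>.
\<close>
definition cohen_macaulay ::
  "'a ring \<Rightarrow> (int \<Rightarrow> 'a set) \<Rightarrow> ('a, 'b) module \<Rightarrow> bool" where
  "cohen_macaulay R A M \<longleftrightarrow> depth R (irrelevant_ideal R A) M = module_dim R M"

definition sequentially_cohen_macaulay ::
  "'a ring \<Rightarrow> (int \<Rightarrow> 'a set) \<Rightarrow> ('a, 'b) module \<Rightarrow> (int \<Rightarrow> 'b set) \<Rightarrow> bool" where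
  "sequentially_cohen_macaulay R A M G \<longleftrightarrow>
     graded_module R A M G \<and>
     (\<exists>(r :: nat) (F :: nat \<Rightarrow> 'b set).
        let Q = (\<lambda>i. quot_module (M\<lparr>carrier := F (Suc i)\<rparr>) (F i)) in
        F 0 = {\<zero>\<^bsub>M\<^esub>} \<and> F r = carrier M \<and>
        (\<forall>i\<le>r. graded_submodule (F i) R M G) \<and>
        (\<forall>i<r. F i \<subset> F (Suc i)) \<and>
        (\<forall>i<r. cohen_macaulay R A (Q i)) \<and>
        (\<forall>i. Suc i < r \<longrightarrow> module_dim R (Q i) < module_dim R (Q (Suc i))))"

section \<open>Polynomial rings\<close>

text \<open>
  A polynomial is a finitely supported map from exponent vectors to coefficients, with the
  convolution product of \<^theory>\<open>HOL-Library.Poly_Mapping\<close>.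
\<close>
type_synonym 'k mpoly = "(nat \<Rightarrow>\<^sub>0 nat) \<Rightarrow>\<^sub>0 'k"

definition var :: "nat \<Rightarrow> 'k::field mpoly" where
  "var j = Poly_Mapping.single (Poly_Mapping.single j 1) 1"

text \<open>\<open>K[x\<^sub>1,\<dots>,x\<^sub>n]\<close>\<close>
definition poly_ring :: "nat \<Rightarrow> 'k::field mpoly ring" where
  "poly_ring n =
     \<lparr>carrier = {p. \<forall>t \<in> Poly_Mapping.keys p. Poly_Mapping.keys t \<subseteq> {1..n}},
      mult = (*), one = 1, zero = 0, add = (+)\<rparr>"

definition monom_deg :: "(nat \<Rightarrow>\<^sub>0 nat) \<Rightarrow> nat" where
  "monom_deg t = (\<Sum>j\<in>Poly_Mapping.keys t. Poly_Mapping.lookup t j)"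

definition poly_grading :: "nat \<Rightarrow> int \<Rightarrow> 'k::field mpoly set" where
  "poly_grading n d =
     {p \<in> carrier (poly_ring n). \<forall>t \<in> Poly_Mapping.keys p. int (monom_deg t) = d}"

section \<open>Clutters and edge ideals\<close>

text \<open>Vertices are the indices \<open>j\<close> of the variables \<open>x\<^sub>j\<close>.\<close>

definition clutter :: "nat set \<Rightarrow> nat set set \<Rightarrow> bool" where
  "clutter V C \<longleftrightarrow> (\<forall>E\<in>C. E \<subseteq> V) \<and> (\<forall>E\<in>C. \<forall>E'\<in>C. E \<subseteq> E' \<longrightarrow> E = E')"

definition edge_ideal :: "nat \<Rightarrow> nat set set \<Rightarrow> 'k::field mpoly set" where
  "edge_ideal n C = Idl\<^bsub>poly_ring n\<^esub> ((\<lambda>E. \<Prod>j\<in>E. var j) ` C)"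

definition path_clutter :: "nat \<Rightarrow> nat \<Rightarrow> nat \<Rightarrow> nat set set" where
  "path_clutter m l k = (\<lambda>i. {(i - 1) * (m - l) + 1..(i - 1) * (m - l) + m}) ` {1..k}"

lemma clutter_path_clutter:
  assumes "0 < m" "l \<le> m" "n = k * (m - l) + l"
  shows "clutter {1..n} (path_clutter m l k)"
  unfolding clutter_def
proof (intro conjI ballI impI)
  fix E assume "E \<in> path_clutter m l k"
  then obtain i where i: "1 \<le> i" "i \<le> k"
    and E: "E = {(i - 1) * (m - l) + 1..(i - 1) * (m - l) + m}"
    by (auto simp: path_clutter_def)
  have "(i - 1) * (m - l) + m = i * (m - l) + l"
    using i assms(2) by (cases i) auto
  also have "\<dots> \<le> n"
    using i assms(3) by (simp add: mult_le_mono1)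
  finally show "E \<subseteq> {1..n}"
    unfolding E by auto
next
  fix E E' assume "E \<in> path_clutter m l k" "E' \<in> path_clutter m l k" "E \<subseteq> E'"
  moreover from this have "finite E'" "card E = m" "card E' = m"
    by (auto simp: path_clutter_def)
  ultimately show "E = E'"
    by (simp add: card_subset_eq)
qed

end

theory Submission
  imports Defs "HOL-Algebra.Ring_Divisibility" "HOL-Library.Nat_Bijection"
begin

text \<open>
  Scan the windows \<open>E\<^sub>1, \<dots>, E\<^sub>k\<close> from left to right and hit each window not yet hit as far to the
  right as possible outside the support of a monomial \<open>u\<close>; this gives a minimum transversal
  \<open>T(u)\<close> avoiding the support of \<open>u\<close>. The monomials outside \<open>I\<close> with a given transversal \<open>T\<close>
  are exactly those whose support lies in an interval \<open>[r, F]\<close> of sets, where \<open>F\<close> is the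
  complement of \<open>T\<close>, so they span a shifted copy of the polynomial ring in the variables of \<open>F\<close>.
  Multiplying \<open>u\<close> by a monomial makes \<open>T(u)\<close> larger, or keeps its size and moves its elements
  to the left. Hence the sets \<open>{u. card T(u) \<ge> c}\<close> span ideals whose successive quotients are
  filtered by such shifted polynomial rings in \<open>d = n - c\<close> variables, on all of which the
  elementary symmetric polynomials \<open>e\<^sub>d, \<dots>, e\<^sub>1\<close> of \<open>x\<^sub>1, \<dots>, x\<^sub>n\<close> form a regular sequence.
  The dimension of a quotient is at most \<open>d\<close>, because primes over its annihilator contain the
  variables of some \<open>T\<close> and \<open>K[F]\<close> has dimension at most \<open>d\<close> (by counting monomials), and it is at
  least the depth.
\<close>

section \<open>Prime chains\<close>

text \<open>A regular sequence is needed that serves all the shifted copies of K[F] in a stratum at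
  once, while F varies. The variables of one F fail for another; the elementary symmetric
  polynomials do not depend on F, and being homogeneous of positive degree they lie in R_+. The
  order e_d, ..., e_1 is chosen because modulo the variables outside F the first of them is a
  monomial, which keeps every step combinatorial. The filtration consists of submodules of a
  quotient, so its factors have sets of sets of polynomials as elements. The arguments therefore
  concern pairs B \<subseteq> A of sets of polynomials, and the locale \<open>presentation\<close>
  carries the results over to the modules. Hitting windows as far right as possible makes the
  transversal monotone: forbidding further vertices can only push a pick to the left, and an earlier
  pick leaves more windows to be hit. The greedy choice thus gives the codimension of the stratum
  and the order of the shelling at the same time.\<close>

lemma (in cring) exists_prime_avoiding:
  assumes J: "ideal J R" and S: "S \<subseteq> carrier R" "\<one> \<in> S"
    and mult: "\<And>x y. x \<in> S \<Longrightarrow> y \<in> S \<Longrightarrow> x \<otimes> y \<in> S"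
    and disj: "J \<inter> S = {}"
  obtains P where "primeideal P R" "J \<subseteq> P" "P \<inter> S = {}"
proof -
  let ?\<A> = "{I. ideal I R \<and> J \<subseteq> I \<and> I \<inter> S = {}}"
  have "\<exists>M\<in>?\<A>. \<forall>X\<in>?\<A>. M \<subseteq> X \<longrightarrow> X = M"
  proof (rule subset_Zorn_nonempty)
    show "?\<A> \<noteq> {}" using J disj by blast
    fix \<C> assume ne: "\<C> \<noteq> {}" and ch: "subset.chain ?\<A> \<C>"
    then have "subset.chain {I. ideal I R} \<C>"
      by (auto simp: subset_chain_def)
    from chain_Union_is_ideal[OF this] ne ch show "\<Union>\<C> \<in> ?\<A>"
      by (auto simp: subset_chain_def)
  qed
  then obtain P where "P \<in> ?\<A>" and max': "\<forall>X\<in>?\<A>. P \<subseteq> X \<longrightarrow> X = P" ..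
  then have P: "ideal P R" "J \<subseteq> P" "P \<inter> S = {}" by simp_all
  have max: "X = P" if "ideal X R" "J \<subseteq> X" "X \<inter> S = {}" "P \<subseteq> X" for X
    using max' that by simp
  interpret P: ideal P R by fact
  \<comment> \<open>P + (a) is an ideal strictly larger than P, so by maximality it meets S.\<close>
  have meet: "\<exists>p r. p \<in> P \<and> r \<in> carrier R \<and> p \<oplus> r \<otimes> a \<in> S" if a: "a \<in> carrier R" "a \<notin> P" for a
  proof -
    let ?X = "P <+>\<^bsub>R\<^esub> PIdl a"
    have X: "ideal ?X R" by (intro add_ideals P cgenideal_ideal a)
    have memI: "x \<oplus> y \<in> ?X" if "x \<in> P" "y \<in> PIdl a" for x y
      using that by (auto simp: set_add_def')
    have sub: "P \<subseteq> ?X"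
    proof
      fix p assume p: "p \<in> P"
      have "\<zero> \<in> PIdl a" using additive_subgroup.zero_closed[OF ideal.axioms(1)[OF cgenideal_ideal[OF a(1)]]] .
      from memI[OF p this] show "p \<in> ?X" using P.a_Hcarr[OF p] by simp
    qed
    have "a \<in> ?X" using memI[OF P.zero_closed cgenideal_self[OF a(1)]] a(1) by simp
    then have "?X \<noteq> P" using a by blast
    then have "?X \<inter> S \<noteq> {}" using max[OF X] sub P(2) by blast
    then show ?thesis unfolding set_add_def' cgenideal_def by blast
  qed
  have "primeideal P R"
  proof (rule primeidealI)
    show "ideal P R" "cring R" using P is_cring by auto
    show "carrier R \<noteq> P" using S P by blast
    fix a b assume ab: "a \<in> carrier R" "b \<in> carrier R" "a \<otimes> b \<in> P"
    show "a \<in> P \<or> b \<in> P"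
    proof (rule ccontr)
      assume "\<not> ?thesis"
      with meet[of a] meet[of b] ab obtain p r q s where
        1: "p \<in> P" "r \<in> carrier R" "p \<oplus> r \<otimes> a \<in> S" and 2: "q \<in> P" "s \<in> carrier R" "q \<oplus> s \<otimes> b \<in> S"
        by blast
      have c: "p \<in> carrier R" "q \<in> carrier R" using 1 2 P.a_Hcarr by auto
      have "(p \<oplus> r \<otimes> a) \<otimes> (q \<oplus> s \<otimes> b) = p \<otimes> (q \<oplus> s \<otimes> b) \<oplus> ((r \<otimes> a) \<otimes> q \<oplus> (r \<otimes> s) \<otimes> (a \<otimes> b))"
        using c 1 2 ab by algebra
      also have "\<dots> \<in> P"
        by (intro P.a_closed P.I_r_closed[OF 1(1)] P.I_l_closed[OF 2(1)] P.I_l_closed[OF ab(3)])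
          (use c 1 2 ab in auto)
      finally show False using mult[OF 1(3) 2(3)] P(3) by blast
    qed
  qed
  with that P show thesis by blast
qed

section \<open>Primes of a quotient ring\<close>

lemma (in cring) primeideal_quot_image:
  assumes "primeideal P R" "ideal J R" "J \<subseteq> P"
  shows "primeideal ((+>) J ` P) (R Quot J)"
proof -
  interpret P: primeideal P R by fact
  interpret J: ideal J R by fact
  interpret h: ring_hom_ring R "R Quot J" "(+>) J" by (rule J.rcos_ring_hom_ring)
  \<comment> \<open>P contains J, so it is a union of cosets of J and any representative decides
    membership.\<close>
  have mem: "J +> x \<in> (+>) J ` P \<longleftrightarrow> x \<in> P" if x: "x \<in> carrier R" for x
  proof
    assume "J +> x \<in> (+>) J ` P"
    then obtain y where y: "y \<in> P" "J +> x = J +> y" by blast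
    then have "x \<in> J +> y" using x J.a_rcos_self by metis
    then obtain j where "j \<in> J" "x = j \<oplus> y" unfolding a_r_coset_def' by blast
    then show "x \<in> P" using assms(3) y P.a_closed by blast
  qed auto
  show ?thesis
  proof (rule primeidealI)
    show "ideal ((+>) J ` P) (R Quot J)" by (rule ring_ideal_imp_quot_ideal[OF assms(2) P.is_ideal])
    show "cring (R Quot J)" by (rule J.quotient_is_cring[OF is_cring])
    show "carrier (R Quot J) \<noteq> (+>) J ` P"
      using mem[of \<one>] P.I_notcarr P.one_imp_carrier h.hom_closed by blast
    fix a b assume "a \<in> carrier (R Quot J)" "b \<in> carrier (R Quot J)"
      and ab: "a \<otimes>\<^bsub>R Quot J\<^esub> b \<in> (+>) J ` P"
    then obtain x y where xy: "x \<in> carrier R" "y \<in> carrier R" "a = J +> x" "b = J +> y"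
      unfolding FactRing_simps by auto
    with ab have "x \<otimes> y \<in> P" using mem[of "x \<otimes> y"] by simp
    then have "x \<in> P \<or> y \<in> P" using P.I_prime xy by blast
    then show "a \<in> (+>) J ` P \<or> b \<in> (+>) J ` P"
      using xy by blast
  qed
qed

definition prime_chain_over :: "'a ring \<Rightarrow> 'a set \<Rightarrow> nat \<Rightarrow> (nat \<Rightarrow> 'a set) \<Rightarrow> bool" where
  "prime_chain_over R J n P \<longleftrightarrow>
     (\<forall>i\<le>n. primeideal (P i) R \<and> J \<subseteq> P i) \<and> (\<forall>i<n. P i \<subset> P (Suc i))"

text \<open>Contraction and image along R \<rightarrow> R / J both carry strict chains of primes to
  strict chains. Dimensions can thus be bounded by looking at primes of R itself.\<close>

lemma krull_dim_quot:
  fixes R :: "'a ring" (structure)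
  assumes "cring R" and J: "ideal J R"
  shows "krull_dim (R Quot J) = Sup {ereal (real n) | n. \<exists>P. prime_chain_over R J n P}"
proof -
  interpret cring R by fact
  interpret J: ideal J R by fact
  interpret h: ring_hom_ring R "R Quot J" "(+>) J" by (rule J.rcos_ring_hom_ring)
  have "(\<exists>P. (\<forall>i\<le>n. primeideal (P i) (R Quot J)) \<and> (\<forall>i<n. P i \<subset> P (Suc i))) \<longleftrightarrow>
        (\<exists>P. prime_chain_over R J n P)" for n
  proof
    assume "\<exists>P. (\<forall>i\<le>n. primeideal (P i) (R Quot J)) \<and> (\<forall>i<n. P i \<subset> P (Suc i))"
    then obtain P where P: "\<And>i. i \<le> n \<Longrightarrow> primeideal (P i) (R Quot J)" "\<And>i. i<n \<Longrightarrow> P i \<subset> P (Suc i)"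
      by blast
    define Q where "Q i = {r \<in> carrier R. J +> r \<in> P i}" for i
    have "primeideal (Q i) R" if "i \<le> n" for i
      unfolding Q_def by (rule h.primeideal_vimage[OF is_cring P(1)[OF that]])
    moreover have "J \<subseteq> Q i" if "i \<le> n" for i
    proof
      fix x assume x: "x \<in> J"
      have "\<zero>\<^bsub>R Quot J\<^esub> \<in> P i"
        using P(1)[OF that] additive_subgroup.zero_closed ideal.axioms(1) primeideal.axioms(1) by blast
      then have "J \<in> P i" by (simp only: FactRing_def ring.simps)
      moreover have "J +> x = J" by (rule J.a_rcos_const[OF x])
      ultimately show "x \<in> Q i" using J.a_Hcarr[OF x] by (simp only: Q_def mem_Collect_eq simp_thms)
    qed
    moreover have "Q i \<subset> Q (Suc i)" if i: "i < n" for i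
    proof -
      have "P (Suc i) \<subseteq> carrier (R Quot J)"
        using P(1)[of "Suc i"] i additive_subgroup.a_subset ideal.axioms(1) primeideal.axioms(1)
        by (metis Suc_leI)
      then have car: "P (Suc i) \<subseteq> (+>) J ` carrier R"
        unfolding FactRing_simps by auto
      obtain a where "a \<in> P (Suc i)" "a \<notin> P i" using P(2)[OF i] by blast
      moreover from this obtain x where "x \<in> carrier R" "a = J +> x"
        using car by blast
      ultimately show ?thesis using P(2)[OF i] unfolding Q_def by blast
    qed
    ultimately show "\<exists>P. prime_chain_over R J n P" unfolding prime_chain_over_def by blast
  next
    assume "\<exists>P. prime_chain_over R J n P"
    then obtain P where P: "\<And>i. i \<le> n \<Longrightarrow> primeideal (P i) R" "\<And>i. i \<le> n \<Longrightarrow> J \<subseteq> P i"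
      "\<And>i. i<n \<Longrightarrow> P i \<subset> P (Suc i)"
      unfolding prime_chain_over_def by blast
    have "(+>) J ` P i \<subset> (+>) J ` P (Suc i)" if i: "i < n" for i
    proof -
      interpret Pi: primeideal "P i" R using P(1) i by simp
      interpret Ps: primeideal "P (Suc i)" R using P(1) i by simp
      obtain x where x: "x \<in> P (Suc i)" "x \<notin> P i" using P(3)[OF i] by blast
      have "J +> x \<notin> (+>) J ` P i"
      proof
        assume "J +> x \<in> (+>) J ` P i"
        then obtain y where y: "y \<in> P i" "J +> x = J +> y" by blast
        then have "x \<in> J +> y" using x J.a_rcos_self Ps.a_Hcarr by metis
        then obtain j where "j \<in> J" "x = j \<oplus> y" unfolding a_r_coset_def' by blast
        then show False using P(2)[of i] i x y Pi.a_closed by (auto dest: less_imp_le)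
      qed
      with x P(3)[OF i] show ?thesis by blast
    qed
    then show "\<exists>P. (\<forall>i\<le>n. primeideal (P i) (R Quot J)) \<and> (\<forall>i<n. P i \<subset> P (Suc i))"
      using primeideal_quot_image[OF P(1) J P(2)] by (intro exI[of _ "\<lambda>i. (+>) J ` P i"]) blast
  qed
  then show ?thesis unfolding krull_dim_def by simp
qed

section \<open>Quotient modules\<close>

lemma submodule_abelian_subgroup:
  assumes "Module.module R M" "submodule N R M"
  shows "abelian_subgroup N M"
proof -
  interpret Module.module R M by fact
  show ?thesis using assms(2)
    by (intro abelian_subgroupI3 M.abelian_group_axioms)
      (simp add: submodule_def additive_subgroup_def)
qed

context
  fixes R :: "'a ring" and M :: "('a, 'b) module" and N :: "'b set"
  assumes M: "Module.module R M" and N: "submodule N R M"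
begin

interpretation Module.module R M by (rule M)
interpretation N: abelian_subgroup N M by (rule submodule_abelian_subgroup[OF M N])

lemma quot_module_carrier: "carrier (quot_module M N) = (\<lambda>x. N +>\<^bsub>M\<^esub> x) ` carrier M"
  unfolding quot_module_def FactRing_simps ring.extend_def module.fields_def by auto

lemma quot_module_zero: "\<zero>\<^bsub>quot_module M N\<^esub> = N"
  unfolding quot_module_def FactRing_def ring.extend_def module.fields_def by simp

lemma quot_module_add:
  "x \<in> carrier M \<Longrightarrow> y \<in> carrier M \<Longrightarrow>
    (N +>\<^bsub>M\<^esub> x) \<oplus>\<^bsub>quot_module M N\<^esub> (N +>\<^bsub>M\<^esub> y) = N +>\<^bsub>M\<^esub> (x \<oplus>\<^bsub>M\<^esub> y)"
  unfolding quot_module_def FactRing_def ring.extend_def module.fields_def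
  by (simp add: N.a_rcos_sum)

lemma quot_module_coset_eq_iff:
  assumes x: "x \<in> carrier M" and y: "y \<in> carrier M"
  shows "N +>\<^bsub>M\<^esub> x = N +>\<^bsub>M\<^esub> y \<longleftrightarrow> x \<ominus>\<^bsub>M\<^esub> y \<in> N"
  using N.a_rcos_module[OF y x, folded M.minus_eq] N.a_repr_independence'[OF _ y] N.a_rcos_self[OF x]
  by metis

lemma quot_module_coset_eq_zero_iff:
  assumes x: "x \<in> carrier M"
  shows "N +>\<^bsub>M\<^esub> x = N \<longleftrightarrow> x \<in> N"
  using N.a_rcos_const N.a_rcos_self x by blast

text \<open>For z in the coset of x the difference a z - a x is a multiple of an element of N, so
  all cosets in the defining union coincide; the union is nonempty because x itself
  contributes.\<close>

lemma quot_module_smult: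
  assumes a: "a \<in> carrier R" and x: "x \<in> carrier M"
  shows "a \<odot>\<^bsub>quot_module M N\<^esub> (N +>\<^bsub>M\<^esub> x) = N +>\<^bsub>M\<^esub> (a \<odot>\<^bsub>M\<^esub> x)"
proof -
  have "N +>\<^bsub>M\<^esub> (a \<odot>\<^bsub>M\<^esub> z) = N +>\<^bsub>M\<^esub> (a \<odot>\<^bsub>M\<^esub> x)" if z: "z \<in> N +>\<^bsub>M\<^esub> x" for z
  proof -
    obtain h where h: "h \<in> N" "z = h \<oplus>\<^bsub>M\<^esub> x" using z unfolding a_r_coset_def' by blast
    have hc: "h \<in> carrier M" using h by simp
    have "a \<odot>\<^bsub>M\<^esub> z \<ominus>\<^bsub>M\<^esub> a \<odot>\<^bsub>M\<^esub> x = a \<odot>\<^bsub>M\<^esub> h"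
      using a x hc unfolding h a_minus_def by (simp add: smult_r_distr M.a_assoc M.r_neg)
    also have "\<dots> \<in> N" using submodule.smult_closed[OF N a h(1)] .
    finally show ?thesis using quot_module_coset_eq_iff a x hc h by simp
  qed
  then have "(\<Union>z\<in>N +>\<^bsub>M\<^esub> x. N +>\<^bsub>M\<^esub> (a \<odot>\<^bsub>M\<^esub> z)) = N +>\<^bsub>M\<^esub> (a \<odot>\<^bsub>M\<^esub> x)"
    using N.a_rcos_self[OF x] by blast
  then show ?thesis
    by (simp only: quot_module_def ring.extend_def module.fields_def module.simps)
qed

lemma quot_module_is_module: "Module.module R (quot_module M N)"
proof -
  let ?Q = "quot_module M N"
  have add_c: "X \<oplus>\<^bsub>?Q\<^esub> Y \<in> carrier ?Q" if "X \<in> carrier ?Q" "Y \<in> carrier ?Q" for X Y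
    using that by (auto simp: quot_module_carrier quot_module_add)
  show ?thesis
  proof (rule moduleI)
    show "cring R" by (rule R.is_cring)
    show "abelian_group ?Q"
    proof (rule abelian_groupI)
      show "\<zero>\<^bsub>?Q\<^esub> \<in> carrier ?Q"
        unfolding quot_module_carrier quot_module_zero
        using quot_module_coset_eq_zero_iff[of "\<zero>\<^bsub>M\<^esub>"] by (auto intro!: image_eqI[of _ _ "\<zero>\<^bsub>M\<^esub>"])
      fix X assume "X \<in> carrier ?Q"
      then obtain x where x: "x \<in> carrier M" "X = N +>\<^bsub>M\<^esub> x" by (auto simp: quot_module_carrier)
      have z: "\<zero>\<^bsub>?Q\<^esub> = N +>\<^bsub>M\<^esub> \<zero>\<^bsub>M\<^esub>"
        using quot_module_coset_eq_zero_iff[of "\<zero>\<^bsub>M\<^esub>"] quot_module_zero by simp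
      show "\<zero>\<^bsub>?Q\<^esub> \<oplus>\<^bsub>?Q\<^esub> X = X" unfolding z x using x by (simp add: quot_module_add)
      have "(N +>\<^bsub>M\<^esub> \<ominus>\<^bsub>M\<^esub> x) \<oplus>\<^bsub>?Q\<^esub> X = \<zero>\<^bsub>?Q\<^esub>"
        unfolding z x using x by (simp add: quot_module_add M.l_neg)
      then show "\<exists>Y\<in>carrier ?Q. Y \<oplus>\<^bsub>?Q\<^esub> X = \<zero>\<^bsub>?Q\<^esub>"
        using x by (auto simp: quot_module_carrier)
    next
      fix X Y assume "X \<in> carrier ?Q" "Y \<in> carrier ?Q"
      then show "X \<oplus>\<^bsub>?Q\<^esub> Y \<in> carrier ?Q" by (rule add_c)
    next
      fix X Y Z assume "X \<in> carrier ?Q" "Y \<in> carrier ?Q" "Z \<in> carrier ?Q"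
      then show "X \<oplus>\<^bsub>?Q\<^esub> Y \<oplus>\<^bsub>?Q\<^esub> Z = X \<oplus>\<^bsub>?Q\<^esub> (Y \<oplus>\<^bsub>?Q\<^esub> Z)"
        by (auto simp: quot_module_carrier quot_module_add M.a_assoc)
    next
      fix X Y assume "X \<in> carrier ?Q" "Y \<in> carrier ?Q"
      then show "X \<oplus>\<^bsub>?Q\<^esub> Y = Y \<oplus>\<^bsub>?Q\<^esub> X"
        by (auto simp: quot_module_carrier quot_module_add M.a_comm)
    qed
  next
    fix a X assume "a \<in> carrier R" "X \<in> carrier ?Q"
    then show "a \<odot>\<^bsub>?Q\<^esub> X \<in> carrier ?Q"
      by (auto simp: quot_module_carrier quot_module_smult)
  next
    fix a b X assume "a \<in> carrier R" "b \<in> carrier R" "X \<in> carrier ?Q"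
    then show "(a \<oplus>\<^bsub>R\<^esub> b) \<odot>\<^bsub>?Q\<^esub> X = a \<odot>\<^bsub>?Q\<^esub> X \<oplus>\<^bsub>?Q\<^esub> b \<odot>\<^bsub>?Q\<^esub> X"
      "a \<otimes>\<^bsub>R\<^esub> b \<odot>\<^bsub>?Q\<^esub> X = a \<odot>\<^bsub>?Q\<^esub> (b \<odot>\<^bsub>?Q\<^esub> X)"
      by (auto simp: quot_module_carrier quot_module_smult quot_module_add smult_l_distr smult_assoc1)
  next
    fix a X Y assume "a \<in> carrier R" "X \<in> carrier ?Q" "Y \<in> carrier ?Q"
    then show "a \<odot>\<^bsub>?Q\<^esub> (X \<oplus>\<^bsub>?Q\<^esub> Y) = a \<odot>\<^bsub>?Q\<^esub> X \<oplus>\<^bsub>?Q\<^esub> a \<odot>\<^bsub>?Q\<^esub> Y"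
      by (auto simp: quot_module_carrier quot_module_smult quot_module_add smult_r_distr)
  next
    fix X assume "X \<in> carrier ?Q"
    then show "\<one>\<^bsub>R\<^esub> \<odot>\<^bsub>?Q\<^esub> X = X"
      by (auto simp: quot_module_carrier quot_module_smult)
  qed
qed

text \<open>Turns the condition on cosets into one on elements of M, the form in which regular
  sequences are both used and verified.\<close>

lemma nonzerodivisor_on_quot_module:
  assumes "a \<in> carrier R"
  shows "nonzerodivisor_on a (quot_module M N) \<longleftrightarrow> (\<forall>x\<in>carrier M. a \<odot>\<^bsub>M\<^esub> x \<in> N \<longrightarrow> x \<in> N)"
  using assms unfolding nonzerodivisor_on_def quot_module_carrier quot_module_zero
  by (simp add: quot_module_smult quot_module_coset_eq_zero_iff)

end

lemma (in Module.module) submodule_Inter: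
  assumes "\<A> \<noteq> {}" "\<And>N. N \<in> \<A> \<Longrightarrow> submodule N R M"
  shows "submodule (\<Inter>\<A>) R M"
proof (rule submoduleI)
  have zero: "\<zero>\<^bsub>M\<^esub> \<in> N" if "N \<in> \<A>" for N
    using subgroup.one_closed[OF submodule.axioms(1)[OF assms(2)[OF that]]] by simp
  show "\<Inter>\<A> \<subseteq> carrier M" using assms(1) submoduleE(1)[OF assms(2)] by blast
  show "\<zero>\<^bsub>M\<^esub> \<in> \<Inter>\<A>" using zero by blast
  show "\<ominus>\<^bsub>M\<^esub> a \<in> \<Inter>\<A>" if "a \<in> \<Inter>\<A>" for a
    using submoduleE(3)[OF assms(2)] that by blast
  show "a \<oplus>\<^bsub>M\<^esub> b \<in> \<Inter>\<A>" if "a \<in> \<Inter>\<A>" "b \<in> \<Inter>\<A>" for a b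
    using submoduleE(5)[OF assms(2)] that by blast
  show "a \<odot>\<^bsub>M\<^esub> x \<in> \<Inter>\<A>" if "a \<in> carrier R" "x \<in> \<Inter>\<A>" for a x
    using submoduleE(4)[OF assms(2)] that by blast
qed

lemma ideal_smult_submodule:
  assumes "Module.module R M" and S: "S \<subseteq> carrier R"
  shows "submodule (ideal_smult R S M) R M"
proof -
  interpret Module.module R M by fact
  show ?thesis unfolding ideal_smult_def
    by (rule submodule_Inter) (use S carrier_is_submodule in auto)
qed

lemma ideal_smult_mono: "S \<subseteq> T \<Longrightarrow> ideal_smult R S M \<subseteq> ideal_smult R T M"
  unfolding ideal_smult_def by blast

lemma ideal_smult_memI:
  "a \<in> S \<Longrightarrow> x \<in> carrier M \<Longrightarrow> a \<odot>\<^bsub>M\<^esub> x \<in> ideal_smult R S M"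
  unfolding ideal_smult_def by blast

section \<open>Depth is at most dimension\<close>

text \<open>This is the annihilator of M / N, described inside M. For N generated by an initial
  segment of a regular sequence it is the ideal above which a chain of primes is built.\<close>

lemma annihilator_mod_submodule_ideal:
  assumes "Module.module R M" "submodule N R M"
  shows "ideal {a \<in> carrier R. \<forall>x\<in>carrier M. a \<odot>\<^bsub>M\<^esub> x \<in> N} R"
proof -
  interpret Module.module R M by fact
  note N = submoduleE[OF assms(2)]
  have z: "\<zero>\<^bsub>M\<^esub> \<in> N" using subgroup.one_closed[OF submodule.axioms(1)[OF assms(2)]] by simp
  show ?thesis
  proof (rule idealI)
    show "ring R" by (rule R.ring_axioms)
    show "subgroup {a \<in> carrier R. \<forall>x\<in>carrier M. a \<odot>\<^bsub>M\<^esub> x \<in> N} (add_monoid R)"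
      using z N by (intro R.add.subgroupI) (auto simp: smult_l_distr smult_l_minus a_inv_def[symmetric])
    fix a r assume a: "a \<in> {a \<in> carrier R. \<forall>x\<in>carrier M. a \<odot>\<^bsub>M\<^esub> x \<in> N}" and r: "r \<in> carrier R"
    show "r \<otimes>\<^bsub>R\<^esub> a \<in> {a \<in> carrier R. \<forall>x\<in>carrier M. a \<odot>\<^bsub>M\<^esub> x \<in> N}"
      using a r N by (auto simp: smult_assoc1)
    then show "a \<otimes>\<^bsub>R\<^esub> r \<in> {a \<in> carrier R. \<forall>x\<in>carrier M. a \<odot>\<^bsub>M\<^esub> x \<in> N}"
      using a r by (simp add: R.m_comm)
  qed
qed

lemma annihilator_ideal:
  assumes "Module.module R M"
  shows "ideal (annihilator R M) R"
proof -
  interpret Module.module R M by fact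
  have "submodule {\<zero>\<^bsub>M\<^esub>} R M" by (intro submoduleI) auto
  from annihilator_mod_submodule_ideal[OF assms this] show ?thesis
    by (simp add: annihilator_def)
qed

text \<open>A nonzerodivisor modulo I lies in no minimal prime over I. The products x^k s with s
  outside P form a multiplicative set missing I, and a prime avoiding this set lies inside P and
  does not contain x. This stands in for localizing at P.\<close>

lemma (in cring) exists_smaller_prime:
  assumes I: "ideal I R" and P: "primeideal P R" "I \<subseteq> P" and x: "x \<in> P"
    and reg: "\<And>s. s \<in> carrier R \<Longrightarrow> x \<otimes> s \<in> I \<Longrightarrow> s \<in> I"
  obtains Q where "primeideal Q R" "I \<subseteq> Q" "Q \<subset> P"
proof -
  interpret P: primeideal P R by (rule P)
  have xc: "x \<in> carrier R" using x by (rule P.a_Hcarr)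
  have reg_pow: "s \<in> I" if "s \<in> carrier R" "(x [^] k) \<otimes> s \<in> I" for s and k :: nat
    using that(2)
  proof (induction k)
    case 0
    then show ?case using that(1) by simp
  next
    case (Suc k)
    have "(x [^] Suc k) \<otimes> s = x \<otimes> ((x [^] k) \<otimes> s)"
      using xc that(1) by (simp add: m_ac)
    then have "x \<otimes> ((x [^] k) \<otimes> s) \<in> I" using Suc.prems by simp
    then have "(x [^] k) \<otimes> s \<in> I" using xc that(1) by (intro reg[of "(x [^] k) \<otimes> s"] m_closed nat_pow_closed)
    then show ?case by (rule Suc.IH)
  qed
  let ?S = "{(x [^] k) \<otimes> s | (k :: nat) s. s \<in> carrier R - P}"
  have one: "\<one> \<in> carrier R - P" by (metis P.I_notcarr P.one_imp_carrier DiffI one_closed)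
  have SI: "(x [^] k) \<otimes> s \<in> ?S" if "s \<in> carrier R - P" for s and k :: nat
    using that by blast
  obtain Q where Q: "primeideal Q R" "I \<subseteq> Q" "Q \<inter> ?S = {}"
  proof (rule exists_prime_avoiding[OF I, of ?S])
    show "?S \<subseteq> carrier R" using xc by auto
    show "\<one> \<in> ?S" using SI[OF one, of 0] by simp
    show "I \<inter> ?S = {}" using reg_pow P(2) by blast
    fix u v assume "u \<in> ?S" "v \<in> ?S"
    then obtain k s l t where
      u: "u = (x [^] (k :: nat)) \<otimes> s" "s \<in> carrier R - P" and
      v: "v = (x [^] (l :: nat)) \<otimes> t" "t \<in> carrier R - P" by blast
    have "u \<otimes> v = (x [^] (k + l)) \<otimes> (s \<otimes> t)"
      using u v xc by (simp add: nat_pow_mult[symmetric] m_ac)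
    moreover have "s \<otimes> t \<in> carrier R - P" using u v P.I_prime by auto
    ultimately show "u \<otimes> v \<in> ?S" using SI by simp
  qed
  have "s \<in> P" if s: "s \<in> Q" for s
  proof (rule ccontr)
    assume "s \<notin> P"
    moreover have "s \<in> carrier R" using Q(1) s ideal.Icarr primeideal.axioms(1) by metis
    ultimately have "s \<in> ?S" using SI[of s 0] by simp
    then show False using Q(3) s by blast
  qed
  moreover have "x \<notin> Q" using SI[OF one, of 1] Q(3) xc by auto
  ultimately show thesis using that[OF Q(1,2)] x by blast
qed

text \<open>Each member of a regular sequence lies in every prime over the annihilator of the next
  quotient, but is a nonzerodivisor modulo the annihilator of the present one. Each step back along
  the sequence therefore yields a strictly smaller prime.\<close>

lemma depth_le_module_dim:
  fixes R :: "'a ring"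
  assumes M: "Module.module R M"
  shows "depth R J M \<le> module_dim R M"
  unfolding depth_def
proof (rule Sup_least, clarify)
  fix as assume reg: "regular_sequence R M as"
  interpret Module.module R M by fact
  let ?N = "\<lambda>i. ideal_smult R (set (take i as)) M"
  let ?J = "\<lambda>i. {a \<in> carrier R. \<forall>x\<in>carrier M. a \<odot>\<^bsub>M\<^esub> x \<in> ?N i}"
  let ?r = "length as"
  have "set as \<subseteq> carrier R" using reg unfolding regular_sequence_def by blast
  then have "set (take i as) \<subseteq> carrier R" for i using set_take_subset by fast
  from ideal_smult_submodule[OF M this] have sub: "submodule (?N i) R M" for i .
  have J: "ideal (?J i) R" for i by (rule annihilator_mod_submodule_ideal[OF M sub])
  have as: "as ! i \<in> carrier R" if "i < ?r" for i
    using reg that unfolding regular_sequence_def by (meson nth_mem subsetD)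
  have chain: "\<exists>P. prime_chain_over R (?J i) (?r - i) P" if "i \<le> ?r" for i
    using that
  proof (induction i rule: inc_induct)
    \<comment> \<open>The chain is built from its top. If the ideal contained 1, the sequence would
      generate all of M, against regularity; so some prime contains it.\<close>
    case base
    have "\<one>\<^bsub>R\<^esub> \<notin> ?J ?r"
    proof
      assume "\<one>\<^bsub>R\<^esub> \<in> ?J ?r"
      then have "carrier M \<subseteq> ?N ?r" by auto
      then show False using reg submoduleE(1)[OF sub[of "length as"]]
        unfolding regular_sequence_def by auto
    qed
    then obtain P where "primeideal P R" "?J ?r \<subseteq> P"
      by (rule_tac R.exists_prime_avoiding[OF J[of ?r], of "{\<one>\<^bsub>R\<^esub>}"]) auto
    then show ?case by (auto simp: prime_chain_over_def)
  next
    case (step i)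
    then obtain P where P: "prime_chain_over R (?J (Suc i)) (?r - Suc i) P" by blast
    let ?x = "as ! i"
    have x: "?x \<in> carrier R" using as step by simp
    have nzd: "z \<in> ?N i" if "z \<in> carrier M" "?x \<odot>\<^bsub>M\<^esub> z \<in> ?N i" for z
      using reg step that nonzerodivisor_on_quot_module[OF M sub x]
      unfolding regular_sequence_def by blast
    have P0: "primeideal (P 0) R" "?J (Suc i) \<subseteq> P 0"
      using P unfolding prime_chain_over_def by auto
    have mono: "?N i \<subseteq> ?N (Suc i)" by (intro ideal_smult_mono set_take_subset_set_take) simp
    have JJ: "?J i \<subseteq> ?J (Suc i)" using mono by blast
    have "?x \<in> set (take (Suc i) as)"
      using step by (simp add: take_Suc_conv_app_nth)
    then have "?x \<in> ?J (Suc i)" by (intro CollectI conjI ballI x ideal_smult_memI)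
    then have xP: "?x \<in> P 0" using P0(2) by blast
    have "s \<in> ?J i" if s: "s \<in> carrier R" "?x \<otimes>\<^bsub>R\<^esub> s \<in> ?J i" for s
    proof (intro CollectI conjI ballI s(1))
      fix z assume z: "z \<in> carrier M"
      then have "(?x \<otimes>\<^bsub>R\<^esub> s) \<odot>\<^bsub>M\<^esub> z \<in> ?N i" using s(2) by blast
      then have "?x \<odot>\<^bsub>M\<^esub> (s \<odot>\<^bsub>M\<^esub> z) \<in> ?N i"
        by (simp only: smult_assoc1[OF x s(1) z])
      then show "s \<odot>\<^bsub>M\<^esub> z \<in> ?N i" by (rule nzd[OF smult_closed[OF s(1) z]])
    qed
    from R.exists_smaller_prime[OF J[of i] P0(1) subset_trans[OF JJ P0(2)] xP this]
    obtain Q where Q: "primeideal Q R" "?J i \<subseteq> Q" and QP: "Q \<subset> P 0" .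
    let ?P = "case_nat Q P"
    have len: "?r - i = Suc (?r - Suc i)" using step by simp
    have PP: "primeideal (P j) R" "?J (Suc i) \<subseteq> P j" if "j \<le> ?r - Suc i" for j
      using P that unfolding prime_chain_over_def by blast+
    have Plt: "P j \<subset> P (Suc j)" if "j < ?r - Suc i" for j
      using P that unfolding prime_chain_over_def by blast
    have "prime_chain_over R (?J i) (?r - i) ?P"
      unfolding len prime_chain_over_def
    proof (intro conjI allI impI)
      fix j
      assume j: "j \<le> Suc (?r - Suc i)"
      show "primeideal (?P j) R"
        using PP(1)[of "j - 1"] Q(1) j by (cases j) simp_all
      show "?J i \<subseteq> ?P j"
      proof (cases j)
        case (Suc j')
        with j have "?J (Suc i) \<subseteq> P j'" by (intro PP(2)) simp
        with JJ show ?thesis unfolding Suc nat.case by (rule subset_trans)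
      qed (use Q in simp)
    next
      fix j assume "j < Suc (?r - Suc i)"
      then show "?P j \<subset> ?P (Suc j)"
        using Plt[of "j - 1"] QP by (cases j) simp_all
    qed
    then show ?case by blast
  qed
  have "annihilator R M \<subseteq> ?J 0"
    using subgroup.one_closed[OF submodule.axioms(1)[OF sub[of 0]]]
    unfolding annihilator_def by auto
  moreover obtain P where "prime_chain_over R (?J 0) ?r P"
    using chain[of 0] by auto
  ultimately have "\<exists>P. prime_chain_over R (annihilator R M) ?r P"
    unfolding prime_chain_over_def by (meson subset_trans)
  then show "ereal (real (length as)) \<le> module_dim R M"
    unfolding module_dim_def krull_dim_quot[OF R.is_cring annihilator_ideal[OF M]]
    by (intro Sup_upper) blast
qed

section \<open>Weakly regular sequences on subquotients of a ring\<close>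

text \<open>\<open>C\<close> is the subring of scalars. The type \<open>'k mpoly\<close> has
  infinitely many variables, so stability is asked only under the polynomials in the first n of
  them.\<close>

definition subideal :: "'a::comm_ring_1 set \<Rightarrow> 'a set \<Rightarrow> bool" where
  "subideal C A \<longleftrightarrow> 0 \<in> A \<and> (\<forall>x\<in>A. \<forall>y\<in>A. x + y \<in> A) \<and> (\<forall>x\<in>A. - x \<in> A) \<and> (\<forall>c\<in>C. \<forall>x\<in>A. c * x \<in> A)"

lemma subidealD:
  assumes "subideal C A"
  shows "0 \<in> A" "x \<in> A \<Longrightarrow> y \<in> A \<Longrightarrow> x + y \<in> A" "x \<in> A \<Longrightarrow> - x \<in> A"
    "c \<in> C \<Longrightarrow> x \<in> A \<Longrightarrow> c * x \<in> A" "x \<in> A \<Longrightarrow> y \<in> A \<Longrightarrow> x - y \<in> A"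
proof -
  show minus: "x \<in> A \<Longrightarrow> - x \<in> A" for x using assms unfolding subideal_def by blast
  show plus: "x \<in> A \<Longrightarrow> y \<in> A \<Longrightarrow> x + y \<in> A" for x y using assms unfolding subideal_def by blast
  show "x \<in> A \<Longrightarrow> y \<in> A \<Longrightarrow> x - y \<in> A" using plus[of x "- y"] minus[of y] by simp
qed (use assms in \<open>auto simp: subideal_def\<close>)

text \<open>The submodule a A + B: dividing A by it amounts to dividing A / B by its multiples of
  a.\<close>

definition adjoin_mult :: "'a::comm_ring_1 \<Rightarrow> 'a set \<Rightarrow> 'a set \<Rightarrow> 'a set" where
  "adjoin_mult a A B = {a * y + b | y b. y \<in> A \<and> b \<in> B}"

lemma adjoin_multI: "y \<in> A \<Longrightarrow> b \<in> B \<Longrightarrow> x = a * y + b \<Longrightarrow> x \<in> adjoin_mult a A B"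
  unfolding adjoin_mult_def by blast

lemma adjoin_multE:
  assumes "x \<in> adjoin_mult a A B"
  obtains y b where "y \<in> A" "b \<in> B" "x = a * y + b"
  using assms unfolding adjoin_mult_def by blast

lemma subideal_adjoin_mult:
  assumes A: "subideal C A" and B: "subideal C B"
  shows "subideal C (adjoin_mult a A B)"
  unfolding subideal_def
proof (intro conjI ballI)
  show "0 \<in> adjoin_mult a A B"
    by (rule adjoin_multI[OF subidealD(1)[OF A] subidealD(1)[OF B]]) simp
next
  fix x x' assume "x \<in> adjoin_mult a A B" "x' \<in> adjoin_mult a A B"
  then obtain y b y' b' where "y \<in> A" "b \<in> B" "x = a * y + b" "y' \<in> A" "b' \<in> B" "x' = a * y' + b'"
    by (elim adjoin_multE)
  then show "x + x' \<in> adjoin_mult a A B"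
    by (intro adjoin_multI[OF subidealD(2)[OF A, of y y'] subidealD(2)[OF B, of b b']])
      (simp_all add: algebra_simps)
next
  fix x assume "x \<in> adjoin_mult a A B"
  then obtain y b where y: "y \<in> A" "b \<in> B" "x = a * y + b"
    by (elim adjoin_multE)
  then show "- x \<in> adjoin_mult a A B"
    by (intro adjoin_multI[OF subidealD(3)[OF A, of y] subidealD(3)[OF B, of b]]) simp_all
  fix c assume "c \<in> C"
  with y show "c * x \<in> adjoin_mult a A B"
    by (intro adjoin_multI[OF subidealD(4)[OF A, of c y] subidealD(4)[OF B, of c b]])
      (simp_all add: algebra_simps)
qed

text \<open>For submodules \<open>B \<subseteq> A\<close>: the sequence is weakly regular on \<open>A / B\<close>.\<close>
fun weakly_regular :: "'a::comm_ring_1 list \<Rightarrow> 'a set \<Rightarrow> 'a set \<Rightarrow> bool" where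
  "weakly_regular [] A B \<longleftrightarrow> True"
| "weakly_regular (a # as) A B \<longleftrightarrow>
     (\<forall>x\<in>A. a * x \<in> B \<longrightarrow> x \<in> B) \<and> weakly_regular as A (adjoin_mult a A B)"

text \<open>A / A is the zero module and stays so, because a A + A = A. This starts the inductions
  along filtrations.\<close>

lemma weakly_regular_refl: "subideal C A \<Longrightarrow> set as \<subseteq> C \<Longrightarrow> weakly_regular as A A"
proof (induction as)
  case (Cons a as)
  have "adjoin_mult a A A = A"
  proof
    show "adjoin_mult a A A \<subseteq> A"
      using Cons.prems subidealD[of C A] by (auto elim!: adjoin_multE)
    show "A \<subseteq> adjoin_mult a A A"
      using subidealD(1)[OF Cons.prems(1)] by (auto intro: adjoin_multI[of 0])
  qed
  with Cons show ?case by simp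
qed simp

text \<open>Multiplication by \<open>u\<close> induces an isomorphism from \<open>A / B\<close> to \<open>A' / B'\<close>.\<close>
lemma weakly_regular_transfer:
  assumes "weakly_regular as A B"
    and "subideal C A" "subideal C A'" "subideal C B'" "set as \<subseteq> C"
    and "A' = adjoin_mult u A B'" and "B = {p \<in> A. u * p \<in> B'}"
  shows "weakly_regular as A' B'"
  using assms
proof (induction as arbitrary: B B')
  case (Cons a as)
  note A = subidealD[OF Cons.prems(2)] and A' = subidealD[OF Cons.prems(3)]
    and B' = subidealD[OF Cons.prems(4)]
  note A'eq = Cons.prems(6) and Beq = Cons.prems(7)
  have a: "a \<in> C" using Cons.prems by simp
  have uA: "u * y \<in> A'" if "y \<in> A" for y
    unfolding A'eq by (rule adjoin_multI[OF that B'(1)]) simp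
  have BA': "b \<in> A'" if "b \<in> B'" for b
    unfolding A'eq by (rule adjoin_multI[OF A(1) that]) simp
  have 1: "x \<in> B'" if x: "x \<in> A'" "a * x \<in> B'" for x
  proof -
    obtain y b where y: "y \<in> A" "b \<in> B'" "x = u * y + b"
      using x(1) unfolding A'eq by (elim adjoin_multE)
    have "u * (a * y) = a * x - a * b" unfolding y by (simp add: algebra_simps)
    also have "\<dots> \<in> B'" using x(2) y(2) a B'(4,5) by blast
    finally have "a * y \<in> B" using Beq y(1) a A(4) by blast
    then have "y \<in> B" using Cons.prems(1) y(1) by simp
    then have "u * y \<in> B'" unfolding Beq by simp
    then show "x \<in> B'" using y B'(2) by blast
  qed
  \<comment> \<open>The same u maps A / (a A + B) isomorphically to A' / (a A' + B').\<close>
  have "weakly_regular as A' (adjoin_mult a A' B')"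
  proof (rule Cons.IH)
    show "weakly_regular as A (adjoin_mult a A B)" using Cons.prems(1) by simp
    show "subideal C A" "subideal C A'" "set as \<subseteq> C" using Cons.prems by simp_all
    show "subideal C (adjoin_mult a A' B')" using Cons.prems by (intro subideal_adjoin_mult)
    show "A' = adjoin_mult u A (adjoin_mult a A' B')"
    proof
      show "A' \<subseteq> adjoin_mult u A (adjoin_mult a A' B')"
      proof
        fix x assume "x \<in> A'"
        then obtain y b where y: "y \<in> A" "b \<in> B'" "x = u * y + b"
          unfolding A'eq by (elim adjoin_multE)
        have "b \<in> adjoin_mult a A' B'" by (rule adjoin_multI[OF A'(1) y(2)]) simp
        then show "x \<in> adjoin_mult u A (adjoin_mult a A' B')"
          by (rule adjoin_multI[OF y(1) _ y(3)])
      qed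
      show "adjoin_mult u A (adjoin_mult a A' B') \<subseteq> A'"
      proof
        fix x assume "x \<in> adjoin_mult u A (adjoin_mult a A' B')"
        then obtain y z b where "y \<in> A" "z \<in> A'" "b \<in> B'" "x = u * y + (a * z + b)"
          by (elim adjoin_multE) blast
        then show "x \<in> A'" using uA BA' A'(2) A'(4)[OF a] by simp
      qed
    qed
    show "adjoin_mult a A B = {p \<in> A. u * p \<in> adjoin_mult a A' B'}"
    proof
      show "adjoin_mult a A B \<subseteq> {p \<in> A. u * p \<in> adjoin_mult a A' B'}"
      proof
        fix x assume "x \<in> adjoin_mult a A B"
        then obtain y b where y: "y \<in> A" "b \<in> B" "x = a * y + b" by (elim adjoin_multE)
        then have b: "b \<in> A" "u * b \<in> B'" using Beq by simp_all
        have "u * x \<in> adjoin_mult a A' B'"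
          by (rule adjoin_multI[OF uA[OF y(1)] b(2)]) (simp add: y algebra_simps)
        moreover have "x \<in> A" using y b A(2) A(4)[OF a] by simp
        ultimately show "x \<in> {p \<in> A. u * p \<in> adjoin_mult a A' B'}" by simp
      qed
      show "{p \<in> A. u * p \<in> adjoin_mult a A' B'} \<subseteq> adjoin_mult a A B"
      proof
        fix p assume "p \<in> {p \<in> A. u * p \<in> adjoin_mult a A' B'}"
        then obtain x b where p: "p \<in> A" "x \<in> A'" "b \<in> B'" "u * p = a * x + b"
          by (auto elim: adjoin_multE)
        then obtain y b' where y: "y \<in> A" "b' \<in> B'" "x = u * y + b'"
          unfolding A'eq by (auto elim: adjoin_multE)
        \<comment> \<open>Splitting the element of A' as u y + b' moves the multiple of a back into
          A: p and a y agree modulo B.\<close>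
        have "u * (p - a * y) = a * b' + b" using p(4) y(3) by (simp add: algebra_simps)
        also have "\<dots> \<in> B'" using p(3) y(2) B'(2) B'(4)[OF a] by simp
        finally have "p - a * y \<in> B" using Beq p(1) y(1) A(5) A(4)[OF a] by simp
        then show "p \<in> adjoin_mult a A B" by (rule adjoin_multI[OF y(1)]) simp
      qed
    qed
  qed
  with 1 show ?case by simp
qed simp

text \<open>Regularity passes to the middle of the exact sequence formed by A / B, E / B and E / A.
  Since a is a nonzerodivisor on E / A, reduction modulo a keeps the sequence exact, and the
  induction continues with the reduced modules.\<close>

lemma weakly_regular_extension:
  assumes "weakly_regular as E A" "weakly_regular as A B"
    and "subideal C E" "subideal C A" "subideal C B" "set as \<subseteq> C" "B \<subseteq> A" "A \<subseteq> E"
  shows "weakly_regular as E B"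
  using assms
proof (induction as arbitrary: A B)
  case (Cons a as)
  note E = subidealD[OF Cons.prems(3)] and A = subidealD[OF Cons.prems(4)]
    and B = subidealD[OF Cons.prems(5)]
  have a: "a \<in> C" using Cons.prems by simp
  note BA = subsetD[OF Cons.prems(7)] and AE = subsetD[OF Cons.prems(8)]
  have 1: "x \<in> A" if "x \<in> E" "a * x \<in> A" for x
    using Cons.prems(1) that by simp
  have 2: "x \<in> B" if "x \<in> A" "a * x \<in> B" for x
    using Cons.prems(2) that by simp
  have 3: "x \<in> B" if "x \<in> E" "a * x \<in> B" for x
    using 2[OF 1] that BA by blast
  let ?A' = "adjoin_mult a E A" and ?B' = "adjoin_mult a E B"
  have sub: "subideal C ?A'" "subideal C ?B'" "set as \<subseteq> C"
    using Cons.prems by (simp_all add: subideal_adjoin_mult)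
  have BA': "?B' \<subseteq> ?A'" using BA by (auto elim!: adjoin_multE intro: adjoin_multI)
  have AE': "?A' \<subseteq> E" using AE E(2) E(4)[OF a] by (auto elim!: adjoin_multE)
  have "weakly_regular as E ?B'"
  proof (rule Cons.IH[of ?A'])
    show "weakly_regular as E ?A'" using Cons.prems(1) by simp
    show "weakly_regular as ?A' ?B'"
    \<comment> \<open>With u = 1 this is the second isomorphism theorem: (a E + A) / (a E + B) is A
      / (A \<inter> (a E + B)), and the last denominator equals a A + B.\<close>
    proof (rule weakly_regular_transfer[where u = 1 and C = C])
      show "weakly_regular as A (adjoin_mult a A B)" using Cons.prems(2) by simp
      show "subideal C A" by fact
      show "?A' = adjoin_mult 1 A ?B'"
      proof
        show "?A' \<subseteq> adjoin_mult 1 A ?B'"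
        proof
          fix x assume "x \<in> ?A'"
          then obtain y z where yz: "y \<in> E" "z \<in> A" "x = a * y + z" by (elim adjoin_multE)
          have "a * y \<in> ?B'" by (rule adjoin_multI[OF yz(1) B(1)]) simp
          then show "x \<in> adjoin_mult 1 A ?B'" by (rule adjoin_multI[OF yz(2)]) (simp add: yz)
        qed
        show "adjoin_mult 1 A ?B' \<subseteq> ?A'"
        proof
          fix x assume "x \<in> adjoin_mult 1 A ?B'"
          then obtain y z b where "y \<in> A" "z \<in> E" "b \<in> B" "x = 1 * y + (a * z + b)"
            by (elim adjoin_multE) blast
          then show "x \<in> ?A'" using BA A(2) by (intro adjoin_multI[of z E "y + b"]) simp_all
        qed
      qed
      show "adjoin_mult a A B = {p \<in> A. 1 * p \<in> ?B'}"
      proof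
        show "adjoin_mult a A B \<subseteq> {p \<in> A. 1 * p \<in> ?B'}"
          using AE BA A(2) A(4)[OF a] by (auto elim!: adjoin_multE intro: adjoin_multI)
        show "{p \<in> A. 1 * p \<in> ?B'} \<subseteq> adjoin_mult a A B"
        proof
          fix p assume "p \<in> {p \<in> A. 1 * p \<in> ?B'}"
          then obtain y b where p: "p \<in> A" "y \<in> E" "b \<in> B" "p = a * y + b"
            by (auto elim: adjoin_multE)
          have "p - b = a * y" using p by simp
          moreover have "p - b \<in> A" using p(1,3) BA A(5) by blast
          ultimately have "a * y \<in> A" by simp
          \<comment> \<open>Injectivity of a on E / A gives a E \<inter> A = a A; this is the
            exactness after reduction.\<close>
          then have "y \<in> A" using 1 p by blast
          then show "p \<in> adjoin_mult a A B" using p by (intro adjoin_multI)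
        qed
      qed
    qed (use sub in auto)
  qed (use sub Cons.prems(3) BA' AE' in auto)
  with 3 show ?case by simp
qed simp

text \<open>The submodule (a_1, ..., a_r) A + B, accumulated in the order in which
  \<open>weakly_regular\<close> divides, so that the two recursions match.\<close>

fun adjoin_all :: "'a::comm_ring_1 list \<Rightarrow> 'a set \<Rightarrow> 'a set \<Rightarrow> 'a set" where
  "adjoin_all [] A B = B"
| "adjoin_all (a # as) A B = adjoin_all as A (adjoin_mult a A B)"

lemma subideal_adjoin_all:
  "subideal C A \<Longrightarrow> subideal C B \<Longrightarrow> subideal C (adjoin_all as A B)"
  by (induction as arbitrary: B) (simp_all add: subideal_adjoin_mult)

lemma weakly_regular_nth:
  "weakly_regular as A B \<Longrightarrow> i < length as \<Longrightarrow> x \<in> A \<Longrightarrow>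
    as ! i * x \<in> adjoin_all (take i as) A B \<Longrightarrow> x \<in> adjoin_all (take i as) A B"
proof (induction as arbitrary: B i)
  case (Cons a as)
  then show ?case by (cases i) simp_all
qed simp

lemma subset_adjoin_mult: "0 \<in> A \<Longrightarrow> B \<subseteq> adjoin_mult a A B"
  by (auto intro: adjoin_multI[of 0])

lemma subset_adjoin_all: "0 \<in> A \<Longrightarrow> B \<subseteq> adjoin_all as A B"
  by (induction as arbitrary: B) (auto dest: subset_adjoin_mult)

lemma mult_mem_adjoin_all:
  assumes "0 \<in> A" "0 \<in> B" "a \<in> set as" "y \<in> A"
  shows "a * y \<in> adjoin_all as A B"
  using assms(2,3)
proof (induction as arbitrary: B)
  case (Cons b as)
  show ?case
  proof (cases "a = b")
    case True
    have "a * y \<in> adjoin_mult b A B"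
      using Cons.prems assms True by (intro adjoin_multI[of y A 0]) simp_all
    then show ?thesis using subset_adjoin_all[OF assms(1)] by auto
  next
    case False
    then show ?thesis using Cons subset_adjoin_mult[OF assms(1)] by auto
  qed
qed simp

text \<open>Of \<open>N\<close> only closure under addition is asked, so that it may be cut out by
  the vanishing of one coefficient, as in \<open>adjoin_all_stratum\<close>.\<close>

lemma adjoin_all_subset:
  assumes N: "\<And>x y. x \<in> N \<Longrightarrow> y \<in> N \<Longrightarrow> x + y \<in> N"
    and "\<And>a y. a \<in> set as \<Longrightarrow> y \<in> A \<Longrightarrow> a * y \<in> N" and "B \<subseteq> N"
  shows "adjoin_all as A B \<subseteq> N"
  using assms(2,3)
proof (induction as arbitrary: B)
  case (Cons a as)
  have "adjoin_mult a A B \<subseteq> N" using Cons.prems N by (auto elim!: adjoin_multE)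
  with Cons show ?case by simp
qed simp

section \<open>Monomial ideals\<close>

abbreviation exp_vectors :: "nat \<Rightarrow> (nat \<Rightarrow>\<^sub>0 nat) set" where
  "exp_vectors n \<equiv> {t. Poly_Mapping.keys t \<subseteq> {1..n}}"

definition monom_span :: "(nat \<Rightarrow>\<^sub>0 nat) set \<Rightarrow> 'k::field mpoly set" where
  "monom_span S = {p. Poly_Mapping.keys p \<subseteq> S}"

text \<open>The exponent sets of monomial ideals of K[x_1, ..., x_n]; \<open>monom_span\<close>
  yields the ideal itself.\<close>

definition upset :: "nat \<Rightarrow> (nat \<Rightarrow>\<^sub>0 nat) set \<Rightarrow> bool" where
  "upset n S \<longleftrightarrow> S \<subseteq> exp_vectors n \<and> (\<forall>s\<in>exp_vectors n. \<forall>t\<in>S. s + t \<in> S)"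

lemma keys_add_nat: "Poly_Mapping.keys (s + t) = Poly_Mapping.keys s \<union> Poly_Mapping.keys (t :: nat \<Rightarrow>\<^sub>0 nat)"
  by (auto simp: in_keys_iff lookup_add)

lemma carrier_poly_ring: "carrier (poly_ring n) = monom_span (exp_vectors n)"
  by (auto simp: poly_ring_def monom_span_def)

lemma poly_ring_simps [simp]:
  "monoid.mult (poly_ring n) = (*)" "one (poly_ring n) = 1" "zero (poly_ring n) = 0" "add (poly_ring n) = (+)"
  by (simp_all add: poly_ring_def)

lemma monom_span_add: "p \<in> monom_span S \<Longrightarrow> q \<in> monom_span S \<Longrightarrow> p + q \<in> monom_span S"
  using keys_add[of p q] by (auto simp: monom_span_def)

lemma monom_span_uminus: "p \<in> monom_span S \<Longrightarrow> - p \<in> monom_span S"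
  by (simp add: monom_span_def in_keys_iff subset_iff)

lemma monom_span_0: "0 \<in> monom_span S"
  by (simp add: monom_span_def)

lemma monom_span_diff: "p \<in> monom_span S \<Longrightarrow> q \<in> monom_span S \<Longrightarrow> p - q \<in> monom_span S"
  using monom_span_add[of p S "- q"] monom_span_uminus[of q S] by simp

lemma monom_span_sum: "(\<And>i. i \<in> A \<Longrightarrow> f i \<in> monom_span S) \<Longrightarrow> sum f A \<in> monom_span S"
  by (induction A rule: infinite_finite_induct) (auto simp: monom_span_add monom_span_0)

lemma monom_span_mult:
  assumes "p \<in> monom_span S" "q \<in> monom_span T" "\<And>s t. s \<in> S \<Longrightarrow> t \<in> T \<Longrightarrow> s + t \<in> U"
  shows "p * q \<in> monom_span U"
  using assms keys_mult[of p q] unfolding monom_span_def by blast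

lemma monom_span_mono: "S \<subseteq> T \<Longrightarrow> monom_span S \<subseteq> monom_span T"
  by (auto simp: monom_span_def)

lemma single_mem_monom_span: "t \<in> S \<Longrightarrow> Poly_Mapping.single t c \<in> monom_span S"
  by (simp add: monom_span_def)

lemma cring_poly_ring: "cring (poly_ring n :: 'k::field mpoly ring)"
proof -
  have mult: "p * q \<in> carrier (poly_ring n)" if "p \<in> carrier (poly_ring n)" "q \<in> carrier (poly_ring n)"
    for p q :: "'k mpoly"
    using that unfolding carrier_poly_ring by (rule monom_span_mult) (auto simp: keys_add_nat)
  show ?thesis
  proof (rule cringI)
    show "abelian_group (poly_ring n :: 'k mpoly ring)"
    proof (rule abelian_groupI)
      fix x :: "'k mpoly" assume x: "x \<in> carrier (poly_ring n)"
      then show "\<exists>y\<in>carrier (poly_ring n). y \<oplus>\<^bsub>poly_ring n\<^esub> x = \<zero>\<^bsub>poly_ring n\<^esub>"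
        by (intro bexI[of _ "- x"]) (auto simp: carrier_poly_ring monom_span_uminus)
    qed (auto simp: carrier_poly_ring monom_span_add monom_span_0 algebra_simps)
    show "comm_monoid (poly_ring n :: 'k mpoly ring)"
      by (rule comm_monoidI) (auto simp: mult, auto simp: carrier_poly_ring monom_span_def algebra_simps)
  qed (auto simp: algebra_simps)
qed

interpretation poly_ring: cring "poly_ring n" for n by (rule cring_poly_ring)

lemma a_inv_poly_ring:
  assumes "p \<in> carrier (poly_ring n)"
  shows "\<ominus>\<^bsub>poly_ring n\<^esub> p = - p"
  by (rule poly_ring.minus_equality) (use assms in \<open>simp_all add: carrier_poly_ring monom_span_uminus\<close>)

lemma subideal_carrier: "subideal (carrier (poly_ring n)) (carrier (poly_ring n))"
  unfolding subideal_def
  using poly_ring.m_closed[of _ n] by (auto simp: carrier_poly_ring monom_span_0 monom_span_add monom_span_uminus)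

lemma subideal_monom_span:
  "upset n S \<Longrightarrow> subideal (carrier (poly_ring n)) (monom_span S)"
  unfolding subideal_def carrier_poly_ring
  by (auto simp: monom_span_0 monom_span_add monom_span_uminus upset_def elim: monom_span_mult)

lemma lookup_single_mult:
  fixes p :: "'k::field mpoly"
  shows "Poly_Mapping.lookup (Poly_Mapping.single s 1 * p) (s + t) = Poly_Mapping.lookup p t"
proof -
  have "Poly_Mapping.lookup (Poly_Mapping.single s 1 * p) (s + t) =
     (\<Sum>l. (1 when s = l) * (\<Sum>q. Poly_Mapping.lookup p q when s + t = l + q))"
    by (simp add: lookup_mult lookup_single)
  also have "\<dots> = (\<Sum>l. (\<Sum>q. Poly_Mapping.lookup p q when s + t = s + q) when l = s)"
    by (rule Sum_any.cong) (auto simp: when_def)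
  also have "\<dots> = (\<Sum>q. Poly_Mapping.lookup p q when t = q)" by simp
  also have "\<dots> = Poly_Mapping.lookup p t" by simp
  finally show ?thesis .
qed

text \<open>Multiplication by a monomial shifts exponents injectively, so nothing cancels and
  membership is read off exponent by exponent.\<close>

lemma single_mult_mem_monom_span_iff:
  fixes p :: "'k::field mpoly"
  shows "Poly_Mapping.single s 1 * p \<in> monom_span S \<longleftrightarrow> (\<forall>t\<in>Poly_Mapping.keys p. s + t \<in> S)"
proof
  assume *: "Poly_Mapping.single s 1 * p \<in> monom_span S"
  show "\<forall>t\<in>Poly_Mapping.keys p. s + t \<in> S"
  proof
    fix t assume "t \<in> Poly_Mapping.keys p"
    then have "s + t \<in> Poly_Mapping.keys (Poly_Mapping.single s 1 * p)"
      by (simp add: in_keys_iff lookup_single_mult)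
    with * show "s + t \<in> S" by (auto simp: monom_span_def)
  qed
next
  assume "\<forall>t\<in>Poly_Mapping.keys p. s + t \<in> S"
  then show "Poly_Mapping.single s 1 * p \<in> monom_span S"
    using keys_mult[of "Poly_Mapping.single s 1" p] by (auto simp: monom_span_def)
qed

lemma sum_singles: "(\<Sum>t\<in>Poly_Mapping.keys p. Poly_Mapping.single t (Poly_Mapping.lookup p t)) = p"
  proof (rule poly_mapping_eqI)
  fix k
  show "Poly_Mapping.lookup (\<Sum>t\<in>Poly_Mapping.keys p. Poly_Mapping.single t (Poly_Mapping.lookup p t)) k = Poly_Mapping.lookup p k"
    by (simp add: lookup_sum lookup_single when_def in_keys_iff sum.delta)
qed

lemma exists_monomial_diff:
  fixes t s :: "nat \<Rightarrow>\<^sub>0 nat"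
  assumes "\<And>j. Poly_Mapping.lookup s j \<le> Poly_Mapping.lookup t j"
  obtains q where "t = s + q" "Poly_Mapping.keys q \<subseteq> Poly_Mapping.keys t"
proof
  show "t = s + (t - s)" using assms by (intro poly_mapping_eqI) (simp add: lookup_add lookup_minus)
  show "Poly_Mapping.keys (t - s) \<subseteq> Poly_Mapping.keys t" by (auto simp: in_keys_iff lookup_minus)
qed

section \<open>Squarefree monomials\<close>

definition ind_exp :: "nat set \<Rightarrow> nat \<Rightarrow>\<^sub>0 nat" where
  "ind_exp S = (\<Sum>j\<in>S. Poly_Mapping.single j 1)"

lemma lookup_ind_exp: "finite S \<Longrightarrow> Poly_Mapping.lookup (ind_exp S) j = (if j \<in> S then 1 else 0)"
  by (simp add: ind_exp_def lookup_sum lookup_single when_def)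

lemma keys_ind_exp: "finite S \<Longrightarrow> Poly_Mapping.keys (ind_exp S) = S"
  by (auto simp: in_keys_iff lookup_ind_exp split: if_splits)

lemma prod_var: "finite S \<Longrightarrow> (\<Prod>j\<in>S. var j :: 'k::field mpoly) = Poly_Mapping.single (ind_exp S) 1"
  by (induction S rule: finite_induct) (auto simp: ind_exp_def var_def mult_single)

lemma ind_exp_decomp:
  assumes "finite S" "S \<subseteq> Poly_Mapping.keys t"
  obtains q where "t = ind_exp S + q" "Poly_Mapping.keys q \<subseteq> Poly_Mapping.keys t"
  by (rule exists_monomial_diff[of "ind_exp S" t])
    (use assms in \<open>auto simp: lookup_ind_exp in_keys_iff Suc_le_eq\<close>)

section \<open>Elementary symmetric polynomials as a system of parameters\<close>

lemma monom_span_subset_subideal: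
  assumes A: "subideal C A" and "\<And>t c. t \<in> S \<Longrightarrow> Poly_Mapping.single t c \<in> A"
  shows "monom_span S \<subseteq> A"
proof
  fix p :: "'a mpoly" assume p: "p \<in> monom_span S"
  have "(\<Sum>t\<in>T. Poly_Mapping.single t (Poly_Mapping.lookup p t)) \<in> A" if "T \<subseteq> S" for T
    using that by (induction T rule: infinite_finite_induct) (auto intro: subidealD(1,2)[OF A] assms(2))
  from this[of "Poly_Mapping.keys p"] p show "p \<in> A"
    unfolding sum_singles by (simp add: monom_span_def)
qed

text \<open>Spans the ideal generated by the variables outside F, whose quotient is the polynomial
  ring K[F].\<close>

definition nonface_exps :: "nat \<Rightarrow> nat set \<Rightarrow> (nat \<Rightarrow>\<^sub>0 nat) set" where
  "nonface_exps n F = {t \<in> exp_vectors n. \<not> Poly_Mapping.keys t \<subseteq> F}"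

lemma upset_nonface_exps: "upset n (nonface_exps n F)"
  by (auto simp: upset_def nonface_exps_def keys_add_nat)

text \<open>Multiplication by the squarefree monomial x_r maps R onto \<open>monom_span S\<close>
  modulo \<open>monom_span S'\<close>, and its kernel is the ideal of the variables outside F. The
  quotient is K[F] shifted by x_r, and regularity transfers along this map.\<close>

lemma weakly_regular_interval:
  assumes S: "upset n S" and S': "upset n S'" and sub: "S' \<subseteq> S"
    and diff: "S - S' = {t \<in> exp_vectors n. r \<subseteq> Poly_Mapping.keys t \<and> Poly_Mapping.keys t \<subseteq> F}"
    and rF: "r \<subseteq> F" and F: "F \<subseteq> {1..n}"
    and reg: "weakly_regular as (carrier (poly_ring n)) (monom_span (nonface_exps n F))"
    and as: "set as \<subseteq> carrier (poly_ring n :: 'k::field mpoly ring)"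
  shows "weakly_regular as (monom_span S) (monom_span S' :: 'k mpoly set)"
proof -
  let ?R = "carrier (poly_ring n :: 'k mpoly ring)"
  let ?u = "Poly_Mapping.single (ind_exp r) 1 :: 'k mpoly"
  have fin: "finite r" using finite_subset[OF subset_trans[OF rF F]] by simp
  note keys_r = keys_ind_exp[OF fin]
  have rn: "ind_exp r \<in> exp_vectors n" using keys_r rF F by auto
  have rS: "ind_exp r \<in> S" using diff keys_r rF F by auto
  have rt: "ind_exp r + t \<in> S" if "t \<in> exp_vectors n" for t
    using S rS that unfolding upset_def by (metis add.commute)
  have rt': "ind_exp r + t \<in> S' \<longleftrightarrow> t \<in> nonface_exps n F" if t: "t \<in> exp_vectors n" for t
  proof -
    have "ind_exp r + t \<in> exp_vectors n" using rn t by (simp add: keys_add_nat)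
    then have "ind_exp r + t \<in> S - S' \<longleftrightarrow> Poly_Mapping.keys t \<subseteq> F"
      unfolding diff using rF by (simp add: keys_add_nat keys_r)
    then show ?thesis using rt[OF t] t by (auto simp: nonface_exps_def)
  qed
  have sub_adj: "subideal ?R (adjoin_mult ?u ?R (monom_span S'))"
    by (rule subideal_adjoin_mult[OF subideal_carrier subideal_monom_span[OF S']])
  show ?thesis
  proof (rule weakly_regular_transfer[OF reg subideal_carrier subideal_monom_span[OF S]
        subideal_monom_span[OF S'] as])
    show "monom_span S = adjoin_mult ?u ?R (monom_span S')"
    proof
      show "monom_span S \<subseteq> adjoin_mult ?u ?R (monom_span S')"
      proof (rule monom_span_subset_subideal[OF sub_adj])
        fix t and c :: 'k assume t: "t \<in> S"
        show "Poly_Mapping.single t c \<in> adjoin_mult ?u ?R (monom_span S')"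
        proof (cases "t \<in> S'")
          case True
          then show ?thesis
            by (intro adjoin_multI[of 0 _ "Poly_Mapping.single t c"])
              (auto simp: carrier_poly_ring monom_span_0 single_mem_monom_span)
        next
          case False
          then have "r \<subseteq> Poly_Mapping.keys t" "Poly_Mapping.keys t \<subseteq> {1..n}" using diff t by auto
          then obtain q where q: "t = ind_exp r + q" "Poly_Mapping.keys q \<subseteq> {1..n}"
            using ind_exp_decomp[OF fin] by (metis subset_trans)
          then show ?thesis
            by (intro adjoin_multI[of "Poly_Mapping.single q c" _ 0])
              (auto simp: carrier_poly_ring monom_span_0 single_mem_monom_span mult_single)
        qed
      qed
      show "adjoin_mult ?u ?R (monom_span S') \<subseteq> monom_span S"
      proof
        fix x assume "x \<in> adjoin_mult ?u ?R (monom_span S')"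
        then obtain y b where y: "y \<in> ?R" "b \<in> monom_span S'" "x = ?u * y + b" by (elim adjoin_multE)
        have "?u * y \<in> monom_span S"
          unfolding single_mult_mem_monom_span_iff using y(1) rt
          by (auto simp: carrier_poly_ring monom_span_def)
        moreover have "b \<in> monom_span S" using y(2) monom_span_mono[OF sub] by blast
        ultimately show "x \<in> monom_span S" unfolding y(3) by (rule monom_span_add)
      qed
    qed
    show "monom_span (nonface_exps n F) = {p \<in> ?R. ?u * p \<in> monom_span S'}"
    proof -
      have "p \<in> monom_span (nonface_exps n F) \<longleftrightarrow> p \<in> ?R \<and> (\<forall>t\<in>Poly_Mapping.keys p. ind_exp r + t \<in> S')"
        for p :: "'k mpoly"
        using rt' unfolding carrier_poly_ring monom_span_def
        by (auto simp: subset_iff nonface_exps_def)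
      then show ?thesis unfolding single_mult_mem_monom_span_iff by blast
    qed
  qed
qed

section \<open>Elementary symmetric polynomials modulo a face ideal\<close>

definition esym :: "nat \<Rightarrow> nat \<Rightarrow> 'k::field mpoly" where
  "esym n i = (\<Sum>S\<in>{S. S \<subseteq> {1..n} \<and> card S = i}. Poly_Mapping.single (ind_exp S) 1)"

text \<open>Listed from e_d down to e_1, so that the tail is the list belonging to faces with one
  vertex fewer.\<close>

fun esyms :: "nat \<Rightarrow> nat \<Rightarrow> 'k::field mpoly list" where
  "esyms n 0 = []"
| "esyms n (Suc d) = esym n (Suc d) # esyms n d"

lemma length_esyms: "length (esyms n d) = d"
  by (induction d) auto

lemma set_esyms: "set (esyms n d) = esym n ` {1..d}"
  by (induction d) (auto simp: atLeastAtMostSuc_conv)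

lemma keys_esym:
  assumes "t \<in> Poly_Mapping.keys (esym n i)"
  obtains S where "S \<subseteq> {1..n}" "card S = i" "t = ind_exp S"
proof -
  have "esym n i \<in> monom_span (ind_exp ` {S. S \<subseteq> {1..n} \<and> card S = i})"
    unfolding esym_def by (rule monom_span_sum) (auto intro!: single_mem_monom_span)
  with assms show thesis using that by (auto simp: monom_span_def)
qed

lemma esym_carrier: "esym n i \<in> carrier (poly_ring n)"
  unfolding carrier_poly_ring esym_def
proof (intro monom_span_sum single_mem_monom_span)
  fix S assume S: "S \<in> {S. S \<subseteq> {1..n} \<and> card S = i}"
  then have "finite S" using finite_subset[of S "{1..n}"] by simp
  then show "ind_exp S \<in> exp_vectors n" using S by (simp add: keys_ind_exp)
qed

text \<open>Among the d-element subsets of {1..n}, only F itself is contained in F; every other term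
  of e_d has a variable outside F.\<close>

lemma esym_facet:
  assumes "F \<subseteq> {1..n}" "card F = d"
  obtains q where "esym n d = Poly_Mapping.single (ind_exp F) 1 + q" "q \<in> monom_span (nonface_exps n F)"
proof
  let ?A = "{S. S \<subseteq> {1..n} \<and> card S = d}"
  have fin: "finite ?A" by simp
  have "F \<in> ?A" using assms by simp
  then show "esym n d = Poly_Mapping.single (ind_exp F) 1 + (\<Sum>S\<in>?A - {F}. Poly_Mapping.single (ind_exp S) 1)"
    unfolding esym_def by (rule sum.remove[OF fin])
  show "(\<Sum>S\<in>?A - {F}. Poly_Mapping.single (ind_exp S) 1) \<in> monom_span (nonface_exps n F)"
  proof (rule monom_span_sum, rule single_mem_monom_span)
    fix S assume S: "S \<in> ?A - {F}"
    have finF: "finite F" and finS: "finite S" using assms S finite_subset[of _ "{1..n}"] by auto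
    have "\<not> S \<subseteq> F" using S assms card_subset_eq[OF finF, of S] by auto
    then show "ind_exp S \<in> nonface_exps n F"
      using S by (auto simp: nonface_exps_def keys_ind_exp[OF finS])
  qed
qed

text \<open>
  Modulo the face ideal of \<open>F\<close>, the top elementary symmetric polynomial is the product of the
  variables in \<open>F\<close>; dividing it out leaves the boundary of a simplex, which is filtered by
  shifted coordinate rings of the smaller faces \<open>F - {f}\<close>.
\<close>
lemma weakly_regular_esyms:
  assumes "F \<subseteq> {1..n}" "card F = d"
  shows "weakly_regular (esyms n d) (carrier (poly_ring n))
    (monom_span (nonface_exps n F) :: 'k::field mpoly set)"
  using assms
proof (induction d arbitrary: F)
  case (Suc d)
  let ?R = "carrier (poly_ring n :: 'k mpoly ring)"
  let ?N = "monom_span (nonface_exps n F) :: 'k mpoly set"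
  let ?e = "esym n (Suc d) :: 'k mpoly"
  let ?u = "Poly_Mapping.single (ind_exp F) 1 :: 'k mpoly"
  have finF: "finite F" using finite_subset[OF Suc.prems(1)] by simp
  obtain q where q: "?e = ?u + q" "q \<in> ?N" using esym_facet[OF Suc.prems] .
  have subN: "subideal ?R ?N" by (rule subideal_monom_span[OF upset_nonface_exps])
  note N = subidealD[OF subN]
  have keysF: "ind_exp F \<in> exp_vectors n" using Suc.prems(1) keys_ind_exp[OF finF] by simp
  have qy: "q * y \<in> ?N" if "y \<in> ?R" for y
    using N(4)[OF that q(2)] by (simp add: mult.commute)
  have nzd: "x \<in> ?N" if x: "x \<in> ?R" "?e * x \<in> ?N" for x
  proof -
    \<comment> \<open>Modulo N the first polynomial is the monomial x_F, and multiplying by x_F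
      cannot move a support contained in F out of F.\<close>
    have "?u * x = ?e * x - q * x" unfolding q(1) by (simp add: algebra_simps)
    also have "\<dots> \<in> ?N" using N(5)[OF x(2) qy[OF x(1)]] .
    finally have "\<forall>t\<in>Poly_Mapping.keys x. ind_exp F + t \<in> nonface_exps n F"
      unfolding single_mult_mem_monom_span_iff .
    then show ?thesis
      by (auto simp: monom_span_def nonface_exps_def keys_add_nat keys_ind_exp[OF finF])
  qed
  \<comment> \<open>\<open>J G\<close> belongs to the ideal generated by x_G and the variables
    outside F. As G grows from {} to F, it descends from the whole ring to the ideal reached after
    dividing by the first polynomial.\<close>
  define J where "J G = {t \<in> exp_vectors n. \<not> Poly_Mapping.keys t \<subseteq> F \<or> G \<subseteq> Poly_Mapping.keys t}" for G
  have upJ: "upset n (J G)" for G by (auto simp: upset_def J_def keys_add_nat)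
  have adj: "adjoin_mult ?e ?R ?N = monom_span (J F)"
  proof
    show "adjoin_mult ?e ?R ?N \<subseteq> monom_span (J F)"
    proof
      fix x assume "x \<in> adjoin_mult ?e ?R ?N"
      then obtain y b where y: "y \<in> ?R" "b \<in> ?N" "x = ?e * y + b" by (elim adjoin_multE)
      have "?u * y \<in> monom_span (J F)"
        using y(1) keysF unfolding single_mult_mem_monom_span_iff
        by (auto simp: J_def keys_add_nat keys_ind_exp[OF finF] carrier_poly_ring monom_span_def)
      moreover have "q * y + b \<in> monom_span (J F)"
        using N(2)[OF qy[OF y(1)] y(2)] by (auto simp: monom_span_def J_def nonface_exps_def)
      ultimately have "?u * y + (q * y + b) \<in> monom_span (J F)" by (rule monom_span_add)
      then show "x \<in> monom_span (J F)" unfolding y(3) q(1) by (simp add: algebra_simps)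
    qed
    show "monom_span (J F) \<subseteq> adjoin_mult ?e ?R ?N"
    proof (rule monom_span_subset_subideal)
      show "subideal ?R (adjoin_mult ?e ?R ?N)"
        by (intro subideal_adjoin_mult subideal_carrier subideal_monom_span upset_nonface_exps)
      fix t and c :: 'k assume t: "t \<in> J F"
      show "Poly_Mapping.single t c \<in> adjoin_mult ?e ?R ?N"
      proof (cases "Poly_Mapping.keys t \<subseteq> F")
        case False
        then show ?thesis using t
          by (intro adjoin_multI[of 0 _ "Poly_Mapping.single t c"])
            (auto simp: carrier_poly_ring monom_span_0 single_mem_monom_span J_def nonface_exps_def)
      next
        case True
        then have "F \<subseteq> Poly_Mapping.keys t" "Poly_Mapping.keys t \<subseteq> {1..n}" using t by (auto simp: J_def)
        then obtain r where r: "t = ind_exp F + r" "Poly_Mapping.keys r \<subseteq> {1..n}"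
          using ind_exp_decomp[OF finF] by (metis subset_trans)
        have rR: "Poly_Mapping.single r c \<in> ?R"
          using r(2) by (auto simp: carrier_poly_ring monom_span_def)
        have "Poly_Mapping.single t c = ?u * Poly_Mapping.single r c"
          by (simp add: r(1) mult_single)
        also have "\<dots> = ?e * Poly_Mapping.single r c + - (q * Poly_Mapping.single r c)"
          unfolding q(1) by (simp add: algebra_simps)
        finally show ?thesis by (rule adjoin_multI[OF rR N(3)[OF qy[OF rR]]])
      qed
    qed
  qed
  have esR: "set (esyms n d) \<subseteq> ?R" by (auto simp: set_esyms esym_carrier)
  have "weakly_regular (esyms n d) ?R (monom_span (J G))" if "G \<subseteq> F" for G
    using finite_subset[OF that finF] that
  proof (induction G rule: finite_induct)
    case empty
    have "monom_span (J {}) = ?R" by (simp add: J_def carrier_poly_ring)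
    then show ?case using weakly_regular_refl[OF subideal_carrier esR] by simp
  next
    case (insert f G)
    have Jsub: "J (insert f G) \<subseteq> J G" "J G \<subseteq> exp_vectors n" by (auto simp: J_def)
    \<comment> \<open>The monomials lost on passing from G to \<open>insert f G\<close> are those
      supported in F that are divisible by x_G but not by x_f. The face F - {f} has d elements, so
      the outer induction hypothesis applies to it.\<close>
    have "weakly_regular (esyms n d) (monom_span (J G)) (monom_span (J (insert f G)) :: 'k mpoly set)"
    proof (rule weakly_regular_interval[where r = G and F = "F - {f}"])
      show "J G - J (insert f G) =
        {t \<in> exp_vectors n. G \<subseteq> Poly_Mapping.keys t \<and> Poly_Mapping.keys t \<subseteq> F - {f}}"
        by (auto simp: J_def)
      show "weakly_regular (esyms n d) ?R (monom_span (nonface_exps n (F - {f})))"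
        using Suc.prems insert.prems finF by (intro Suc.IH) auto
    qed (use insert Suc.prems esR upJ Jsub in auto)
    moreover have "weakly_regular (esyms n d) ?R (monom_span (J G))" using insert by simp
    ultimately show ?case
    proof (rule_tac weakly_regular_extension[where C = ?R])
      show "monom_span (J (insert f G)) \<subseteq> (monom_span (J G) :: 'k mpoly set)"
        by (rule monom_span_mono[OF Jsub(1)])
      show "monom_span (J G) \<subseteq> ?R"
        unfolding carrier_poly_ring by (rule monom_span_mono[OF Jsub(2)])
    qed (rule subideal_carrier esR subideal_monom_span[OF upJ] | assumption)+
  qed
  from this[of F] nzd show ?case by (simp add: adj)
qed simp

section \<open>Dimension of polynomial rings\<close>

fun power_product :: "'a::comm_ring_1 list \<Rightarrow> nat list \<Rightarrow> 'a" where
  "power_product (x # xs) (e # es) = x ^ e * power_product xs es"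
| "power_product _ _ = 1"

abbreviation exps_upto :: "nat \<Rightarrow> nat \<Rightarrow> nat list set" where
  "exps_upto r N \<equiv> {es. set es \<subseteq> {..N} \<and> length es = r}"

lemma exps_upto_Suc: "exps_upto (Suc r) N = (\<lambda>(e, es). e # es) ` ({..N} \<times> exps_upto r N)"
  by (auto simp: image_iff length_Suc_conv)

definition const_poly :: "'k::field \<Rightarrow> 'k mpoly" where
  "const_poly c = Poly_Mapping.single 0 c"

lemma const_poly_carrier: "const_poly c \<in> carrier (poly_ring n)"
  by (simp add: const_poly_def carrier_poly_ring monom_span_def)

lemma poly_ring_idealD:
  assumes "ideal P (poly_ring n :: 'k::field mpoly ring)"
  shows "subideal (carrier (poly_ring n)) P" "P \<subseteq> carrier (poly_ring n)"
proof -
  interpret ideal P "poly_ring n" by fact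
  show sub: "P \<subseteq> carrier (poly_ring n)" by (rule a_subset)
  show "subideal (carrier (poly_ring n)) P"
    unfolding subideal_def
  proof (intro conjI ballI)
    show "0 \<in> P" using zero_closed by simp
    fix x assume x: "x \<in> P"
    show "- x \<in> P" using a_inv_closed[OF x] a_inv_poly_ring[of x n] sub x by auto
    show "x + y \<in> P" if "y \<in> P" for y using a_closed[OF x that] by simp
    show "c * x \<in> P" if "c \<in> carrier (poly_ring n)" for c using I_l_closed[OF x that] by simp
  qed
qed

lemma poly_ring_primeD:
  assumes "primeideal P (poly_ring n :: 'k::field mpoly ring)"
  shows "x \<in> carrier (poly_ring n) \<Longrightarrow> y \<in> carrier (poly_ring n) \<Longrightarrow> x * y \<in> P \<Longrightarrow> x \<in> P \<or> y \<in> P"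
    and "1 \<notin> P"
proof -
  interpret primeideal P "poly_ring n" by fact
  show "x \<in> carrier (poly_ring n) \<Longrightarrow> y \<in> carrier (poly_ring n) \<Longrightarrow> x * y \<in> P \<Longrightarrow> x \<in> P \<or> y \<in> P"
    using I_prime[of x y] by simp
  show "1 \<notin> P" using I_notcarr one_imp_carrier by (metis poly_ring_simps(2))
qed

lemma one_carrier: "1 \<in> carrier (poly_ring n)"
  using poly_ring.one_closed[of n] by simp

lemma mult_carrier: "x \<in> carrier (poly_ring n) \<Longrightarrow> y \<in> carrier (poly_ring n) \<Longrightarrow> x * y \<in> carrier (poly_ring n)"
  using poly_ring.m_closed[of x n y] by simp

lemma power_carrier: "x \<in> carrier (poly_ring n) \<Longrightarrow> x ^ k \<in> carrier (poly_ring n)"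
  by (induction k) (auto simp: one_carrier mult_carrier)

lemma power_product_carrier:
  "set xs \<subseteq> carrier (poly_ring n) \<Longrightarrow> power_product xs es \<in> carrier (poly_ring n)"
  by (induction xs es rule: power_product.induct) (auto simp: one_carrier power_carrier mult_carrier)

lemma power_notin_prime:
  assumes "primeideal P (poly_ring n :: 'k::field mpoly ring)" "x \<in> carrier (poly_ring n)" "x \<notin> P"
  shows "x ^ k \<notin> P"
  by (induction k) (use assms poly_ring_primeD[OF assms(1)] power_carrier[OF assms(2)] in auto)

lemma carrier_sum:
  "(\<And>i. i \<in> A \<Longrightarrow> f i \<in> carrier (poly_ring n)) \<Longrightarrow> sum f A \<in> carrier (poly_ring n)"
  unfolding carrier_poly_ring by (rule monom_span_sum)

text \<open>
  Along a chain of primes, elements \<open>x\<^sub>i \<in> P\<^sub>i\<^sub>+\<^sub>1 - P\<^sub>i\<close> are algebraically independent modulo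
  \<open>P\<^sub>0\<close>: factor the smallest power of \<open>x\<^sub>0\<close> out of a relation and reduce modulo \<open>P\<^sub>1\<close>.
\<close>
lemma prime_chain_independent:
  fixes P :: "nat \<Rightarrow> 'k::field mpoly set"
  assumes "\<And>i. i \<le> length xs \<Longrightarrow> primeideal (P i) (poly_ring n)"
    and "\<And>i. i < length xs \<Longrightarrow> P i \<subseteq> P (Suc i) \<and> xs ! i \<in> P (Suc i) - P i"
    and "set xs \<subseteq> carrier (poly_ring n)"
    and "es0 \<in> exps_upto (length xs) N" "c es0 \<noteq> 0"
  shows "(\<Sum>es\<in>exps_upto (length xs) N. const_poly (c es) * power_product xs es) \<notin> P 0"
  using assms
proof (induction xs arbitrary: P c es0)
  case Nil
  then have pr: "primeideal (P 0) (poly_ring n)" and c: "c [] \<noteq> 0" by auto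
  show ?case
  proof
    assume "(\<Sum>es\<in>exps_upto (length []) N. const_poly (c es) * power_product [] es) \<in> P 0"
    moreover have "exps_upto (length []) N = {[]}" by auto
    ultimately have "const_poly (c []) \<in> P 0" by simp
    then have "const_poly (inverse (c [])) * const_poly (c []) \<in> P 0"
      using subidealD(4)[OF poly_ring_idealD(1)[OF primeideal.axioms(1)[OF pr]] const_poly_carrier] by blast
    moreover have "const_poly (inverse (c [])) * const_poly (c []) = 1"
      using c by (simp add: const_poly_def mult_single)
    ultimately show False using poly_ring_primeD(2)[OF pr] by simp
  qed
next
  case (Cons x xs)
  let ?R = "carrier (poly_ring n) :: 'k mpoly set"
  let ?E = "exps_upto (length xs) N"
  have pr: "primeideal (P 0) (poly_ring n)" "primeideal (P 1) (poly_ring n)"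
    using Cons.prems(1)[of 0] Cons.prems(1)[of 1] by auto
  note sub0 = poly_ring_idealD[OF primeideal.axioms(1)[OF pr(1)]]
  note sub1 = poly_ring_idealD[OF primeideal.axioms(1)[OF pr(2)]]
  have x: "x \<in> P 1" "x \<notin> P 0" "x \<in> ?R" "P 0 \<subseteq> P 1" using Cons.prems(2)[of 0] Cons.prems(3) by auto
  have xs: "set xs \<subseteq> ?R" using Cons.prems by simp
  define s where "s e = (\<Sum>es\<in>?E. const_poly (c (e # es)) * power_product xs es)" for e
  have sR: "s e \<in> ?R" for e
    unfolding s_def
    by (intro carrier_sum mult_carrier const_poly_carrier power_product_carrier[OF xs])
  have split: "(\<Sum>es\<in>exps_upto (length (x # xs)) N. const_poly (c es) * power_product (x # xs) es)
      = (\<Sum>e\<le>N. x ^ e * s e)"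
  proof -
    have "(\<Sum>es\<in>exps_upto (length (x # xs)) N. const_poly (c es) * power_product (x # xs) es)
      = (\<Sum>p\<in>{..N} \<times> ?E. const_poly (c (fst p # snd p)) * power_product (x # xs) (fst p # snd p))"
      by (simp only: list.size exps_upto_Suc add_0_right add_Suc_right, subst sum.reindex)
        (auto simp: inj_on_def case_prod_beta)
    also have "\<dots> = (\<Sum>e\<le>N. \<Sum>es\<in>?E. const_poly (c (e # es)) * power_product (x # xs) (e # es))"
      by (simp add: sum.cartesian_product case_prod_beta)
    also have "\<dots> = (\<Sum>e\<le>N. x ^ e * s e)"
      by (simp add: s_def sum_distrib_left algebra_simps)
    finally show ?thesis .
  qed
  obtain e1 es1 where e1: "es0 = e1 # es1" "e1 \<le> N" "es1 \<in> ?E"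
    using Cons.prems(4) by (cases es0) auto
  define good where "good e \<longleftrightarrow> (\<exists>es\<in>?E. c (e # es) \<noteq> 0)" for e
  define m where "m = (LEAST e. good e)"
  have "good e1" using e1 Cons.prems(5) by (auto simp: good_def)
  then have gm: "good m" and mN: "m \<le> N" and least: "\<And>e. e < m \<Longrightarrow> \<not> good e"
    unfolding m_def using e1(2) by (auto intro: LeastI Least_le order.trans dest: not_less_Least)
  have s0: "s e = 0" if "e < m" for e
    using least[OF that] unfolding good_def s_def by (intro sum.neutral) (auto simp: const_poly_def)
  \<comment> \<open>\<open>w\<close> is what remains of the higher terms after dividing by x^m and
    one further x. Since x lies in \<open>P 1\<close>, only \<open>s m\<close> survives modulo
    \<open>P 1\<close>.\<close>
  define w where "w = (\<Sum>e\<in>{m<..N}. x ^ (e - Suc m) * s e)"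
  have wR: "w \<in> ?R"
    unfolding w_def by (intro carrier_sum mult_carrier power_carrier x sR)
  have "(\<Sum>e\<le>N. x ^ e * s e) = (\<Sum>e\<in>{m..N}. x ^ e * s e)"
    by (rule sum.mono_neutral_right) (auto simp: s0)
  also have "{m..N} = insert m {m<..N}" using mN by auto
  also have "(\<Sum>e\<in>\<dots>. x ^ e * s e) = x ^ m * s m + (\<Sum>e\<in>{m<..N}. x ^ e * s e)" by simp
  also have "(\<Sum>e\<in>{m<..N}. x ^ e * s e) = x ^ m * (x * w)"
    unfolding w_def sum_distrib_left
  proof (rule sum.cong[OF refl])
    fix e assume "e \<in> {m<..N}"
    then have "e = m + Suc (e - Suc m)" by simp
    then have "x ^ e = x ^ m * (x * x ^ (e - Suc m))" by (metis power_Suc power_add)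
    then show "x ^ e * s e = x ^ m * (x * (x ^ (e - Suc m) * s e))" by (simp add: algebra_simps)
  qed
  finally have fact: "(\<Sum>e\<le>N. x ^ e * s e) = x ^ m * (s m + x * w)" by (simp add: algebra_simps)
  have "s m \<notin> P 1"
  proof -
    obtain es2 where es2: "es2 \<in> ?E" "c (m # es2) \<noteq> 0" using gm unfolding good_def by blast
    have "(\<Sum>es\<in>?E. const_poly (c (m # es)) * power_product xs es) \<notin> P (Suc 0)"
    proof (rule Cons.IH[where P = "\<lambda>i. P (Suc i)" and c = "\<lambda>es. c (m # es)", OF _ _ xs es2])
      show "primeideal (P (Suc i)) (poly_ring n)" if "i \<le> length xs" for i
        using Cons.prems(1)[of "Suc i"] that by simp
      show "P (Suc i) \<subseteq> P (Suc (Suc i)) \<and> xs ! i \<in> P (Suc (Suc i)) - P (Suc i)" if "i < length xs" for i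
        using Cons.prems(2)[of "Suc i"] that by simp
    qed
    then show ?thesis unfolding s_def by simp
  qed
  moreover have xw: "x * w \<in> P 1" using subidealD(4)[OF sub1(1) wR x(1)] by (simp add: mult.commute)
  ultimately have "s m + x * w \<notin> P 1"
    using subidealD(5)[OF sub1(1), of "s m + x * w" "x * w"] by auto
  then have "s m + x * w \<notin> P 0" using x by blast
  moreover have "s m + x * w \<in> ?R"
    using poly_ring.a_closed[OF sR[of m], of "x * w"] sub1(2) xw by auto
  ultimately have "x ^ m * (s m + x * w) \<notin> P 0"
    using poly_ring_primeD(1)[OF pr(1) power_carrier[OF x(3)]] power_notin_prime[OF pr(1) x(3,2)] by blast
  then show ?case unfolding split fact .
qed

section \<open>Linear algebra over K and counting of monomials\<close>

interpretation mpoly_vs: vector_space "\<lambda>(c::'k::field) p. const_poly c * (p :: 'k mpoly)"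
  by unfold_locales
    (simp_all add: const_poly_def algebra_simps single_add mult_single flip: mult.assoc)

text \<open>There are more members than the span of the monomials of \<open>B\<close> has
  dimensions. The family may repeat a value, which a dependence within the set of its values does
  not detect; such a repetition is itself a relation.\<close>

lemma linear_dependence:
  fixes v :: "'i \<Rightarrow> 'k::field mpoly"
  assumes fin: "finite E" "finite B" and v: "\<And>e. e \<in> E \<Longrightarrow> v e \<in> monom_span B"
    and card: "card B < card E"
  obtains c e where "e \<in> E" "c e \<noteq> 0" "(\<Sum>e\<in>E. const_poly (c e) * v e) = 0"
proof (cases "inj_on v E")
  case False
  then obtain a b where ab: "a \<in> E" "b \<in> E" "a \<noteq> b" "v a = v b" by (auto simp: inj_on_def)
  define c where "c e = (if e = a then 1 else if e = b then - 1 else 0 :: 'k)" for e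
  have "(\<Sum>e\<in>E. const_poly (c e) * v e) = (\<Sum>e\<in>{a, b}. const_poly (c e) * v e)"
    using fin ab by (intro sum.mono_neutral_right) (auto simp: c_def const_poly_def)
  also have "\<dots> = 0" using ab by (simp add: c_def const_poly_def single_uminus)
  finally show thesis using that[of a c] ab by (simp add: c_def)
next
  case True
  let ?S = "(\<lambda>t. Poly_Mapping.single t 1) ` B :: 'k mpoly set"
  have "v e \<in> mpoly_vs.span ?S" if "e \<in> E" for e
  proof -
    have "Poly_Mapping.single t d \<in> mpoly_vs.span ?S" if "t \<in> B" for t and d :: 'k
    proof -
      have "const_poly d * Poly_Mapping.single t 1 \<in> mpoly_vs.span ?S"
        using that by (intro mpoly_vs.span_scale mpoly_vs.span_base) simp
      then show ?thesis by (simp add: const_poly_def mult_single)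
    qed
    then have "(\<Sum>t\<in>Poly_Mapping.keys (v e). Poly_Mapping.single t (Poly_Mapping.lookup (v e) t)) \<in> mpoly_vs.span ?S"
      using v[OF \<open>e \<in> E\<close>] by (intro mpoly_vs.span_sum) (auto simp: monom_span_def)
    then show ?thesis by (simp add: sum_singles)
  qed
  then have "v ` E \<subseteq> mpoly_vs.span ?S" by blast
  moreover have "card ?S < card (v ` E)"
    using card card_image_le[OF fin(2)] card_image[OF True] by (metis le_less_trans)
  ultimately have "mpoly_vs.dependent (v ` E)"
    using mpoly_vs.independent_span_bound[of ?S "v ` E"] fin by auto
  then obtain u where u: "\<exists>w\<in>v ` E. u w \<noteq> 0" "(\<Sum>w\<in>v ` E. const_poly (u w) * w) = 0"
    using mpoly_vs.dependent_finite[of "v ` E"] fin by auto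
  then obtain e where "e \<in> E" "u (v e) \<noteq> 0" by blast
  moreover have "(\<Sum>e\<in>E. const_poly (u (v e)) * v e) = 0"
    using u(2) by (simp add: sum.reindex[OF True])
  ultimately show thesis using that[of e "\<lambda>e. u (v e)"] by simp
qed

text \<open>Bounding each exponent separately, rather than the total degree, makes the count a plain
  power, (E + 1)^|F|.\<close>

definition exp_box :: "nat set \<Rightarrow> nat \<Rightarrow> (nat \<Rightarrow>\<^sub>0 nat) set" where
  "exp_box F E = {t. Poly_Mapping.keys t \<subseteq> F \<and> (\<forall>j. Poly_Mapping.lookup t j \<le> E)}"

lemma exp_box_card:
  assumes "finite F"
  shows "finite (exp_box F E)" "card (exp_box F E) \<le> Suc E ^ card F"
proof -
  let ?g = "\<lambda>t. restrict (Poly_Mapping.lookup t) F"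
  have inj: "inj_on ?g (exp_box F E)"
  proof (rule inj_onI)
    fix s t assume st: "s \<in> exp_box F E" "t \<in> exp_box F E" "?g s = ?g t"
    show "s = t"
    proof (rule poly_mapping_eqI)
      fix k show "Poly_Mapping.lookup s k = Poly_Mapping.lookup t k"
      proof (cases "k \<in> F")
        case True
        then show ?thesis using fun_cong[OF st(3), of k] by simp
      next
        case False
        then have "k \<notin> Poly_Mapping.keys s" "k \<notin> Poly_Mapping.keys t" using st by (auto simp: exp_box_def)
        then show ?thesis by (simp add: in_keys_iff)
      qed
    qed
  qed
  have sub: "?g ` exp_box F E \<subseteq> F \<rightarrow>\<^sub>E {..E}" by (auto simp: exp_box_def)
  have fin: "finite (F \<rightarrow>\<^sub>E {..E})" using assms by (intro finite_PiE) auto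
  show "finite (exp_box F E)" using inj_on_finite[OF inj sub fin] .
  show "card (exp_box F E) \<le> Suc E ^ card F"
    using card_inj_on_le[OF inj sub fin] by (simp add: card_PiE[OF assms])
qed

lemma exp_box_mult:
  assumes "p \<in> monom_span (exp_box F D)" "q \<in> monom_span (exp_box F E)" "D + E \<le> E'"
  shows "p * q \<in> monom_span (exp_box F E')"
proof (rule monom_span_mult[OF assms(1,2)])
  fix s t assume st: "s \<in> exp_box F D" "t \<in> exp_box F E"
  have "Poly_Mapping.lookup s j + Poly_Mapping.lookup t j \<le> E'" for j
    using st assms(3) add_mono[of "Poly_Mapping.lookup s j" D "Poly_Mapping.lookup t j" E]
    unfolding exp_box_def by fastforce
  then show "s + t \<in> exp_box F E'"
    using st by (simp add: exp_box_def keys_add_nat lookup_add)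
qed

lemma exp_box_one: "1 \<in> monom_span (exp_box F E)"
  by (simp add: monom_span_def exp_box_def)

lemma exp_box_power: "p \<in> monom_span (exp_box F D) \<Longrightarrow> p ^ k \<in> monom_span (exp_box F (k * D))"
  by (induction k) (auto intro: exp_box_mult exp_box_one)

lemma exp_box_power_product:
  assumes "set xs \<subseteq> monom_span (exp_box F D)" "es \<in> exps_upto (length xs) N"
  shows "power_product xs es \<in> monom_span (exp_box F (length xs * (N * D)))"
  using assms
proof (induction xs es rule: power_product.induct)
  case (1 x xs e es)
  have "x ^ e \<in> monom_span (exp_box F (e * D))" using 1 by (intro exp_box_power) auto
  moreover have "power_product xs es \<in> monom_span (exp_box F (length xs * (N * D)))" using 1 by auto
  moreover have "e * D + length xs * (N * D) \<le> length (x # xs) * (N * D)" using 1 by auto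
  ultimately show ?case unfolding power_product.simps by (rule exp_box_mult)
qed (auto simp: exp_box_one)

lemma exists_exp_box:
  assumes "finite A" "A \<subseteq> monom_span {t. Poly_Mapping.keys t \<subseteq> F}"
  obtains D where "A \<subseteq> monom_span (exp_box F D)"
proof
  let ?X = "\<Union>p\<in>A. \<Union>t\<in>Poly_Mapping.keys p. Poly_Mapping.lookup t ` Poly_Mapping.keys t"
  have fin: "finite ?X" using assms by auto
  have "Poly_Mapping.lookup t j \<le> Max (insert 0 ?X)" if "p \<in> A" "t \<in> Poly_Mapping.keys p" for p t j
  proof (cases "j \<in> Poly_Mapping.keys t")
    case True
    then show ?thesis using fin that by (intro Max_ge) auto
  qed (simp add: in_keys_iff)
  moreover have "Poly_Mapping.keys t \<subseteq> F" if "p \<in> A" "t \<in> Poly_Mapping.keys p" for p t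
    using assms(2) that unfolding monom_span_def by blast
  ultimately show "A \<subseteq> monom_span (exp_box F (Max (insert 0 ?X)))"
    unfolding monom_span_def exp_box_def by blast
qed

text \<open>A monomial whose support meets T is a multiple of a variable in P, so deleting all such
  monomials changes p only by an element of P.\<close>

lemma mod_vars_restrict:
  assumes P: "ideal P (poly_ring n :: 'k::field mpoly ring)" and T: "\<And>t. t \<in> T \<Longrightarrow> var t \<in> P"
    and T': "T \<subseteq> {1..n}" and p: "p \<in> carrier (poly_ring n)"
  obtains q where "q \<in> monom_span {t. Poly_Mapping.keys t \<subseteq> {1..n} - T}" "p - q \<in> P"
proof -
  note sub = poly_ring_idealD[OF P]
  let ?F = "{1..n} - T"
  let ?A = "{q + r |q r. q \<in> monom_span {t. Poly_Mapping.keys t \<subseteq> ?F} \<and> r \<in> P}"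
  have "\<exists>q r. q \<in> monom_span {t. Poly_Mapping.keys t \<subseteq> ?F} \<and> r \<in> P
     \<and> (\<Sum>t\<in>K. Poly_Mapping.single t (Poly_Mapping.lookup p t)) = q + r" if "K \<subseteq> exp_vectors n" for K
    using that
  proof (induction K rule: infinite_finite_induct)
    case (insert t K)
    then obtain q r where qr: "q \<in> monom_span {t. Poly_Mapping.keys t \<subseteq> ?F}" "r \<in> P"
      "(\<Sum>t\<in>K. Poly_Mapping.single t (Poly_Mapping.lookup p t)) = q + r" by auto
    let ?s = "Poly_Mapping.single t (Poly_Mapping.lookup p t)"
    show ?case
    proof (cases "Poly_Mapping.keys t \<subseteq> ?F")
      case True
      then have "?s + q \<in> monom_span {t. Poly_Mapping.keys t \<subseteq> ?F}"
        using qr(1) by (intro monom_span_add single_mem_monom_span) auto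
      moreover have "(\<Sum>t\<in>insert t K. Poly_Mapping.single t (Poly_Mapping.lookup p t)) = (?s + q) + r"
        using insert qr(3) by (simp add: algebra_simps)
      ultimately show ?thesis using qr(2) by blast
    next
      case False
      then obtain j where j: "j \<in> T" "j \<in> Poly_Mapping.keys t" using insert by auto
      then obtain s where s: "t = ind_exp {j} + s" "Poly_Mapping.keys s \<subseteq> {1..n}"
        using ind_exp_decomp[of "{j}" t] insert by (metis empty_subsetI finite.simps insert_subset subset_trans mem_Collect_eq)
      have "Poly_Mapping.single s (Poly_Mapping.lookup p t) * var j \<in> P"
        using T[OF j(1)] s(2) by (intro subidealD(4)[OF sub(1)]) (simp_all add: carrier_poly_ring monom_span_def)
      moreover have "?s = Poly_Mapping.single s (Poly_Mapping.lookup p t) * var j"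
        by (simp add: var_def mult_single s(1) ind_exp_def add.commute)
      ultimately have "?s + r \<in> P" using qr(2) subidealD(2)[OF sub(1)] by simp
      moreover have "(\<Sum>t\<in>insert t K. Poly_Mapping.single t (Poly_Mapping.lookup p t)) = q + (?s + r)"
        using insert qr(3) by (simp add: algebra_simps)
      ultimately show ?thesis using qr(1) by blast
    qed
  qed (use monom_span_0 subidealD(1)[OF sub(1)] in force)+
  from this[of "Poly_Mapping.keys p"] p obtain q r where
    "q \<in> monom_span {t. Poly_Mapping.keys t \<subseteq> ?F}" "r \<in> P" "p = q + r"
    unfolding sum_singles carrier_poly_ring by (auto simp: monom_span_def)
  then show thesis using that[of q] by simp
qed

text \<open>A longer chain would give f + 1 elements of K[F], f = |F|, that are algebraically
  independent modulo \<open>P 0\<close>. Their power products with exponents up to N number (N +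
  1)^(f + 1), whereas the monomials occurring in them grow only like N^f.\<close>

lemma prime_chain_length_bound:
  assumes chain: "prime_chain_over (poly_ring n :: 'k::field mpoly ring) J r P"
    and T: "T \<subseteq> {1..n}" "\<And>t. t \<in> T \<Longrightarrow> var t \<in> P 0"
  shows "r \<le> card ({1..n} - T)"
proof (rule ccontr)
  let ?F = "{1..n} - T"
  let ?R = "poly_ring n :: 'k mpoly ring"
  define f where "f = card ?F"
  assume "\<not> r \<le> card ?F"
  then have fr: "Suc f \<le> r" by (simp add: f_def)
  have pr: "primeideal (P i) ?R" if "i \<le> r" for i using chain that by (simp add: prime_chain_over_def)
  note idl = primeideal.axioms(1)[OF pr]
  have lt: "P i \<subset> P (Suc i)" if "i < r" for i using chain that by (simp add: prime_chain_over_def)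
  have P0: "P 0 \<subseteq> P i" if "i \<le> r" for i
    using that
  proof (induction i)
    case (Suc i)
    then show ?case using lt[of i] by auto
  qed simp
  \<comment> \<open>A witness of strictness may be replaced by its part in K[F], since the
    difference lies in \<open>P 0\<close> and hence in every prime of the chain.\<close>
  have "\<exists>x. x \<in> monom_span {t. Poly_Mapping.keys t \<subseteq> ?F} \<and> x \<in> P (Suc i) - P i" if i: "i < r" for i
  proof -
    obtain y where y: "y \<in> P (Suc i)" "y \<notin> P i" using lt[OF i] by blast
    have i': "i \<le> r" "Suc i \<le> r" using i by auto
    note si = poly_ring_idealD[OF idl[OF i'(1)]] and sS = poly_ring_idealD[OF idl[OF i'(2)]]
    obtain x where x: "x \<in> monom_span {t. Poly_Mapping.keys t \<subseteq> ?F}" "y - x \<in> P 0"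
      using mod_vars_restrict[OF idl[of 0] T(2) T(1)] y(1) sS(2) by blast
    have "y - (y - x) \<in> P (Suc i)" using subidealD(5)[OF sS(1) y(1)] x(2) P0[OF i'(2)] by blast
    moreover have "x \<notin> P i"
    proof
      assume "x \<in> P i"
      then have "(y - x) + x \<in> P i" using subidealD(2)[OF si(1)] x(2) P0[OF i'(1)] by blast
      then show False using y by simp
    qed
    ultimately show ?thesis using x(1) by auto
  qed
  then obtain X where X: "\<And>i. i < r \<Longrightarrow> X i \<in> monom_span {t. Poly_Mapping.keys t \<subseteq> ?F}"
    "\<And>i. i < r \<Longrightarrow> X i \<in> P (Suc i) - P i" by metis
  define xs where "xs = map X [0..<Suc f]"
  have len: "length xs = Suc f" by (simp add: xs_def)
  have "set xs \<subseteq> monom_span {t. Poly_Mapping.keys t \<subseteq> ?F}" using X(1) fr by (auto simp: xs_def)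
  then obtain D where D: "set xs \<subseteq> monom_span (exp_box ?F D)" using exists_exp_box[of "set xs"] by blast
  \<comment> \<open>With K = 1 + (f + 1) D one has 1 + (f + 1) N D \<le> (N + 1) K, so the box holds
    at most (N + 1)^f K^f exponents. Taking N = K^f makes this (N + 1)^f N, which is less than (N +
    1)^(f + 1).\<close>
  define K where "K = Suc (Suc f * D)"
  define N where "N = K ^ f"
  let ?B = "exp_box ?F (Suc f * (N * D))"
  have finB: "finite ?B" and "card ?B \<le> Suc (Suc f * (N * D)) ^ f"
    using exp_box_card[of ?F] by (auto simp: f_def)
  note this(2)
  also have "Suc (Suc f * (N * D)) ^ f \<le> (Suc N * K) ^ f"
    by (rule power_mono) (auto simp: K_def algebra_simps)
  also have "\<dots> = Suc N ^ f * N" by (simp only: power_mult_distrib N_def)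
  also have "\<dots> < Suc N ^ Suc f" by simp
  also have "\<dots> = card (exps_upto (length xs) N)"
    by (simp add: card_lists_length_eq len)
  finally have card: "card ?B < card (exps_upto (length xs) N)" .
  have "finite (exps_upto (length xs) N)" by (rule finite_lists_length_eq) simp
  then obtain c e where ce: "e \<in> exps_upto (length xs) N" "c e \<noteq> 0"
    "(\<Sum>e\<in>exps_upto (length xs) N. const_poly (c e) * power_product xs e) = 0"
    using exp_box_power_product[OF D] len
    by (rule_tac linear_dependence[OF _ finB _ card, of "power_product xs"]) auto
  have "set xs \<subseteq> carrier ?R"
  proof -
    have "exp_box ?F D \<subseteq> exp_vectors n" by (auto simp: exp_box_def)
    then show ?thesis using D unfolding carrier_poly_ring using monom_span_mono by blast
  qed
  moreover have "P i \<subseteq> P (Suc i) \<and> xs ! i \<in> P (Suc i) - P i" if "i < length xs" for i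
    using that len fr lt[of i] X(2)[of i] by (auto simp: xs_def simp del: upt_Suc)
  moreover have "primeideal (P i) ?R" if "i \<le> length xs" for i
    using that len fr by (intro pr) simp
  ultimately have "(\<Sum>e\<in>exps_upto (length xs) N. const_poly (c e) * power_product xs e) \<notin> P 0"
    using ce by (intro prime_chain_independent) auto
  with ce(3) show False using subidealD(1)[OF poly_ring_idealD(1)[OF idl[of 0]]] by simp
qed

section \<open>Greedy transversals of windows\<close>

text \<open>
  Greedy transversal of the windows \<open>{a..<a+m}\<close> avoiding \<open>G\<close>: hit the first window as far to
  the right as possible and discard the windows already hit.
\<close>
function picks :: "nat \<Rightarrow> nat set \<Rightarrow> nat list \<Rightarrow> nat list" where
  "picks m G [] = []"
| "picks m G (a # as) =
     (let t = Max ({a..<a + m} - G) in t # picks m G (filter (\<lambda>b. t < b) as))"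
  by pat_completeness auto
termination
  by (relation "measure (\<lambda>(m, G, as). length as)") (auto simp: le_imp_less_Suc)

text \<open>For G the support of a monomial, this says that the monomial lies in the edge ideal.
  When it fails, every \<open>Max\<close> met in \<open>picks\<close> is taken over a nonempty
  set.\<close>

definition covers_window :: "nat \<Rightarrow> nat list \<Rightarrow> nat set \<Rightarrow> bool" where
  "covers_window m as G \<longleftrightarrow> (\<exists>a\<in>set as. {a..<a + m} \<subseteq> G)"

lemma Max_window:
  fixes a m :: nat
  assumes "\<not> {a..<a + m} \<subseteq> G"
  shows "Max ({a..<a + m} - G) \<in> {a..<a + m} - G"
    "x \<in> {a..<a + m} \<Longrightarrow> Max ({a..<a + m} - G) < x \<Longrightarrow> x \<in> G"
proof -
  have "{a..<a + m} - G \<noteq> {}" using assms by blast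
  then show "Max ({a..<a + m} - G) \<in> {a..<a + m} - G" by (intro Max_in finite_Diff finite_atLeastLessThan)
  show "x \<in> {a..<a + m} \<Longrightarrow> Max ({a..<a + m} - G) < x \<Longrightarrow> x \<in> G"
    using Max_ge[of "{a..<a + m} - G" x] by fastforce
qed

lemma covers_window_filter: "\<not> covers_window m (a # as) G \<Longrightarrow> \<not> covers_window m (filter Q as) G"
  by (auto simp: covers_window_def)

text \<open>Windows of equal length sorted by their starts are also sorted by their ends. A later
  window starting no later than the pick t therefore contains t, and exactly the windows starting
  after t remain to be hit.\<close>

lemma picks_props:
  assumes "\<not> covers_window m as G" "sorted as"
  shows "set (picks m G as) \<inter> G = {}"
    and "set (picks m G as) \<subseteq> (\<Union>a\<in>set as. {a..<a + m})"
    and "sorted_wrt (<) (picks m G as)"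
    and "\<forall>a\<in>set as. set (picks m G as) \<inter> {a..<a + m} \<noteq> {}"
proof -
  have "set (picks m G as) \<inter> G = {} \<and> set (picks m G as) \<subseteq> (\<Union>a\<in>set as. {a..<a + m}) \<and>
    sorted_wrt (<) (picks m G as) \<and> (\<forall>a\<in>set as. set (picks m G as) \<inter> {a..<a + m} \<noteq> {})"
    using assms
  proof (induction m G as rule: picks.induct)
    case (2 m G a as)
    define t where "t = Max ({a..<a + m} - G)"
    let ?as = "filter (\<lambda>b. t < b) as"
    define p where "p = picks m G ?as"
    have eq: "picks m G (a # as) = t # p" by (simp only: picks.simps Let_def t_def p_def)
    have t: "t \<in> {a..<a + m} - G" using "2.prems" unfolding t_def by (intro Max_window(1)) (auto simp: covers_window_def)
    have nc: "\<not> covers_window m ?as G" using "2.prems" covers_window_filter by blast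
    have sf: "sorted ?as" using "2.prems"(2) by (simp add: sorted_wrt_filter)
    have IH: "set p \<inter> G = {}" "set p \<subseteq> (\<Union>a\<in>set ?as. {a..<a + m})" "sorted_wrt (<) p"
      "\<forall>a\<in>set ?as. set p \<inter> {a..<a + m} \<noteq> {}"
      using "2.IH"[folded t_def, OF refl nc sf, folded p_def] by blast+
    have "\<forall>s\<in>set p. t < s" using IH(2) by fastforce
    moreover have "set (t # p) \<inter> {b..<b + m} \<noteq> {}" if b: "b \<in> set (a # as)" for b
    proof (cases "b \<in> set ?as")
      case True
      then show ?thesis using IH(4) by auto
    next
      case False
      then have "b \<le> t" "a \<le> b" using b t "2.prems" by auto
      then have "t \<in> {b..<b + m}" using t by auto
      then show ?thesis by auto
    qed
    moreover have "t \<notin> G" "t \<in> {a..<a + m}" using t by blast+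
    moreover have "set p \<subseteq> (\<Union>a\<in>set (a # as). {a..<a + m})" using IH(2) by auto
    ultimately have "set (t # p) \<inter> G = {} \<and> set (t # p) \<subseteq> (\<Union>a\<in>set (a # as). {a..<a + m}) \<and>
      sorted_wrt (<) (t # p) \<and> (\<forall>b\<in>set (a # as). set (t # p) \<inter> {b..<b + m} \<noteq> {})"
      using IH(1,3) by (intro conjI ballI) simp_all
    then show ?case unfolding eq .
  qed simp
  then show "set (picks m G as) \<inter> G = {}"
    and "set (picks m G as) \<subseteq> (\<Union>a\<in>set as. {a..<a + m})"
    and "sorted_wrt (<) (picks m G as)"
    and "\<forall>a\<in>set as. set (picks m G as) \<inter> {a..<a + m} \<noteq> {}" by blast+
qed

text \<open>The least set contained in every \<open>G'\<close> with the same picks as \<open>G\<close>.\<close>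
function skipped :: "nat \<Rightarrow> nat set \<Rightarrow> nat list \<Rightarrow> nat set" where
  "skipped m G [] = {}"
| "skipped m G (a # as) =
     (let t = Max ({a..<a + m} - G) in {Suc t..<a + m} \<union> skipped m G (filter (\<lambda>b. t < b) as))"
  by pat_completeness auto
termination
  by (relation "measure (\<lambda>(m, G, as). length as)") (auto simp: le_imp_less_Suc)

lemma skipped_subset:
  "\<not> covers_window m as G \<Longrightarrow> skipped m G as \<subseteq> G"
proof (induction m G as rule: skipped.induct)
  case (2 m G a as)
  have "x \<in> G" if "x \<in> {Suc (Max ({a..<a + m} - G))..<a + m}" for x
  proof (rule Max_window(2)[of a m])
    have w: "\<not> {a..<a + m} \<subseteq> G" using "2.prems" by (auto simp: covers_window_def)
    then show "\<not> {a..<a + m} \<subseteq> G" .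
    show "x \<in> {a..<a + m}" "Max ({a..<a + m} - G) < x" using that Max_window(1)[OF w] by auto
  qed
  moreover have nc: "\<not> covers_window m (filter (\<lambda>b. Max ({a..<a + m} - G) < b) as) G"
    using "2.prems" covers_window_filter by blast
  have "skipped m G (filter (\<lambda>b. Max ({a..<a + m} - G) < b) as) \<subseteq> G"
    by (rule "2.IH"[OF refl nc])
  ultimately show ?case unfolding skipped.simps Let_def by blast
qed simp

text \<open>The recursion consults G only through the picks t.\<close>

lemma skipped_eq_of_picks_eq:
  "picks m G as = picks m G' as \<Longrightarrow> skipped m G as = skipped m G' as"
proof (induction m G as arbitrary: G' rule: skipped.induct)
  case (2 m G a as)
  let ?t = "Max ({a..<a + m} - G)"
  have t: "Max ({a..<a + m} - G') = ?t"
    and "picks m G (filter (\<lambda>b. ?t < b) as) = picks m G' (filter (\<lambda>b. ?t < b) as)"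
    using "2.prems" unfolding picks.simps Let_def list.inject by metis+
  from "2.IH"[OF refl this(2)] show ?case unfolding skipped.simps Let_def t by simp
qed simp

text \<open>Each maximum is pinned from both sides: the pick is not in G', and everything to its
  right in the window was skipped, hence is in G'. Together with \<open>skipped_subset\<close> this
  makes the sets with given picks an interval.\<close>

lemma picks_eqI:
  assumes "\<not> covers_window m as G" "skipped m G as \<subseteq> G'" "set (picks m G as) \<inter> G' = {}"
  shows "picks m G' as = picks m G as"
  using assms
proof (induction m G as rule: picks.induct)
  case (2 m G a as)
  let ?t = "Max ({a..<a + m} - G)"
  have t: "?t \<in> {a..<a + m} - G" using "2.prems" by (intro Max_window(1)) (auto simp: covers_window_def)
  have "Max ({a..<a + m} - G') = ?t"
  proof (rule Max_eqI)
    show "?t \<in> {a..<a + m} - G'" using "2.prems"(3) t unfolding picks.simps Let_def by auto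
    fix y assume y: "y \<in> {a..<a + m} - G'"
    show "y \<le> ?t"
    proof (rule ccontr)
      assume "\<not> y \<le> ?t"
      then have "y \<in> skipped m G (a # as)" using y unfolding skipped.simps Let_def by auto
      then show False using "2.prems" y by blast
    qed
  qed simp
  moreover have "picks m G' (filter (\<lambda>b. ?t < b) as) = picks m G (filter (\<lambda>b. ?t < b) as)"
  proof (rule "2.IH"[OF refl])
    show "\<not> covers_window m (filter (\<lambda>b. ?t < b) as) G" using "2.prems" covers_window_filter by blast
    show "skipped m G (filter (\<lambda>b. ?t < b) as) \<subseteq> G'"
      using "2.prems"(2) unfolding skipped.simps Let_def by blast
    show "set (picks m G (filter (\<lambda>b. ?t < b) as)) \<inter> G' = {}"
      using "2.prems"(3) unfolding picks.simps Let_def by auto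
  qed
  ultimately show ?case unfolding picks.simps Let_def by metis
qed simp

text \<open>Two window lists are needed for the induction: the first pick for G' is at or to the
  left of the one for G, so the windows then left for G' include those left for G, but may be
  more.\<close>

lemma picks_mono:
  assumes "\<not> covers_window m as' G'" "G \<subseteq> G'" "set as \<subseteq> set as'" "sorted as" "sorted as'"
  shows "length (picks m G as) \<le> length (picks m G' as') \<and>
    (\<forall>i<length (picks m G as). picks m G' as' ! i \<le> picks m G as ! i)"
  using assms
proof (induction m G as arbitrary: as' rule: picks.induct)
  case (2 m G a as)
  from "2.prems" obtain b bs where as': "as' = b # bs" by (cases as') auto
  let ?t = "Max ({a..<a + m} - G)" let ?s = "Max ({b..<b + m} - G')"
  have wa: "\<not> {a..<a + m} \<subseteq> G" using "2.prems" by (force simp: covers_window_def)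
  have wb: "\<not> {b..<b + m} \<subseteq> G'" using "2.prems" as' by (auto simp: covers_window_def)
  have t: "?t \<in> {a..<a + m} - G" by (rule Max_window(1)[OF wa])
  have s: "?s \<in> {b..<b + m} - G'" by (rule Max_window(1)[OF wb])
  have ba: "b \<le> a" using "2.prems" as' by auto
  \<comment> \<open>Either \<open>?s\<close> lies before the window at a, hence before
    \<open>?t\<close>, or it lies in that window and outside G, where \<open>?t\<close> is the
    largest such vertex.\<close>
  have st: "?s \<le> ?t"
  proof (cases "?s < a")
    case False
    then have "?s \<in> {a..<a + m} - G" using s ba "2.prems" by auto
    then show ?thesis by (intro Max_ge) auto
  qed (use t in auto)
  have sub: "set (filter (\<lambda>x. ?t < x) as) \<subseteq> set (filter (\<lambda>x. ?s < x) bs)"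
  proof
    fix x assume "x \<in> set (filter (\<lambda>x. ?t < x) as)"
    then have x: "x \<in> set as" "?t < x" by auto
    moreover have "x \<noteq> b" using x t ba by auto
    ultimately show "x \<in> set (filter (\<lambda>x. ?s < x) bs)" using "2.prems" as' st by auto
  qed
  have IH: "length (picks m G (filter (\<lambda>x. ?t < x) as)) \<le> length (picks m G' (filter (\<lambda>x. ?s < x) bs)) \<and>
    (\<forall>i<length (picks m G (filter (\<lambda>x. ?t < x) as)).
       picks m G' (filter (\<lambda>x. ?s < x) bs) ! i \<le> picks m G (filter (\<lambda>x. ?t < x) as) ! i)"
  proof (rule "2.IH"[OF refl])
    show "\<not> covers_window m (filter (\<lambda>x. ?s < x) bs) G'"
      using "2.prems" as' covers_window_filter by blast
  qed (use "2.prems" as' sub in \<open>auto simp: sorted_wrt_filter\<close>)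
  show ?case unfolding as' picks.simps Let_def
    using IH st by (auto simp: nth_Cons split: nat.splits)
qed simp

section \<open>The strata of the dimension filtration\<close>

lemma monom_deg_add: "monom_deg (s + t) = monom_deg s + monom_deg t"
proof -
  have *: "monom_deg u = (\<Sum>j\<in>Poly_Mapping.keys s \<union> Poly_Mapping.keys t. Poly_Mapping.lookup u j)"
    if "Poly_Mapping.keys u \<subseteq> Poly_Mapping.keys s \<union> Poly_Mapping.keys t" for u
    unfolding monom_deg_def using that by (intro sum.mono_neutral_left) (auto simp: in_keys_iff)
  show ?thesis
    using *[of "s + t"] *[of s] *[of t] by (simp add: keys_add_nat lookup_add sum.distrib)
qed

lemma monom_deg_ind_exp: "finite S \<Longrightarrow> monom_deg (ind_exp S) = card S"
  by (simp add: monom_deg_def keys_ind_exp lookup_ind_exp)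

locale window_family =
  fixes n m :: nat and as :: "nat list"
  assumes sorted: "sorted as" and windows: "\<And>a. a \<in> set as \<Longrightarrow> {a..<a + m} \<subseteq> {1..n}"
begin

abbreviation nonface :: "(nat \<Rightarrow>\<^sub>0 nat) \<Rightarrow> bool" where
  "nonface t \<equiv> covers_window m as (Poly_Mapping.keys t)"

abbreviation transversal :: "(nat \<Rightarrow>\<^sub>0 nat) \<Rightarrow> nat list" where
  "transversal t \<equiv> picks m (Poly_Mapping.keys t) as"

lemma transversal:
  assumes "\<not> nonface t"
  shows "set (transversal t) \<inter> Poly_Mapping.keys t = {}"
    and "set (transversal t) \<subseteq> {1..n}"
    and "sorted_wrt (<) (transversal t)" "distinct (transversal t)"
    and "\<forall>a\<in>set as. set (transversal t) \<inter> {a..<a + m} \<noteq> {}"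
proof -
  note p = picks_props[OF assms sorted]
  show "set (transversal t) \<inter> Poly_Mapping.keys t = {}" by (rule p(1))
  show "set (transversal t) \<subseteq> {1..n}" using p(2) windows by blast
  show "sorted_wrt (<) (transversal t)" by (rule p(3))
  then show "distinct (transversal t)" by (simp add: strict_sorted_iff)
  show "\<forall>a\<in>set as. set (transversal t) \<inter> {a..<a + m} \<noteq> {}" by (rule p(4))
qed

lemma card_transversal: "\<not> nonface t \<Longrightarrow> card (set (transversal t)) = length (transversal t)"
  using transversal(4) distinct_card by blast

lemma length_transversal_le: "\<not> nonface t \<Longrightarrow> length (transversal t) \<le> n"
  using card_mono[OF _ transversal(2)[of t]] by (simp add: card_transversal)

lemma nonface_add: "nonface t \<Longrightarrow> nonface (s + t)"
  by (auto simp: covers_window_def keys_add_nat)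

lemma transversal_add:
  assumes "\<not> nonface (s + t)"
  shows "length (transversal t) \<le> length (transversal (s + t))"
    and "\<And>i. i < length (transversal t) \<Longrightarrow> transversal (s + t) ! i \<le> transversal t ! i"
proof -
  have "length (transversal t) \<le> length (transversal (s + t)) \<and>
    (\<forall>i<length (transversal t). transversal (s + t) ! i \<le> transversal t ! i)"
    by (rule picks_mono[OF assms _ order_refl sorted sorted]) (simp add: keys_add_nat)
  then show "length (transversal t) \<le> length (transversal (s + t))"
    and "\<And>i. i < length (transversal t) \<Longrightarrow> transversal (s + t) ! i \<le> transversal t ! i" by blast+
qed

text \<open>A single integer that determines the transversal and cannot grow when its elements move
  left at constant size; it linearizes the order of the shelling.\<close>

definition code :: "(nat \<Rightarrow>\<^sub>0 nat) \<Rightarrow> nat" where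
  "code t = set_encode (set (transversal t))"

lemma code_eq_sum:
  assumes "\<not> nonface t"
  shows "code t = (\<Sum>i<length (transversal t). 2 ^ (transversal t ! i))"
proof -
  have "code t = sum_list (map ((^) 2) (transversal t))"
    unfolding code_def set_encode_def using transversal(4)[OF assms]
    by (simp add: sum_list_distinct_conv_sum_set)
  also have "\<dots> = (\<Sum>i<length (transversal t). 2 ^ (transversal t ! i))"
    by (simp add: sum_list_sum_nth atLeast0LessThan)
  finally show ?thesis .
qed

lemma code_bound:
  assumes "\<not> nonface t"
  shows "code t < 2 ^ Suc n"
proof -
  have "code t \<le> set_encode {..n}"
    unfolding code_def set_encode_def using transversal(2)[OF assms]
    by (intro sum_mono2) auto
  also have "\<dots> < 2 ^ Suc n"
    by (simp only: set_encode_def lessThan_Suc_atMost[symmetric] atLeast0LessThan[symmetric] sum_power2) simp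
  finally show ?thesis .
qed

lemma code_eq_imp:
  assumes "\<not> nonface s" "\<not> nonface t" "code s = code t"
  shows "transversal s = transversal t"
proof -
  have "set (transversal s) = set (transversal t)"
    using assms(3) unfolding code_def by (simp add: set_encode_eq)
  then show ?thesis
    using transversal(3)[OF assms(1)] transversal(3)[OF assms(2)] by (simp add: strict_sorted_equal)
qed

definition stratum :: "nat \<Rightarrow> (nat \<Rightarrow>\<^sub>0 nat) set" where
  "stratum c = {t \<in> exp_vectors n. \<not> nonface t \<and> length (transversal t) = c}"

text \<open>
  The monomials with a given greedy transversal \<open>T\<close> are those whose support lies between the
  skipped vertices and the facet complementary to \<open>T\<close>; ordering them by \<open>code\<close> is a shelling.
\<close>
lemma weakly_regular_stratum:
  assumes S: "upset n S" and S': "upset n S'" and sub: "S' \<subseteq> S" and diff: "S - S' = stratum c"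
  shows "weakly_regular (esyms n (n - c)) (monom_span S) (monom_span S' :: 'k::field mpoly set)"
proof -
  let ?R = "carrier (poly_ring n) :: 'k mpoly set"
  let ?e = "esyms n (n - c) :: 'k mpoly list"
  have eR: "set ?e \<subseteq> ?R" by (auto simp: set_esyms esym_carrier)
  define U where "U j = S' \<union> {t \<in> stratum c. code t < j}" for j
  have USub: "U j \<subseteq> S" for j using sub diff by (auto simp: U_def)
  have upU: "upset n (U j)" for j
    unfolding upset_def
  proof (intro conjI ballI)
    show "U j \<subseteq> exp_vectors n" using USub[of j] S by (auto simp: upset_def)
    fix s t assume s: "s \<in> exp_vectors n" and t: "t \<in> U j"
    show "s + t \<in> U j"
    proof (cases "s + t \<in> S'")
      case False
      then have t': "t \<in> stratum c" "code t < j" using t s S' by (auto simp: U_def upset_def)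
      have "s + t \<in> S" using S s t USub[of j] by (auto simp: upset_def)
      then have st: "s + t \<in> stratum c" using False diff by blast
      then have nf: "\<not> nonface (s + t)" "\<not> nonface t" using t' by (auto simp: stratum_def)
      have len: "length (transversal (s + t)) = length (transversal t)"
        using st t' by (simp add: stratum_def)
      \<comment> \<open>Within a stratum the size is fixed, so the elements can only move left and
        the powers of 2 decrease term by term.\<close>
      have "code (s + t) \<le> code t"
        unfolding code_eq_sum[OF nf(1)] code_eq_sum[OF nf(2)] len
        using transversal_add(2)[OF nf(1)] by (intro sum_mono power_increasing) auto
      then show ?thesis using t' st by (auto simp: U_def)
    qed (simp add: U_def)
  qed
  have "weakly_regular ?e (monom_span (U j)) (monom_span S')" for j
  proof (induction j)
    case 0
    have "U 0 = S'" by (simp add: U_def)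
    then show ?case using weakly_regular_refl[OF subideal_monom_span[OF S'] eR] by simp
  next
    case (Suc j)
    have mono: "U j \<subseteq> U (Suc j)" by (auto simp: U_def)
    have step: "U (Suc j) - U j = {t \<in> stratum c. code t = j}"
    proof -
      have "t \<notin> S'" if "t \<in> stratum c" for t using that diff by blast
      then show ?thesis by (auto simp: U_def)
    qed
    have "weakly_regular ?e (monom_span (U (Suc j))) (monom_span (U j))"
    proof (cases "\<exists>t. t \<in> stratum c \<and> code t = j")
      case False
      then have "U (Suc j) = U j" using step mono by blast
      then show ?thesis using weakly_regular_refl[OF subideal_monom_span[OF upU] eR] by simp
    next
      case True
      then obtain t0 where t0: "t0 \<in> stratum c" "code t0 = j" by blast
      then have nf: "\<not> nonface t0" and c: "length (transversal t0) = c" by (auto simp: stratum_def)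
      let ?T = "set (transversal t0)" let ?F = "{1..n} - ?T"
      let ?r = "skipped m (Poly_Mapping.keys t0) as"
      have cls: "{t \<in> stratum c. code t = j} =
        {t \<in> exp_vectors n. ?r \<subseteq> Poly_Mapping.keys t \<and> Poly_Mapping.keys t \<subseteq> ?F}"
      proof (rule Set.set_eqI, rule iffI)
        fix t assume "t \<in> {t \<in> stratum c. code t = j}"
        then have t: "t \<in> exp_vectors n" "\<not> nonface t" "code t = code t0"
          using t0 by (auto simp: stratum_def)
        have eq: "transversal t = transversal t0" by (rule code_eq_imp[OF t(2) nf t(3)])
        have "?r \<subseteq> Poly_Mapping.keys t"
          using skipped_subset[OF t(2)] skipped_eq_of_picks_eq[OF eq] by simp
        then show "t \<in> {t \<in> exp_vectors n. ?r \<subseteq> Poly_Mapping.keys t \<and> Poly_Mapping.keys t \<subseteq> ?F}"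
          using transversal(1)[OF t(2)] eq t(1) by auto
      next
        fix t assume "t \<in> {t \<in> exp_vectors n. ?r \<subseteq> Poly_Mapping.keys t \<and> Poly_Mapping.keys t \<subseteq> ?F}"
        then have t: "t \<in> exp_vectors n" "?r \<subseteq> Poly_Mapping.keys t" "?T \<inter> Poly_Mapping.keys t = {}" by auto
        have eq: "transversal t = transversal t0" by (rule picks_eqI[OF nf t(2,3)])
        \<comment> \<open>A window inside the support of t would contain an element of T, which that
          support avoids.\<close>
        have "\<not> nonface t" using transversal(5)[OF nf] t(3) unfolding covers_window_def by blast
        then show "t \<in> {t \<in> stratum c. code t = j}"
          using t(1) eq c t0(2) by (simp add: stratum_def code_def)
      qed
      have "card ?T = c" using card_transversal[OF nf] c by simp
      then have cardF: "card ?F = n - c"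
        using transversal(2)[OF nf] by (simp add: card_Diff_subset)
      have "?r \<subseteq> Poly_Mapping.keys t0" by (rule skipped_subset[OF nf])
      then have rF: "?r \<subseteq> ?F" using t0(1) transversal(1)[OF nf] by (auto simp: stratum_def)
      show ?thesis
        by (rule weakly_regular_interval[OF upU upU mono step[unfolded cls] rF Diff_subset
              weakly_regular_esyms[OF Diff_subset cardF] eR])
    qed
    then show ?case
    proof (rule weakly_regular_extension[where C = ?R])
      show "monom_span S' \<subseteq> (monom_span (U j) :: 'k mpoly set)"
        by (rule monom_span_mono) (simp add: U_def)
    qed (rule Suc.IH subideal_monom_span upU S' eR monom_span_mono mono)+
  qed
  \<comment> \<open>All codes lie below 2^(n + 1), so finitely many layers exhaust S.\<close>
  moreover have "U (2 ^ Suc n) = S"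
  proof
    show "S \<subseteq> U (2 ^ Suc n)"
    proof
      fix t assume "t \<in> S"
      then show "t \<in> U (2 ^ Suc n)"
        using diff code_bound[of t] unfolding U_def stratum_def by blast
    qed
  qed (rule USub)
  ultimately show ?thesis by metis
qed

text \<open>Graded Nakayama in monomial form: a monomial u of least degree in S - S' never occurs in
  a product of a member of \<open>monom_span S\<close> with some e_i, i \<ge> 1, since such a
  product raises the degree.\<close>

lemma adjoin_all_stratum:
  assumes S: "upset n S" and S': "upset n S'" and ne: "S - S' \<noteq> {}" and sub: "S' \<subseteq> S"
  shows "adjoin_all (esyms n d) (monom_span S) (monom_span S') \<noteq> (monom_span S :: 'k::field mpoly set)"
proof -
  obtain u0 where "u0 \<in> S - S'" using ne by blast
  then obtain u where u: "u \<in> S - S'" and least: "\<And>v. v \<in> S - S' \<Longrightarrow> monom_deg u \<le> monom_deg v"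
    using ex_has_least_nat[of "\<lambda>v. v \<in> S - S'" u0 monom_deg] by blast
  let ?N = "{p. Poly_Mapping.lookup p u = 0} :: 'k mpoly set"
  have "adjoin_all (esyms n d) (monom_span S) (monom_span S') \<subseteq> ?N"
  proof (rule adjoin_all_subset)
    show "monom_span S' \<subseteq> ?N" using u by (auto simp: monom_span_def in_keys_iff)
    show "x + y \<in> ?N" if "x \<in> ?N" "y \<in> ?N" for x y using that by (simp add: lookup_add)
    fix a y :: "'k mpoly" assume a: "a \<in> set (esyms n d)" and y: "y \<in> monom_span S"
    show "a * y \<in> ?N"
    proof (rule ccontr)
      assume "a * y \<notin> ?N"
      then have "u \<in> Poly_Mapping.keys (a * y)" by (simp add: in_keys_iff)
      then obtain s t where st: "u = s + t" "s \<in> Poly_Mapping.keys a" "t \<in> Poly_Mapping.keys y"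
        using keys_mult[of a y] by blast
      obtain i where i: "1 \<le> i" "a = esym n i" using a by (auto simp: set_esyms)
      obtain A where A: "A \<subseteq> {1..n}" "card A = i" "s = ind_exp A"
        using keys_esym[of s n i] st(2) i(2) by blast
      have fin: "finite A" using finite_subset[OF A(1)] by simp
      have "s \<in> exp_vectors n" using A by (simp add: keys_ind_exp[OF fin])
      then have "t \<notin> S'" using S' u st(1) by (auto simp: upset_def)
      moreover have "t \<in> S" using y st(3) by (auto simp: monom_span_def)
      ultimately have "monom_deg u \<le> monom_deg t" using least by blast
      then show False using A i by (simp add: st(1) monom_deg_add monom_deg_ind_exp[OF fin])
    qed
  qed
  moreover have "Poly_Mapping.single u 1 \<in> monom_span S" "Poly_Mapping.single u (1 :: 'k) \<notin> ?N"
    using u by (auto simp: single_mem_monom_span)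
  ultimately show ?thesis by blast
qed

section \<open>Primes over the annihilator of a stratum\<close>

lemma prod_var_notin_prime:
  assumes P: "primeideal P (poly_ring n :: 'k::field mpoly ring)" and "finite A"
    and "\<And>x. x \<in> A \<Longrightarrow> g x \<in> {1..n} \<and> var (g x) \<notin> P"
  shows "(\<Prod>x\<in>A. var (g x)) \<notin> P" "(\<Prod>x\<in>A. var (g x) :: 'k mpoly) \<in> carrier (poly_ring n)"
proof -
  have "(\<Prod>x\<in>A. var (g x)) \<notin> P \<and> (\<Prod>x\<in>A. var (g x) :: 'k mpoly) \<in> carrier (poly_ring n)"
    using assms(2,3)
  proof (induction A rule: finite_induct)
    case empty
    then show ?case using poly_ring_primeD(2)[OF P] by (simp add: one_carrier)
  next
    case (insert x A)
    have v: "var (g x) \<in> carrier (poly_ring n :: 'k mpoly ring)"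
      using insert.prems[of x] by (simp add: carrier_poly_ring monom_span_def var_def)
    have "(\<Prod>x\<in>A. var (g x)) \<notin> P \<and> (\<Prod>x\<in>A. var (g x) :: 'k mpoly) \<in> carrier (poly_ring n)"
      using insert.prems by (intro insert.IH) simp
    then show ?case
      using insert.prems[of x] insert.hyps poly_ring_primeD(1)[OF P v] mult_carrier[OF v] by auto
  qed
  then show "(\<Prod>x\<in>A. var (g x)) \<notin> P" "(\<Prod>x\<in>A. var (g x) :: 'k mpoly) \<in> carrier (poly_ring n)"
    by blast+
qed

text \<open>Otherwise pick from each transversal T of the stratum a variable outside P. Their
  product sends S into S', because a monomial left in the stratum would have a transversal disjoint
  from its own support; so the product lies in P, which is prime.\<close>

lemma prime_contains_vars:
  assumes S: "upset n S" and S': "upset n S'" and diff: "S - S' = stratum c"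
    and P: "primeideal P (poly_ring n :: 'k::field mpoly ring)"
    and ann: "\<And>u. u \<in> carrier (poly_ring n) \<Longrightarrow> (\<And>p. p \<in> monom_span S \<Longrightarrow> u * p \<in> monom_span S') \<Longrightarrow> u \<in> P"
  obtains T where "T \<subseteq> {1..n}" "card T = c" "\<And>t. t \<in> T \<Longrightarrow> var t \<in> P"
proof (rule ccontr)
  assume "\<not> thesis"
  with that have no: "\<exists>t\<in>T. var t \<notin> P" if "T \<subseteq> {1..n}" "card T = c" for T
    using that by blast
  let ?\<T> = "(\<lambda>t. set (transversal t)) ` stratum c"
  have \<T>: "T \<subseteq> {1..n}" "card T = c" if "T \<in> ?\<T>" for T
    using that transversal(2) card_transversal by (auto simp: stratum_def)
  have fin: "finite ?\<T>"
    by (rule finite_subset[of _ "Pow {1..n}"]) (use \<T>(1) in auto)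
  from no \<T> obtain g where g: "\<And>T. T \<in> ?\<T> \<Longrightarrow> g T \<in> T \<and> var (g T) \<notin> P" by metis
  let ?u = "\<Prod>T\<in>?\<T>. var (g T) :: 'k mpoly"
  have g': "g T \<in> {1..n} \<and> var (g T) \<notin> P" if "T \<in> ?\<T>" for T using g[OF that] \<T>(1)[OF that] by blast
  have u: "?u \<notin> P" "?u \<in> carrier (poly_ring n)"
    using prod_var_notin_prime[OF P fin, of g] g' by blast+
  \<comment> \<open>A sum of unit exponents rather than an indicator, since \<open>g\<close> may
    choose the same vertex for several transversals.\<close>
  define e where "e = (\<Sum>T\<in>?\<T>. Poly_Mapping.single (g T) (1 :: nat))"
  have u_eq: "?u = Poly_Mapping.single e 1"
    unfolding e_def using fin
    by (induction rule: finite_induct) (auto simp: var_def mult_single)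
  have ge: "g T \<in> Poly_Mapping.keys e" if "T \<in> ?\<T>" for T
  proof -
    have "e = Poly_Mapping.single (g T) 1 + (\<Sum>T\<in>?\<T> - {T}. Poly_Mapping.single (g T) (1 :: nat))"
      unfolding e_def by (rule sum.remove[OF fin that])
    then show ?thesis by (simp only: keys_add_nat) simp
  qed
  have eR: "e \<in> exp_vectors n" using u(2) unfolding u_eq by (simp add: carrier_poly_ring monom_span_def)
  have "?u * p \<in> monom_span S'" if p: "p \<in> monom_span S" for p
    unfolding u_eq single_mult_mem_monom_span_iff
  proof
    fix t assume "t \<in> Poly_Mapping.keys p"
    then have "t \<in> S" using p by (auto simp: monom_span_def)
    then have et: "e + t \<in> S" using S eR by (auto simp: upset_def)
    show "e + t \<in> S'"
    proof (rule ccontr)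
      assume "e + t \<notin> S'"
      then have st: "e + t \<in> stratum c" using et diff by blast
      let ?T = "set (transversal (e + t))"
      have "?T \<in> ?\<T>" using st by blast
      then have "g ?T \<in> ?T" "g ?T \<in> Poly_Mapping.keys (e + t)" using g ge by (auto simp: keys_add_nat)
      moreover have "?T \<inter> Poly_Mapping.keys (e + t) = {}"
        using transversal(1) st by (simp add: stratum_def)
      ultimately show False by blast
    qed
  qed
  then show False using ann[of ?u] u by blast
qed

end

section \<open>Presentations and gradings\<close>

lemma esym_irrelevant:
  assumes "1 \<le> i"
  shows "(esym n i :: 'k::field mpoly) \<in> irrelevant_ideal (poly_ring n) (poly_grading n)"
proof -
  have "(esym n i :: 'k mpoly) \<in> poly_grading n (int i)"
    unfolding poly_grading_def
  proof (intro CollectI conjI ballI)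
    fix t assume "t \<in> Poly_Mapping.keys (esym n i :: 'k mpoly)"
    then obtain S where S: "S \<subseteq> {1..n}" "card S = i" "t = ind_exp S" by (rule keys_esym)
    have fin: "finite S" using finite_subset[OF S(1)] by simp
    show "int (monom_deg t) = int i"
      using S by (simp add: monom_deg_def keys_ind_exp[OF fin] lookup_ind_exp[OF fin])
  qed (rule esym_carrier)
  then have "(esym n i :: 'k mpoly) \<in> (\<Union>d\<in>{0<..}. poly_grading n d)" using assms by force
  moreover have "(\<Union>d\<in>{0<..}. poly_grading n d :: 'k mpoly set) \<subseteq> carrier (poly_ring n)"
    by (auto simp: poly_grading_def)
  ultimately show ?thesis
    unfolding irrelevant_ideal_def using poly_ring.genideal_self by blast
qed

text \<open>An isomorphism from A / B to Q, given on representatives. It reduces claims about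
  iterated cosets to claims about sets of polynomials.\<close>

locale presentation =
  fixes n :: nat and Q :: "('k::field mpoly, 'b) module" and A B :: "'k mpoly set"
    and \<phi> :: "'k mpoly \<Rightarrow> 'b"
  assumes Q: "Module.module (poly_ring n) Q"
    and A: "subideal (carrier (poly_ring n)) A" and B: "subideal (carrier (poly_ring n)) B"
    and BA: "B \<subseteq> A"
    and surj: "\<phi> ` A = carrier Q"
    and add: "\<And>x y. x \<in> A \<Longrightarrow> y \<in> A \<Longrightarrow> \<phi> (x + y) = \<phi> x \<oplus>\<^bsub>Q\<^esub> \<phi> y"
    and smult: "\<And>c x. c \<in> carrier (poly_ring n) \<Longrightarrow> x \<in> A \<Longrightarrow> \<phi> (c * x) = c \<odot>\<^bsub>Q\<^esub> \<phi> x"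
    and ker: "\<And>x. x \<in> A \<Longrightarrow> \<phi> x = \<zero>\<^bsub>Q\<^esub> \<longleftrightarrow> x \<in> B"
begin

interpretation Q: Module.module "poly_ring n" Q by (rule Q)

lemma closed: "x \<in> A \<Longrightarrow> \<phi> x \<in> carrier Q"
  using surj by blast

lemma eq_iff:
  assumes "x \<in> A" "y \<in> A"
  shows "\<phi> x = \<phi> y \<longleftrightarrow> x - y \<in> B"
proof -
  have xy: "x - y \<in> A" using assms subidealD(5)[OF A] by blast
  have "\<phi> x = \<phi> (x - y) \<oplus>\<^bsub>Q\<^esub> \<phi> y" using add[OF xy assms(2)] by simp
  then have "\<phi> x = \<phi> y \<longleftrightarrow> \<phi> (x - y) = \<zero>\<^bsub>Q\<^esub>"
    using closed[OF xy] closed[OF assms(2)] Q.M.add.r_cancel_one'[of "\<phi> y" "\<phi> (x - y)"] by (metis Q.M.l_zero)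
  then show ?thesis using ker[OF xy] by simp
qed

lemma uminus: "x \<in> A \<Longrightarrow> \<phi> (- x) = \<ominus>\<^bsub>Q\<^esub> \<phi> x"
proof -
  assume x: "x \<in> A"
  then have x': "- x \<in> A" using subidealD(3)[OF A] by blast
  have "\<phi> (- x) \<oplus>\<^bsub>Q\<^esub> \<phi> x = \<zero>\<^bsub>Q\<^esub>"
    using add[OF x' x] ker[OF subidealD(1)[OF A]] subidealD(1)[OF B] by simp
  then show ?thesis using Q.M.minus_equality[OF _ closed[OF x] closed[OF x']] by simp
qed

lemma image_submodule:
  assumes D: "subideal (carrier (poly_ring n)) D" and "D \<subseteq> A"
  shows "submodule (\<phi> ` D) (poly_ring n) Q"
proof (rule Q.submoduleI)
  show "\<phi> ` D \<subseteq> carrier Q" using closed assms(2) by blast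
  show "\<zero>\<^bsub>Q\<^esub> \<in> \<phi> ` D"
    using ker[OF subidealD(1)[OF A]] subidealD(1)[OF B] subidealD(1)[OF D] by (metis imageI)
  fix a assume "a \<in> \<phi> ` D"
  then obtain x where x: "x \<in> D" "a = \<phi> x" by blast
  then show "\<ominus>\<^bsub>Q\<^esub> a \<in> \<phi> ` D"
    using uminus[of x] subidealD(3)[OF D x(1)] assms(2) by (metis imageI subsetD)
  show "a \<oplus>\<^bsub>Q\<^esub> b \<in> \<phi> ` D" if "b \<in> \<phi> ` D" for b
  proof -
    obtain y where y: "y \<in> D" "b = \<phi> y" using \<open>b \<in> \<phi> ` D\<close> by blast
    have "\<phi> (x + y) = a \<oplus>\<^bsub>Q\<^esub> b" using add[of x y] x y assms(2) by blast
    then show ?thesis using subidealD(2)[OF D x(1) y(1)] by (metis imageI)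
  qed
next
  fix c a assume c: "c \<in> carrier (poly_ring n :: 'k mpoly ring)" and "a \<in> \<phi> ` D"
  then obtain x where x: "x \<in> D" "a = \<phi> x" by blast
  have "\<phi> (c * x) = c \<odot>\<^bsub>Q\<^esub> a" using smult[OF c, of x] x assms(2) by blast
  then show "c \<odot>\<^bsub>Q\<^esub> a \<in> \<phi> ` D" using subidealD(4)[OF D c x(1)] by (metis imageI)
qed

text \<open>D contains the kernel B, so within A it is a union of fibres of \<phi>.\<close>

lemma image_mem_iff:
  assumes D: "subideal (carrier (poly_ring n)) D" "B \<subseteq> D" "D \<subseteq> A" and x: "x \<in> A"
  shows "\<phi> x \<in> \<phi> ` D \<longleftrightarrow> x \<in> D"
proof
  assume "\<phi> x \<in> \<phi> ` D"
  then obtain y where y: "y \<in> D" "\<phi> x = \<phi> y" by blast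
  then have "x - y \<in> D" using eq_iff[OF x] D by blast
  then show "x \<in> D" using subidealD(2)[OF D(1) _ y(1), of "x - y"] by simp
qed blast

text \<open>Both sides are least of their kind. The image of \<open>adjoin_all bs A B\<close> is a
  submodule containing all products, and the preimage of the submodule on the left is closed under
  addition and contains B and all multiples b y.\<close>

lemma ideal_smult_mem_iff:
  assumes bs: "set bs \<subseteq> carrier (poly_ring n)" and y: "y \<in> A"
  shows "\<phi> y \<in> ideal_smult (poly_ring n) (set bs) Q \<longleftrightarrow> y \<in> adjoin_all bs A B"
proof -
  let ?D = "adjoin_all bs A B" and ?N = "ideal_smult (poly_ring n) (set bs) Q"
  note A0 = subidealD(1)[OF A]
  have D: "subideal (carrier (poly_ring n)) ?D" by (rule subideal_adjoin_all[OF A B])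
  have BD: "B \<subseteq> ?D" by (rule subset_adjoin_all[OF A0])
  have DA: "?D \<subseteq> A"
    using bs subidealD(2,4)[OF A] BA by (intro adjoin_all_subset) auto
  note N = ideal_smult_submodule[OF Q bs]
  have "?N \<subseteq> \<phi> ` ?D"
  proof -
    have "a \<odot>\<^bsub>Q\<^esub> q \<in> \<phi> ` ?D" if a: "a \<in> set bs" and "q \<in> carrier Q" for a q
    proof -
      obtain x where x: "x \<in> A" "q = \<phi> x" using surj \<open>q \<in> carrier Q\<close> by blast
      have "a \<odot>\<^bsub>Q\<^esub> q = \<phi> (a * x)" using smult[of a x] bs a x by auto
      moreover have "a * x \<in> ?D" by (rule mult_mem_adjoin_all[OF A0 subidealD(1)[OF B] a x(1)])
      ultimately show ?thesis by blast
    qed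
    then show ?thesis unfolding ideal_smult_def using image_submodule[OF D DA] by blast
  qed
  moreover have "?D \<subseteq> {x \<in> A. \<phi> x \<in> ?N}"
  proof (rule adjoin_all_subset)
    show "B \<subseteq> {x \<in> A. \<phi> x \<in> ?N}"
    proof
      fix x assume "x \<in> B"
      then have "x \<in> A" "\<phi> x = \<zero>\<^bsub>Q\<^esub>" using BA ker by blast+
      then show "x \<in> {x \<in> A. \<phi> x \<in> ?N}"
        using subgroup.one_closed[OF submodule.axioms(1)[OF N]] by simp
    qed
    show "x + y \<in> {x \<in> A. \<phi> x \<in> ?N}" if "x \<in> {x \<in> A. \<phi> x \<in> ?N}" "y \<in> {x \<in> A. \<phi> x \<in> ?N}" for x y
      using that add[of x y] subidealD(2)[OF A, of x y] Q.submoduleE(5)[OF N] by auto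
    show "a * y \<in> {x \<in> A. \<phi> x \<in> ?N}" if "a \<in> set bs" "y \<in> A" for a y
      using that bs smult[of a y] subidealD(4)[OF A, of a y] ideal_smult_memI[of a "set bs" "\<phi> y" Q] closed[of y]
      by auto
  qed
  ultimately show ?thesis using image_mem_iff[OF D BD DA y] by blast
qed

text \<open>A squeeze: the length of \<open>as\<close> is at most the depth, the depth at most the
  dimension, and the bound on prime chains makes the dimension at most the length of
  \<open>as\<close>.\<close>

lemma cohen_macaulay_of_regular:
  assumes reg: "weakly_regular as A B"
    and as: "set as \<subseteq> irrelevant_ideal (poly_ring n) (poly_grading n)" "set as \<subseteq> carrier (poly_ring n)"
    and ne: "adjoin_all as A B \<noteq> A"
    and bound: "\<And>P r. prime_chain_over (poly_ring n) (annihilator (poly_ring n) Q) r P \<Longrightarrow> r \<le> length as"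
  shows "cohen_macaulay (poly_ring n) (poly_grading n) Q"
    and "module_dim (poly_ring n) Q = ereal (real (length as))"
proof -
  let ?R = "poly_ring n :: 'k mpoly ring" and ?J = "irrelevant_ideal (poly_ring n) (poly_grading n) :: 'k mpoly set"
  have tk: "set (take i as) \<subseteq> carrier ?R" for i using as(2) set_take_subset by fast
  have "regular_sequence ?R Q as"
    unfolding regular_sequence_def
  proof (intro conjI allI impI)
    show "set as \<subseteq> carrier ?R" by (rule as)
    fix i assume i: "i < length as"
    then have ai: "as ! i \<in> carrier ?R" using as(2) nth_mem by blast
    show "nonzerodivisor_on (as ! i) (quot_module Q (ideal_smult ?R (set (take i as)) Q))"
      unfolding nonzerodivisor_on_quot_module[OF Q ideal_smult_submodule[OF Q tk] ai]
    proof (intro ballI impI)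
      fix q assume "q \<in> carrier Q" and q: "as ! i \<odot>\<^bsub>Q\<^esub> q \<in> ideal_smult ?R (set (take i as)) Q"
      then obtain x where x: "x \<in> A" "q = \<phi> x" using surj by blast
      have "\<phi> (as ! i * x) \<in> ideal_smult ?R (set (take i as)) Q" using q smult[OF ai x(1)] x(2) by simp
      then have "as ! i * x \<in> adjoin_all (take i as) A B"
        using ideal_smult_mem_iff[OF tk subidealD(4)[OF A ai x(1)]] by blast
      then have "x \<in> adjoin_all (take i as) A B" by (rule weakly_regular_nth[OF reg i x(1)])
      then show "q \<in> ideal_smult ?R (set (take i as)) Q"
        using ideal_smult_mem_iff[OF tk x(1)] x(2) by blast
    qed
  next
    have "adjoin_all as A B \<subseteq> A"
      using as(2) subidealD(2,4)[OF A] BA by (intro adjoin_all_subset) auto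
    then obtain x where x: "x \<in> A" "x \<notin> adjoin_all as A B" using ne by blast
    then have "\<phi> x \<notin> ideal_smult ?R (set as) Q" using ideal_smult_mem_iff[OF as(2)] by blast
    then show "ideal_smult ?R (set as) Q \<noteq> carrier Q" using closed[OF x(1)] by blast
  qed
  then have "ereal (real (length as)) \<le> depth ?R ?J Q"
    unfolding depth_def using as(1) by (intro Sup_upper) blast
  moreover have "module_dim ?R Q \<le> ereal (real (length as))"
    unfolding module_dim_def krull_dim_quot[OF cring_poly_ring annihilator_ideal[OF Q]]
    by (rule Sup_least) (use bound in auto)
  moreover have "depth ?R ?J Q \<le> module_dim ?R Q" by (rule depth_le_module_dim[OF Q])
  ultimately show "cohen_macaulay ?R (poly_grading n) Q"
    and "module_dim ?R Q = ereal (real (length as))"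
    unfolding cohen_macaulay_def by (metis order.trans order.antisym)+
qed

end

section \<open>Homogeneous components and gradings of monomial subquotients\<close>

definition homog_comp :: "int \<Rightarrow> 'k::field mpoly \<Rightarrow> 'k mpoly" where
  "homog_comp d p = (\<Sum>t\<in>{t \<in> Poly_Mapping.keys p. int (monom_deg t) = d}.
     Poly_Mapping.single t (Poly_Mapping.lookup p t))"

lemma lookup_homog_comp:
  "Poly_Mapping.lookup (homog_comp d p) t = (if int (monom_deg t) = d then Poly_Mapping.lookup p t else 0)"
  by (simp add: homog_comp_def lookup_sum lookup_single when_def in_keys_iff sum.delta)

lemma homog_comp_mem: "p \<in> monom_span S \<Longrightarrow> homog_comp d p \<in> monom_span S"
  by (auto simp: monom_span_def in_keys_iff lookup_homog_comp split: if_splits)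

lemma homog_comp_diff: "homog_comp d (p - q) = homog_comp d p - homog_comp d q"
  by (rule poly_mapping_eqI) (simp add: lookup_homog_comp lookup_minus)

lemma homog_comp_sum: "homog_comp d (sum f A) = (\<Sum>a\<in>A. homog_comp d (f a))"
  by (rule poly_mapping_eqI) (simp add: lookup_homog_comp lookup_sum)

abbreviation homogeneous :: "int \<Rightarrow> 'k::field mpoly \<Rightarrow> bool" where
  "homogeneous d p \<equiv> \<forall>t\<in>Poly_Mapping.keys p. int (monom_deg t) = d"

lemma homogeneous_homog_comp: "homogeneous d (homog_comp d p)"
  by (auto simp: in_keys_iff lookup_homog_comp split: if_splits)

lemma homog_comp_homogeneous: "homogeneous e p \<Longrightarrow> homog_comp d p = (if d = e then p else 0)"
  by (rule poly_mapping_eqI) (auto simp: lookup_homog_comp in_keys_iff)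

lemma sum_homog_comp:
  "(\<Sum>d\<in>(\<lambda>t. int (monom_deg t)) ` Poly_Mapping.keys p. homog_comp d p) = p"
proof (rule poly_mapping_eqI)
  fix t
  show "Poly_Mapping.lookup (\<Sum>d\<in>(\<lambda>t. int (monom_deg t)) ` Poly_Mapping.keys p. homog_comp d p) t
    = Poly_Mapping.lookup p t"
    by (auto simp: lookup_sum lookup_homog_comp sum.delta in_keys_iff)
qed

lemma homogeneous_add: "homogeneous d p \<Longrightarrow> homogeneous d q \<Longrightarrow> homogeneous d (p + q)"
  using keys_add[of p q] by blast

lemma homogeneous_uminus: "homogeneous d p \<Longrightarrow> homogeneous d (- p)"
  by (simp add: in_keys_iff)

text \<open>Monomial spans contain the homogeneous components of their elements. For S this yields
  existence of a decomposition, for the kernel spanned by N its uniqueness.\<close>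

lemma graded_group_of_presentation:
  fixes M :: "('b, 'c) ring_scheme" and \<pi> :: "'k::field mpoly \<Rightarrow> 'b"
  assumes M: "abelian_group M"
    and surj: "\<pi> ` monom_span S = carrier M"
    and add: "\<And>x y. x \<in> monom_span S \<Longrightarrow> y \<in> monom_span S \<Longrightarrow> \<pi> (x + y) = \<pi> x \<oplus>\<^bsub>M\<^esub> \<pi> y"
    and ker: "\<And>x. x \<in> monom_span S \<Longrightarrow> \<pi> x = \<zero>\<^bsub>M\<^esub> \<longleftrightarrow> x \<in> monom_span N"
    and G: "\<And>d. G d = \<pi> ` {p \<in> monom_span S. homogeneous d p}"
  shows "graded_group M G"
proof -
  interpret M: abelian_group M by (rule M)
  have S0: "(0 :: 'k mpoly) \<in> monom_span S" by (rule monom_span_0)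
  have closed: "x \<in> monom_span S \<Longrightarrow> \<pi> x \<in> carrier M" for x using surj by blast
  have zero: "\<pi> 0 = \<zero>\<^bsub>M\<^esub>" using ker[OF S0] monom_span_0 by blast
  have uminus: "\<pi> (- x) = \<ominus>\<^bsub>M\<^esub> \<pi> x" if x: "x \<in> monom_span S" for x
  proof -
    have x': "- x \<in> monom_span S" by (rule monom_span_uminus[OF x])
    have "\<pi> (- x) \<oplus>\<^bsub>M\<^esub> \<pi> x = \<zero>\<^bsub>M\<^esub>" using add[OF x' x] zero by simp
    then show ?thesis using M.minus_equality[OF _ closed[OF x] closed[OF x']] by simp
  qed
  have eqI: "\<pi> x = \<pi> y \<longleftrightarrow> x - y \<in> monom_span N" if x: "x \<in> monom_span S" and y: "y \<in> monom_span S" for x y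
  proof -
    have xy: "x - y \<in> monom_span S" by (rule monom_span_diff[OF x y])
    have "\<pi> x = \<pi> (x - y) \<oplus>\<^bsub>M\<^esub> \<pi> y" using add[OF xy y] by simp
    then have "\<pi> x = \<pi> y \<longleftrightarrow> \<pi> (x - y) = \<zero>\<^bsub>M\<^esub>"
      using closed[OF xy] closed[OF y] M.add.r_cancel_one'[of "\<pi> y" "\<pi> (x - y)"] by (metis M.l_zero)
    then show ?thesis using ker[OF xy] by simp
  qed
  have finsum: "(\<Oplus>\<^bsub>M\<^esub>d\<in>D. \<pi> (f d)) = \<pi> (\<Sum>d\<in>D. f d)"
    if "finite D" "\<And>d. d \<in> D \<Longrightarrow> f d \<in> monom_span S" for D :: "int set" and f
    using that
  proof (induction D rule: finite_induct)
    case empty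
    then show ?case using zero by simp
  next
    case (insert d D)
    have "(\<Oplus>\<^bsub>M\<^esub>d\<in>insert d D. \<pi> (f d)) = \<pi> (f d) \<oplus>\<^bsub>M\<^esub> (\<Oplus>\<^bsub>M\<^esub>d\<in>D. \<pi> (f d))"
      using insert closed by (intro M.finsum_insert) auto
    also have "\<dots> = \<pi> (f d + (\<Sum>d\<in>D. f d))"
      using insert by (simp add: add monom_span_sum)
    finally show ?case using insert by simp
  qed
  have sub: "additive_subgroup (G d) M" for d
  proof (rule additive_subgroupI, rule M.add.subgroupI)
    show "G d \<subseteq> carrier M" unfolding G using closed by auto
    show "G d \<noteq> {}" unfolding G using S0 by force
  next
    fix a assume "a \<in> G d"
    then obtain x where x: "a = \<pi> x" "x \<in> monom_span S" "homogeneous d x" unfolding G by blast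
    have "\<pi> (- x) \<in> G d"
      unfolding G using x monom_span_uminus homogeneous_uminus by blast
    then show "\<ominus>\<^bsub>M\<^esub> a \<in> G d" using uminus[OF x(2)] x(1) by simp
  next
    fix a b assume "a \<in> G d" "b \<in> G d"
    then obtain x y where x: "a = \<pi> x" "x \<in> monom_span S" "homogeneous d x"
      and y: "b = \<pi> y" "y \<in> monom_span S" "homogeneous d y" unfolding G by blast
    have "\<pi> (x + y) \<in> G d"
      unfolding G using monom_span_add[OF x(2) y(2)] homogeneous_add[OF x(3) y(3)] by blast
    then show "a \<oplus>\<^bsub>M\<^esub> b \<in> G d" using add[OF x(2) y(2)] x y by simp
  qed
  have "\<exists>!y. (\<forall>d. y d \<in> G d) \<and> finite {d. y d \<noteq> \<zero>\<^bsub>M\<^esub>} \<and>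
        x = (\<Oplus>\<^bsub>M\<^esub>d\<in>{d. y d \<noteq> \<zero>\<^bsub>M\<^esub>}. y d)" if "x \<in> carrier M" for x
  proof -
    have "x \<in> \<pi> ` monom_span S" using surj that by simp
    then obtain p where p: "p \<in> monom_span S" "x = \<pi> p" by (elim imageE)
    note hp = homog_comp_mem[OF p(1)]
    let ?y = "\<lambda>d. \<pi> (homog_comp d p)"
    let ?D = "{d. ?y d \<noteq> \<zero>\<^bsub>M\<^esub>}" and ?E = "(\<lambda>t. int (monom_deg t)) ` Poly_Mapping.keys p"
    show ?thesis
    proof (rule ex1I[of _ ?y], intro conjI allI)
      show "?y d \<in> G d" for d unfolding G by (rule imageI) (simp add: hp homogeneous_homog_comp)
      have DE: "?D \<subseteq> ?E"
      proof
        fix d assume d: "d \<in> ?D"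
        have "homog_comp d p \<noteq> 0" using d zero by auto
        then have "{t \<in> Poly_Mapping.keys p. int (monom_deg t) = d} \<noteq> {}"
          unfolding homog_comp_def by (metis sum.empty)
        then show "d \<in> ?E" by blast
      qed
      show fin: "finite ?D" using finite_subset[OF DE] by simp
      \<comment> \<open>A component may be nonzero as a polynomial and yet vanish in M; the
        components in such degrees, collected in \<open>?E - ?D\<close>, lie in the kernel.\<close>
      have "p = (\<Sum>d\<in>?D. homog_comp d p) + (\<Sum>d\<in>?E - ?D. homog_comp d p)"
        using sum.subset_diff[OF DE, of "\<lambda>d. homog_comp d p"] by (simp add: sum_homog_comp add.commute)
      then have "p - (\<Sum>d\<in>?D. homog_comp d p) = (\<Sum>d\<in>?E - ?D. homog_comp d p)"
        by (metis add_diff_cancel_left')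
      also have "\<dots> \<in> monom_span N" using ker[OF hp] by (intro monom_span_sum) auto
      finally have "\<pi> p = \<pi> (\<Sum>d\<in>?D. homog_comp d p)"
        using eqI[OF p(1)] hp by (simp add: monom_span_sum)
      then show "x = (\<Oplus>\<^bsub>M\<^esub>d\<in>?D. ?y d)"
        using finsum[OF fin, of "\<lambda>d. homog_comp d p"] hp p(2) by simp
    next
      fix y assume y: "(\<forall>d. y d \<in> G d) \<and> finite {d. y d \<noteq> \<zero>\<^bsub>M\<^esub>} \<and>
        x = (\<Oplus>\<^bsub>M\<^esub>d\<in>{d. y d \<noteq> \<zero>\<^bsub>M\<^esub>}. y d)"
      let ?Y = "{d. y d \<noteq> \<zero>\<^bsub>M\<^esub>}"
      have "\<exists>q. q \<in> monom_span S \<and> homogeneous d q \<and> y d = \<pi> q" for d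
      proof -
        have "y d \<in> G d" using y by simp
        then show ?thesis unfolding G by blast
      qed
      then obtain q where q: "\<And>d. q d \<in> monom_span S" "\<And>d. homogeneous d (q d)" "\<And>d. y d = \<pi> (q d)"
        by metis
      have fin: "finite ?Y" using y by blast
      have "x = (\<Oplus>\<^bsub>M\<^esub>d\<in>?Y. y d)" using y by simp
      then have "\<pi> p = (\<Oplus>\<^bsub>M\<^esub>d\<in>?Y. \<pi> (q d))" unfolding p(2) q(3)[symmetric] .
      also have "\<dots> = \<pi> (\<Sum>d\<in>?Y. q d)" by (rule finsum[OF fin q(1)])
      finally have diff: "p - (\<Sum>d\<in>?Y. q d) \<in> monom_span N"
        using eqI[OF p(1)] q(1) by (simp add: monom_span_sum)
      show "y = ?y"
      proof
        fix d
        \<comment> \<open>The difference lies in the kernel, hence so does its degree d component,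
          which fixes \<open>y d\<close>.\<close>
        have "homog_comp d (p - (\<Sum>d\<in>?Y. q d)) = homog_comp d p - (\<Sum>e\<in>?Y. if d = e then q e else 0)"
          by (simp add: homog_comp_diff homog_comp_sum homog_comp_homogeneous[OF q(2)])
        also have "(\<Sum>e\<in>?Y. if d = e then q e else 0) = (if d \<in> ?Y then q d else 0)"
          by (rule sum.delta'[OF fin])
        finally have "homog_comp d p - (if d \<in> ?Y then q d else 0) \<in> monom_span N"
          using homog_comp_mem[OF diff, of d] by simp
        moreover have "(if d \<in> ?Y then q d else 0) \<in> monom_span S" using q(1) S0 by simp
        ultimately have "?y d = \<pi> (if d \<in> ?Y then q d else 0)"
          using eqI[OF hp] by blast
        also have "\<dots> = y d" using q(3)[of d] zero by auto
        finally show "y d = ?y d" by simp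
      qed
    qed
  qed
  then show ?thesis unfolding graded_group_def using M sub by blast
qed

section \<open>Sequential Cohen-Macaulayness\<close>

context presentation
begin

interpretation Q: Module.module "poly_ring n" Q by (rule Q)

text \<open>The third isomorphism theorem, (A / B) / (D / B) = A / D. Together with
  \<open>presentation_sub\<close> it presents each factor of the filtration directly by two monomial
  ideals.\<close>

lemma presentation_quot:
  assumes D: "subideal (carrier (poly_ring n)) D" "B \<subseteq> D" "D \<subseteq> A"
  shows "presentation n (quot_module Q (\<phi> ` D)) A D (\<lambda>x. (\<phi> ` D) +>\<^bsub>Q\<^esub> \<phi> x)"
proof -
  note sub = image_submodule[OF D(1,3)]
  show ?thesis
  proof (rule presentation.intro)
    show "Module.module (poly_ring n) (quot_module Q (\<phi> ` D))" by (rule quot_module_is_module[OF Q sub])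
    show "(\<lambda>x. (\<phi> ` D) +>\<^bsub>Q\<^esub> \<phi> x) ` A = carrier (quot_module Q (\<phi> ` D))"
      unfolding quot_module_carrier[OF Q sub] surj[symmetric] by (simp add: image_image)
    fix x assume x: "x \<in> A"
    show "(\<phi> ` D) +>\<^bsub>Q\<^esub> \<phi> x = \<zero>\<^bsub>quot_module Q (\<phi> ` D)\<^esub> \<longleftrightarrow> x \<in> D"
      unfolding quot_module_zero[OF Q sub] quot_module_coset_eq_zero_iff[OF Q sub closed[OF x]]
      by (rule image_mem_iff[OF D x])
    show "(\<phi> ` D) +>\<^bsub>Q\<^esub> \<phi> (x + y) =
        ((\<phi> ` D) +>\<^bsub>Q\<^esub> \<phi> x) \<oplus>\<^bsub>quot_module Q (\<phi> ` D)\<^esub> ((\<phi> ` D) +>\<^bsub>Q\<^esub> \<phi> y)" if y: "y \<in> A" for y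
      unfolding quot_module_add[OF Q sub closed[OF x] closed[OF y]] add[OF x y] ..
    show "(\<phi> ` D) +>\<^bsub>Q\<^esub> \<phi> (c * x) = c \<odot>\<^bsub>quot_module Q (\<phi> ` D)\<^esub> ((\<phi> ` D) +>\<^bsub>Q\<^esub> \<phi> x)"
      if c: "c \<in> carrier (poly_ring n)" for c
      unfolding quot_module_smult[OF Q sub c closed[OF x]] smult[OF c x] ..
  qed (use A D in auto)
qed

lemma presentation_sub:
  assumes D: "subideal (carrier (poly_ring n)) D" "B \<subseteq> D" "D \<subseteq> A"
  shows "presentation n (Q\<lparr>carrier := \<phi> ` D\<rparr>) D B \<phi>"
proof (rule presentation.intro)
  show "Module.module (poly_ring n) (Q\<lparr>carrier := \<phi> ` D\<rparr>)"
    by (rule submodule.submodule_is_module[OF image_submodule[OF D(1,3)] Q])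
  show "\<phi> (x + y) = \<phi> x \<oplus>\<^bsub>Q\<lparr>carrier := \<phi> ` D\<rparr>\<^esub> \<phi> y" if "x \<in> D" "y \<in> D" for x y
    using add[of x y] that D(3) by auto
  show "\<phi> (c * x) = c \<odot>\<^bsub>Q\<lparr>carrier := \<phi> ` D\<rparr>\<^esub> \<phi> x"
    if "c \<in> carrier (poly_ring n)" "x \<in> D" for c x
    using smult[of c x] that D(3) by auto
  show "\<phi> x = \<zero>\<^bsub>Q\<lparr>carrier := \<phi> ` D\<rparr>\<^esub> \<longleftrightarrow> x \<in> B" if "x \<in> D" for x
    using ker[of x] that D(3) by auto
qed (use B D in auto)

end

section \<open>The polynomial ring and its edge ideals\<close>

lemma ring_as_module_simps:
  "carrier (ring_as_module R) = carrier R" "add (ring_as_module R) = add R"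
  "zero (ring_as_module R) = zero R" "smult (ring_as_module R) = monoid.mult R"
  by (simp_all add: ring_as_module_def ring.extend_def module.fields_def)

lemma ring_as_module_is_module:
  assumes "cring R"
  shows "Module.module R (ring_as_module R)"
proof -
  interpret cring R by fact
  show ?thesis
  proof (rule moduleI)
    show "abelian_group (ring_as_module R)"
      by (rule abelian_groupI) (auto simp: ring_as_module_simps a_ac l_neg intro: bexI[of _ "\<ominus>\<^bsub>R\<^esub> _"])
  qed (auto simp: ring_as_module_simps is_cring l_distr r_distr m_assoc)
qed

lemma presentation_ring:
  "presentation n (ring_as_module (poly_ring n :: 'k::field mpoly ring)) (carrier (poly_ring n)) {0} (\<lambda>x. x)"
proof (rule presentation.intro)
  show "subideal (carrier (poly_ring n)) {0 :: 'k mpoly}" by (simp add: subideal_def)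
  show "{0} \<subseteq> carrier (poly_ring n :: 'k mpoly ring)" by (simp add: carrier_poly_ring monom_span_0)
qed (simp_all add: ring_as_module_is_module cring_poly_ring subideal_carrier ring_as_module_simps)

lemma graded_ring_poly_ring: "graded_ring (poly_ring n :: 'k::field mpoly ring) (poly_grading n)"
  unfolding graded_ring_def
proof (intro conjI allI ballI)
  show "graded_group (poly_ring n :: 'k mpoly ring) (poly_grading n)"
  \<comment> \<open>The span of no monomials is the zero ideal, the kernel of the identity.\<close>
  proof (rule graded_group_of_presentation[where S = "exp_vectors n" and N = "{}" and \<pi> = "\<lambda>x. x"])
    show "x = \<zero>\<^bsub>poly_ring n\<^esub> \<longleftrightarrow> x \<in> monom_span {}" for x :: "'k mpoly"
      using sum_singles[of x] by (auto simp: monom_span_def)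
  qed (auto simp: poly_ring.abelian_group_axioms carrier_poly_ring poly_grading_def)
  fix i j and a b :: "'k mpoly" assume a: "a \<in> poly_grading n i" and b: "b \<in> poly_grading n j"
  have "a * b \<in> monom_span {t. int (monom_deg t) = i + j}"
    by (rule monom_span_mult[of a "{t. int (monom_deg t) = i}" b "{t. int (monom_deg t) = j}"])
      (use a b in \<open>auto simp: poly_grading_def monom_span_def monom_deg_add\<close>)
  then show "a \<otimes>\<^bsub>poly_ring n\<^esub> b \<in> poly_grading n (i + j)"
    using a b mult_carrier[of a n b] by (auto simp: poly_grading_def monom_span_def)
qed (rule cring_poly_ring)

text \<open>The generator x_E divides a monomial exactly when E is contained in its support, so
  membership in the ideal depends on supports only.\<close>

lemma edge_ideal_eq_monom_span:
  assumes C: "\<And>E. E \<in> C \<Longrightarrow> E \<subseteq> {1..n}"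
  shows "edge_ideal n C = (monom_span {t \<in> exp_vectors n. \<exists>E\<in>C. E \<subseteq> Poly_Mapping.keys t} :: 'k::field mpoly set)"
proof
  let ?N = "{t \<in> exp_vectors n. \<exists>E\<in>C. E \<subseteq> Poly_Mapping.keys t}"
  let ?G = "(\<lambda>E. \<Prod>j\<in>E. var j :: 'k mpoly) ` C"
  have fin: "finite E" if "E \<in> C" for E using finite_subset[OF C[OF that]] by simp
  have up: "upset n ?N" by (auto simp: upset_def keys_add_nat)
  have genN: "?G \<subseteq> monom_span ?N"
  proof
    fix p assume "p \<in> ?G"
    then obtain E where E: "E \<in> C" "p = (\<Prod>j\<in>E. var j)" by blast
    have "ind_exp E \<in> ?N" using C[OF E(1)] E(1) by (auto simp: keys_ind_exp[OF fin[OF E(1)]])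
    then show "p \<in> monom_span ?N"
      unfolding E(2) prod_var[OF fin[OF E(1)]] by (rule single_mem_monom_span)
  qed
  have NR: "monom_span ?N \<subseteq> carrier (poly_ring n)"
    unfolding carrier_poly_ring by (rule monom_span_mono) auto
  note N = subidealD[OF subideal_monom_span[OF up]]
  have "ideal (monom_span ?N) (poly_ring n :: 'k mpoly ring)"
  proof (rule idealI)
    show "subgroup (monom_span ?N) (add_monoid (poly_ring n :: 'k mpoly ring))"
    proof (rule poly_ring.add.subgroupI)
      show "monom_span ?N \<noteq> {}" using N(1) by blast
      show "\<ominus>\<^bsub>poly_ring n\<^esub> a \<in> monom_span ?N" if "a \<in> monom_span ?N" for a :: "'k mpoly"
        using N(3)[OF that] a_inv_poly_ring[of a n] NR that by auto
    qed (use NR N in auto)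
    fix a x :: "'k mpoly" assume "a \<in> monom_span ?N" "x \<in> carrier (poly_ring n)"
    then show "x \<otimes>\<^bsub>poly_ring n\<^esub> a \<in> monom_span ?N" "a \<otimes>\<^bsub>poly_ring n\<^esub> x \<in> monom_span ?N"
      using N(4)[of x a] by (simp_all add: mult.commute[of a x])
  qed (rule poly_ring.ring_axioms)
  then show "edge_ideal n C \<subseteq> (monom_span ?N :: 'k mpoly set)"
    unfolding edge_ideal_def by (rule poly_ring.genideal_minimal) (rule genN)
  have GR: "?G \<subseteq> carrier (poly_ring n)" using genN NR by blast
  have idl: "ideal (edge_ideal n C) (poly_ring n :: 'k mpoly ring)"
    unfolding edge_ideal_def by (rule poly_ring.genideal_ideal[OF GR])
  show "monom_span ?N \<subseteq> (edge_ideal n C :: 'k mpoly set)"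
  proof (rule monom_span_subset_subideal[OF poly_ring_idealD(1)[OF idl]])
    fix t and c :: 'k assume "t \<in> ?N"
    then obtain E where E: "E \<in> C" "E \<subseteq> Poly_Mapping.keys t" and t: "Poly_Mapping.keys t \<subseteq> {1..n}" by blast
    obtain q where q: "t = ind_exp E + q" "Poly_Mapping.keys q \<subseteq> Poly_Mapping.keys t"
      by (rule ind_exp_decomp[OF fin[OF E(1)] E(2)])
    have "(\<Prod>j\<in>E. var j) \<in> (edge_ideal n C :: 'k mpoly set)"
      unfolding edge_ideal_def using poly_ring.genideal_self[OF GR] E(1) by blast
    moreover have "Poly_Mapping.single q c \<in> carrier (poly_ring n)"
      unfolding carrier_poly_ring using q(2) t by (intro single_mem_monom_span) auto
    ultimately have "Poly_Mapping.single q c * (\<Prod>j\<in>E. var j) \<in> edge_ideal n C"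
      using subidealD(4)[OF poly_ring_idealD(1)[OF idl]] by blast
    then show "Poly_Mapping.single t c \<in> edge_ideal n C"
      unfolding prod_var[OF fin[OF E(1)]] q(1) by (simp add: mult_single add.commute)
  qed
qed

section \<open>Assembly of the filtration\<close>

context window_family
begin

lemma cohen_macaulay_stratum:
  fixes Q :: "('k::field mpoly, 'b) module"
  assumes S: "upset n S" and S': "upset n S'" and sub: "S' \<subseteq> S"
    and diff: "S - S' = stratum c" and ne: "stratum c \<noteq> {}"
    and pres: "presentation n Q (monom_span S) (monom_span S') \<phi>"
  shows "cohen_macaulay (poly_ring n) (poly_grading n) Q"
    and "module_dim (poly_ring n) Q = ereal (real (n - c))"
proof -
  let ?e = "esyms n (n - c) :: 'k mpoly list"
  interpret presentation n Q "monom_span S" "monom_span S'" \<phi> by (rule pres)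
  have irr: "set ?e \<subseteq> irrelevant_ideal (poly_ring n) (poly_grading n)"
    by (auto simp: set_esyms intro!: esym_irrelevant)
  have car: "set ?e \<subseteq> carrier (poly_ring n)" by (auto simp: set_esyms esym_carrier)
  have adj: "adjoin_all ?e (monom_span S) (monom_span S') \<noteq> monom_span S"
    by (rule adjoin_all_stratum[OF S S' _ sub]) (simp add: diff ne)
  \<comment> \<open>The bottom prime of a chain over the annihilator contains c variables, so the
    length of the chain is bounded by the number n - c of the others.\<close>
  have bound: "r \<le> length ?e"
    if chain: "prime_chain_over (poly_ring n) (annihilator (poly_ring n) Q) r P" for P r
  proof -
    have P: "primeideal (P 0) (poly_ring n)" and ann: "annihilator (poly_ring n) Q \<subseteq> P 0"
      using chain by (auto simp: prime_chain_over_def)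
    obtain T where T: "T \<subseteq> {1..n}" "card T = c" "\<And>t. t \<in> T \<Longrightarrow> var t \<in> P 0"
    proof (rule prime_contains_vars[OF S S' diff P])
      fix u :: "'k mpoly"
      assume u: "u \<in> carrier (poly_ring n)" and kill: "\<And>p. p \<in> monom_span S \<Longrightarrow> u * p \<in> monom_span S'"
      have "u \<odot>\<^bsub>Q\<^esub> q = \<zero>\<^bsub>Q\<^esub>" if "q \<in> carrier Q" for q
      proof -
        have "q \<in> \<phi> ` monom_span S" using surj that by simp
        then obtain p where p: "p \<in> monom_span S" "q = \<phi> p" by (elim imageE)
        have "\<phi> (u * p) = \<zero>\<^bsub>Q\<^esub>"
          using ker[of "u * p"] kill[OF p(1)] BA by blast
        then show ?thesis using smult[OF u p(1)] p(2) by simp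
      qed
      then show "u \<in> P 0" using ann u by (auto simp: annihilator_def)
    qed blast
    have "r \<le> card ({1..n} - T)" by (rule prime_chain_length_bound[OF chain T(1,3)])
    also have "\<dots> = n - c" using T finite_subset[OF T(1)] by (simp add: card_Diff_subset)
    finally show ?thesis by (simp add: length_esyms)
  qed
  note cm = cohen_macaulay_of_regular[OF weakly_regular_stratum[OF S S' sub diff] irr car adj bound]
  show "cohen_macaulay (poly_ring n) (poly_grading n) Q" by (rule cm(1))
  show "module_dim (poly_ring n) Q = ereal (real (n - c))" using cm(2) by (simp add: length_esyms)
qed

lemma sequentially_cohen_macaulay_windows:
  fixes R :: "'k::field mpoly ring" and I :: "'k mpoly set"
  assumes R: "R = poly_ring n" and I: "I = monom_span {t \<in> exp_vectors n. nonface t}"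
  shows "sequentially_cohen_macaulay R (poly_grading n)
    (quot_module (ring_as_module R) I)
    (quot_grading (ring_as_module R) I (poly_grading n))"
proof -
  define N where "N = {t \<in> exp_vectors n. nonface t}"
  define M where "M = quot_module (ring_as_module R) I"
  define \<pi> where "\<pi> = (\<lambda>x. I +>\<^bsub>ring_as_module R\<^esub> x)"
  define G where "G = quot_grading (ring_as_module R) I (poly_grading n)"
  have IN: "I = monom_span N" by (simp add: I N_def)
  have upN: "upset n N" using nonface_add by (auto simp: upset_def N_def keys_add_nat)
  have carR: "carrier R = monom_span (exp_vectors n)" by (simp add: R carrier_poly_ring)
  have I_sub: "subideal (carrier (poly_ring n)) I" unfolding IN by (rule subideal_monom_span[OF upN])
  have span_car: "monom_span U \<subseteq> carrier (poly_ring n :: 'k mpoly ring)" if "upset n U" for U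
    unfolding carrier_poly_ring by (rule monom_span_mono) (use that in \<open>simp add: upset_def\<close>)
  have "presentation n (quot_module (ring_as_module (poly_ring n)) ((\<lambda>x. x) ` I)) (carrier (poly_ring n)) I
      (\<lambda>x. ((\<lambda>x. x) ` I) +>\<^bsub>ring_as_module (poly_ring n)\<^esub> x)"
    using I_sub span_car[OF upN] subidealD(1)[OF I_sub]
    by (intro presentation.presentation_quot[OF presentation_ring]) (auto simp: IN)
  then have presM: "presentation n M (carrier (poly_ring n)) I \<pi>"
    by (simp add: M_def \<pi>_def R)
  interpret M: presentation n M "carrier (poly_ring n)" I \<pi> by (rule presM)

  \<comment> \<open>Only sizes that occur are listed, so that the inclusions are strict and the
    factors nonzero. They decrease, so that the dimensions n - c increase.\<close>
  define cs where "cs = rev (sorted_list_of_set {c. stratum c \<noteq> {}})"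
  have fin: "finite {c. stratum c \<noteq> {}}"
    by (rule finite_subset[of _ "{..n}"]) (auto simp: stratum_def dest: length_transversal_le)
  have set_cs: "set cs = {c. stratum c \<noteq> {}}" using fin by (simp add: cs_def)
  have cs_desc: "cs ! j < cs ! i" if "i < j" "j < length cs" for i j
    using that strict_sorted_list_of_set[of "{c. stratum c \<noteq> {}}"]
    unfolding cs_def by (simp add: rev_nth sorted_wrt_nth_less)
  \<comment> \<open>The dimensions are truncated differences n - c; they increase strictly because c
    never exceeds n.\<close>
  have cs_n: "cs ! i \<le> n" if i: "i < length cs" for i
  proof -
    obtain t where "t \<in> stratum (cs ! i)" using nth_mem[OF i] unfolding set_cs by blast
    then show ?thesis using length_transversal_le[of t] by (simp add: stratum_def)
  qed
  define S where "S i = N \<union> (\<Union>c\<in>set (take i cs). stratum c)" for i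
  have S_mem: "t \<in> S i \<longleftrightarrow> t \<in> N \<or> (\<not> nonface t \<and> length (transversal t) \<in> set (take i cs))"
    if "t \<in> exp_vectors n" for t i
    using that unfolding S_def stratum_def by blast
  have stratum_mem: "length (transversal t) \<in> set cs" if "t \<in> exp_vectors n" "\<not> nonface t" for t
    using that unfolding set_cs stratum_def by blast
  have upS: "upset n (S i)" for i
    unfolding upset_def
  proof (intro conjI ballI)
    show S_exp: "S i \<subseteq> exp_vectors n" unfolding S_def N_def stratum_def by blast
    fix s t assume s: "s \<in> exp_vectors n" and t: "t \<in> S i"
    then have t': "t \<in> exp_vectors n" using S_exp by blast
    have st: "s + t \<in> exp_vectors n" using s t' by (simp add: keys_add_nat)
    show "s + t \<in> S i"
    proof (cases "nonface (s + t)")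
      case True
      then show ?thesis using st by (simp add: S_def N_def)
    next
      case False
      then have nft: "\<not> nonface t" using nonface_add by blast
      then have "length (transversal t) \<in> set (take i cs)"
        using t S_mem[OF t'] by (auto simp: N_def)
      then obtain j where j: "j < i" "j < length cs" "cs ! j = length (transversal t)"
        by (auto simp: in_set_conv_nth)
      obtain j' where j': "j' < length cs" "cs ! j' = length (transversal (s + t))"
        using stratum_mem[OF st False] by (auto simp: in_set_conv_nth)
      \<comment> \<open>Multiplication cannot shrink the transversal and \<open>cs\<close>
        decreases, so the size of the new transversal occurs no later in \<open>cs\<close>.\<close>
      have "\<not> j < j'"
        using cs_desc[of j j'] j j' transversal_add(1)[OF False] by auto
      then have "length (transversal (s + t)) \<in> set (take i cs)"
        using j j' by (auto simp: in_set_conv_nth intro!: exI[of _ j'])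
      then show ?thesis using S_mem[OF st] False by blast
    qed
  qed
  have S_sub: "S i \<subseteq> S (Suc i)" for i
    unfolding S_def using set_take_subset_set_take[of i "Suc i" cs] by auto
  have S_diff: "S (Suc i) - S i = stratum (cs ! i)" if i: "i < length cs" for i
  proof -
    have "cs ! i \<notin> set (take i cs)"
      using cs_desc i by (auto simp: in_set_conv_nth) (metis less_irrefl)
    then show ?thesis
      unfolding S_def take_Suc_conv_app_nth[OF i] by (auto simp: stratum_def N_def)
  qed
  have S_ne: "stratum (cs ! i) \<noteq> {}" if "i < length cs" for i
    using nth_mem[OF that] unfolding set_cs by blast
  have S_0: "S 0 = N" by (simp add: S_def)
  have S_top: "S (length cs) = exp_vectors n"
  proof
    show "exp_vectors n \<subseteq> S (length cs)"
      using S_mem[where i = "length cs"] stratum_mem by (auto simp: N_def)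
  qed (use upS in \<open>simp add: upset_def\<close>)
  have NS: "I \<subseteq> monom_span (S i)" for i unfolding IN by (rule monom_span_mono) (simp add: S_def)
  note S_subideal = subideal_monom_span[OF upS]

  define F where "F i = \<pi> ` monom_span (S i)" for i
  have F_mem: "\<pi> x \<in> F i \<longleftrightarrow> x \<in> monom_span (S i)" if "x \<in> carrier (poly_ring n)" for x i
    unfolding F_def by (rule M.image_mem_iff[OF S_subideal NS span_car[OF upS] that])
  have pres_F: "presentation n (M\<lparr>carrier := F i\<rparr>) (monom_span (S i)) I \<pi>" for i
    unfolding F_def by (rule M.presentation_sub[OF S_subideal NS span_car[OF upS]])
  have G_eq: "G d = \<pi> ` {p \<in> carrier (poly_ring n). homogeneous d p}" for d
    by (simp add: G_def quot_grading_def \<pi>_def R poly_grading_def)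
  have graded_F: "graded_group (M\<lparr>carrier := F i\<rparr>) (\<lambda>d. F i \<inter> G d)" for i
  proof -
    interpret Fi: presentation n "M\<lparr>carrier := F i\<rparr>" "monom_span (S i)" I \<pi> by (rule pres_F)
    show ?thesis
    proof (rule graded_group_of_presentation[where S = "S i" and N = N and \<pi> = \<pi>])
      show "abelian_group (M\<lparr>carrier := F i\<rparr>)" using Fi.Q by (rule Module.module.axioms)
      \<comment> \<open>A homogeneous representative of an element of \<open>F i\<close> already
        lies in \<open>monom_span (S i)\<close>, because this set contains the kernel I.\<close>
      show "F i \<inter> G d = \<pi> ` {p \<in> monom_span (S i). homogeneous d p}" for d
      proof
        show "F i \<inter> G d \<subseteq> \<pi> ` {p \<in> monom_span (S i). homogeneous d p}"
        proof
          fix X assume X: "X \<in> F i \<inter> G d"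
          then obtain p where p: "p \<in> carrier (poly_ring n)" "homogeneous d p" "X = \<pi> p"
            unfolding G_eq by blast
          then show "X \<in> \<pi> ` {p \<in> monom_span (S i). homogeneous d p}"
            using X F_mem[OF p(1)] by blast
        qed
        show "\<pi> ` {p \<in> monom_span (S i). homogeneous d p} \<subseteq> F i \<inter> G d"
          unfolding F_def G_eq using span_car[OF upS[of i]] by blast
      qed
    qed (rule Fi.surj Fi.add Fi.ker[unfolded IN] | assumption)+
  qed
  have F_top: "F (length cs) = carrier M"
    unfolding F_def S_top M.surj[symmetric] carrier_poly_ring ..
  have "graded_group M G"
  proof -
    have "F (length cs) \<inter> G d = G d" for d
      unfolding F_top G_eq using M.closed by blast
    then show ?thesis using graded_F[of "length cs"] unfolding F_top by simp
  qed
  moreover have "a \<odot>\<^bsub>M\<^esub> X \<in> G (i + j)" if a: "a \<in> poly_grading n i" and X: "X \<in> G j" for i j a X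
  proof -
    obtain p where p: "p \<in> poly_grading n j" "X = \<pi> p"
      using X unfolding G_def quot_grading_def \<pi>_def by blast
    have car: "a \<in> carrier (poly_ring n)" "p \<in> carrier (poly_ring n)"
      using a p by (simp_all add: poly_grading_def)
    have "a * p \<in> poly_grading n (i + j)"
      using graded_ring_poly_ring[of n, where 'k = 'k] a p(1) unfolding graded_ring_def by auto
    then have "\<pi> (a * p) \<in> G (i + j)" unfolding G_def quot_grading_def \<pi>_def by blast
    then show ?thesis using M.smult[OF car] p(2) by simp
  qed
  ultimately have graded_M: "graded_module R (poly_grading n) M G"
    unfolding graded_module_def R using graded_ring_poly_ring M.Q by blast

  let ?Q = "\<lambda>i. quot_module (M\<lparr>carrier := F (Suc i)\<rparr>) (F i)"
  have pres_Q: "presentation n (?Q i) (monom_span (S (Suc i))) (monom_span (S i))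
      (\<lambda>x. F i +>\<^bsub>M\<lparr>carrier := F (Suc i)\<rparr>\<^esub> \<pi> x)" for i
    using presentation.presentation_quot[OF pres_F[of "Suc i"] S_subideal NS monom_span_mono[OF S_sub]]
    unfolding F_def[symmetric] .
  have CM: "cohen_macaulay R (poly_grading n) (?Q i)" "module_dim R (?Q i) = ereal (real (n - cs ! i))"
    if "i < length cs" for i
    unfolding R
    by (rule cohen_macaulay_stratum[OF upS upS S_sub S_diff[OF that] S_ne[OF that] pres_Q])+
  have "F 0 = {\<zero>\<^bsub>M\<^esub>}"
  proof -
    have "\<pi> x = \<zero>\<^bsub>M\<^esub>" if "x \<in> I" for x using M.ker[of x] M.BA that by blast
    then show ?thesis unfolding F_def S_0 IN[symmetric] using subidealD(1)[OF I_sub] by force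
  qed
  moreover have "graded_submodule (F i) R M G" for i
    unfolding graded_submodule_def R
    using graded_F M.image_submodule[OF S_subideal span_car[OF upS]] by (simp add: F_def)
  moreover have "F i \<subset> F (Suc i)" if i: "i < length cs" for i
  proof -
    obtain t where t: "t \<in> S (Suc i)" "t \<notin> S i" using S_diff[OF i] S_ne[OF i] by blast
    let ?x = "Poly_Mapping.single t 1 :: 'k mpoly"
    have "?x \<in> monom_span (S (Suc i))" "?x \<notin> monom_span (S i)"
      using t by (simp_all add: monom_span_def)
    moreover from this have "?x \<in> carrier (poly_ring n)" using span_car[OF upS] by blast
    ultimately have "\<pi> ?x \<in> F (Suc i)" "\<pi> ?x \<notin> F i" using F_mem by blast+
    moreover have "F i \<subseteq> F (Suc i)" unfolding F_def by (intro image_mono monom_span_mono S_sub)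
    ultimately show ?thesis by blast
  qed
  moreover have "module_dim R (?Q i) < module_dim R (?Q (Suc i))" if i: "Suc i < length cs" for i
    using CM(2)[of i] CM(2)[OF i] cs_desc[of i "Suc i"] cs_n[of i] i by simp
  ultimately show ?thesis
    unfolding sequentially_cohen_macaulay_def M_def[symmetric] G_def[symmetric] Let_def
    using graded_M F_top CM(1) by (intro conjI exI[of _ "length cs"] exI[of _ F]) auto
qed

end

theorem proposition2p7:
  fixes k l m n :: nat
    and R :: "'k::field mpoly ring"
    and I :: "'k mpoly set"
  assumes "0 < k" and "0 < l" and "0 < m" and "l \<le> m"
    and "n = k * (m - l) + l"
    and "R = poly_ring n"
    and "I = edge_ideal n (path_clutter m l k)"
  shows "sequentially_cohen_macaulay R (poly_grading n)
           (quot_module (ring_as_module R) I)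
           (quot_grading (ring_as_module R) I (poly_grading n))"
proof -
  \<comment> \<open>The starts of the windows, counted from i = 0. For l = m they all coincide,
    which \<open>sorted\<close> permits, and the clutter has a single edge.\<close>
  define as where "as = map (\<lambda>i. i * (m - l) + 1) [0..<k]"
  have clutter: "path_clutter m l k = (\<lambda>a. {a..<a + m}) ` set as"
  proof -
    have k: "{1..k} = Suc ` {0..<k}"
      by (simp add: image_Suc_atLeastLessThan atLeastLessThanSuc_atLeastAtMost)
    show ?thesis
      unfolding path_clutter_def k as_def set_map set_upt image_image
      by (intro image_cong) auto
  qed
  have E: "E \<subseteq> {1..n}" if "E \<in> path_clutter m l k" for E
    using clutter_path_clutter[of m l n k] assms that by (simp add: clutter_def)
  interpret window_family n m as
  proof
    show "sorted as" by (simp add: as_def sorted_iff_nth_mono)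
    show "{a..<a + m} \<subseteq> {1..n}" if "a \<in> set as" for a using E that unfolding clutter by blast
  qed
  have "I = monom_span {t \<in> exp_vectors n. nonface t}"
    using edge_ideal_eq_monom_span[of "path_clutter m l k" n, OF E] assms(7)
    by (simp add: clutter covers_window_def)
  then show ?thesis by (rule sequentially_cohen_macaulay_windows[OF assms(6)])
qed

end
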